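(* Let $\mathbb{F}$ be $\mathbb{C}$ or $\mathbb{F}_p$ ($p$ prime). For all $0<\alpha<1$ there is a constant $C=C(\alpha)>0$ such that the following holds for all $N>0$. Let $Y\subseteq\mathbb{F}$ with $|Y|=N$ and let $L$ be a set of lines in $\mathbb{F}^2$ in general position, each $\alpha$-rich in $Y\times Y$. \begin{itemize} \item If $\mathbb{F}=\mathbb{C}$, then $|L|\ll_\alpha N^{C/\log\log N}$. \item If $\mathbb{F}=\mathbb{F}_p$, the same conclusion holds provided that $N^{1+\log(2/\alpha)/\log\log N}\leq p$. \end{itemize}
   Context: A line $\ell$ is $\alpha$-rich in $Y\times Y$ if $|\ell\cap(Y\times Y)|\geq\alpha|Y|$. A set of lines is in general position if no two are parallel and no three pass through a common point. Lines are graphs of affine maps $x\mapsto ax+b$ with $a\neq 0$. $f\ll_\alpha g$ means $f\leq cg$ for a constant $c$ depending only on $\alpha$. *)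

theory Defs
  imports
    Complex_Main
    "HOL-Number_Theory.Residues"
    "HOL-Algebra.Algebraic_Closure_Type"
begin

text \<open>
  The constants in the theorem must not depend on the prime \<open>p\<close>, so the field is a ring record
  (which can be quantified over inside a formula) rather than a type of class \<open>field\<close>.
  The records used are \<open>ring_of_type_algebra :: complex ring\<close> and \<open>residue_ring (int p)\<close>.
\<close>

definition affine_graph :: "'a ring \<Rightarrow> 'a \<Rightarrow> 'a \<Rightarrow> ('a \<times> 'a) set" where
  "affine_graph F a b = {(x, a \<otimes>\<^bsub>F\<^esub> x \<oplus>\<^bsub>F\<^esub> b) | x. x \<in> carrier F}"

definition lines :: "'a ring \<Rightarrow> ('a \<times> 'a) set set" where
  "lines F = {affine_graph F a b | a b. a \<in> carrier F \<and> b \<in> carrier F \<and> a \<noteq> \<zero>\<^bsub>F\<^esub>}"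

text \<open>A line counts as parallel to itself; \<open>general_position\<close> only compares distinct lines.\<close>

definition parallel :: "'a ring \<Rightarrow> ('a \<times> 'a) set \<Rightarrow> ('a \<times> 'a) set \<Rightarrow> bool" where
  "parallel F l m \<longleftrightarrow>
     (\<exists>a\<in>carrier F. \<exists>b\<in>carrier F. \<exists>c\<in>carrier F. l = affine_graph F a b \<and> m = affine_graph F a c)"

definition general_position :: "'a ring \<Rightarrow> ('a \<times> 'a) set set \<Rightarrow> bool" where
  "general_position F L \<longleftrightarrow>
     (\<forall>l\<in>L. \<forall>m\<in>L. l \<noteq> m \<longrightarrow> \<not> parallel F l m) \<and>
     (\<forall>l\<in>L. \<forall>m\<in>L. \<forall>n\<in>L. l \<noteq> m \<and> m \<noteq> n \<and> l \<noteq> n \<longrightarrow> l \<inter> m \<inter> n = {})"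

definition rich :: "real \<Rightarrow> 'a set \<Rightarrow> ('a \<times> 'a) set \<Rightarrow> bool" where
  "rich \<alpha> Y l \<longleftrightarrow> real (card (l \<inter> Y \<times> Y)) \<ge> \<alpha> * real (card Y)"

end

theory Submission
  imports
    Defs
    "HOL-Analysis.Convex"
    "HOL-Library.Set_Algebras"
    "HOL-Algebra.Multiplicative_Group"
    "HOL-Real_Asymp.Real_Asymp"
begin

text \<open>
  Regard the lines as elements of the group of affine maps and let \<open>\<nu>\<^sub>0\<close> be the uniform
  measure on them, \<open>\<nu>\<^sub>j\<^sub>+\<^sub>1(x) = \<Sum>\<^sub>g \<nu>\<^sub>j(g) \<nu>\<^sub>j(g x)\<close>. By Cauchy-Schwarz an average map under
  \<open>\<nu>\<^sub>j\<close> is still \<open>\<alpha>^(2^j)\<close>-rich, and there are few rich affine maps, so the \<open>L\<^sup>2\<close>-norm of \<open>\<nu>\<^sub>j\<close>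
  is at least a negative power of \<open>N\<close> for \<open>2^j\<close> up to \<open>sqrt (ln N)\<close>. Over \<open>F\<^sub>p\<close> the lower bound is even
  of the order of \<open>1 / p\<close>; this is where \<open>p\<close> has to be large compared with \<open>N\<close>. As there are about
  \<open>ln (ln N)\<close> steps, at one of them the norm drops by a factor of at most \<open>K = N^(O(1) / ln (ln N))\<close>.

  By the Balog-Szemeredi-Gowers theorem the measure at this step gives mass at least \<open>K^(-O(1))\<close> to a
  translate of an approximate subgroup \<open>H\<close>. General position says that \<open>\<nu>\<^sub>0\<close>, hence every \<open>\<nu>\<^sub>j\<close>,
  gives mass at most \<open>2 / |L|\<close> to the maps of a given slope and to the maps taking a given point to a
  given point. If \<open>|L|\<close> exceeds a large power of \<open>K\<close>, then \<open>H\<close> is not commutative and has many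
  slopes. Letting these slopes act on the translations in \<open>H\<^sup>4\<close>, a pivoting argument produces so many
  translations in \<open>H\<^sup>3\<^sup>4\<close> that \<open>H\<^sup>3\<^sup>5\<close> is too large for an approximate subgroup.
\<close>

section \<open>Approximate subgroups\<close>

text \<open>Two steps are taken at a time because the flatness hypothesis compares the supremum of a
  measure with the squared norm of its autocorrelation: the supremum of
  \<open>\<nu>\<^sub>j\<^sub>+\<^sub>1\<close> is at most the squared norm of
  \<open>\<nu>\<^sub>j\<close>, so \<open>\<nu>\<^sub>j\<^sub>+\<^sub>1\<close> is flat as soon as
  the norm of \<open>\<nu>\<^sub>j\<^sub>+\<^sub>2\<close> is not much smaller than that of
  \<open>\<nu>\<^sub>j\<close>.

  The contradiction is a count. Each slope carries mass at most 2 / |L|, so a heavy translate of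
  \<open>H\<close> forces the number n of slopes of \<open>H\<close> to be at least |L| / K^O(1).
  With u the number of translations in \<open>H^4\<close>, |H| is at most u n, and pivoting tries to
  produce about u n translations, to be multiplied by n once more through representatives of the
  slopes; small growth then gives n at most K^O(1).

  In a finite field pivoting may instead fill half of all p translations. Then u is at least p /
  K^O(1), and n is bounded only if |H| is at most K^O(1) p. This is why the norm has to be bounded
  below by 1 / p there, and not merely by 1 / N^2.

  All numerical constants are absorbed into powers of \<open>K\<close>, which is at least 2.\<close>

lemma real_card_filter:
  "finite A \<Longrightarrow> real (card {x\<in>A. P x}) = (\<Sum>x\<in>A. of_bool (P x))"
  by (simp add: Collect_conj_eq)

lemma card_times_fibre_le:
  fixes k :: real
  assumes "finite S" "finite C" "\<And>c. c \<in> C \<Longrightarrow> k \<le> real (card {s\<in>S. f s = c})"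
  shows "k * real (card C) \<le> real (card S)"
proof -
  have "k * real (card C) \<le> (\<Sum>c\<in>C. real (card {s\<in>S. f s = c}))"
    using sum_mono[of C "\<lambda>_. k" "\<lambda>c. real (card {s\<in>S. f s = c})"] assms(3)
    by (simp add: mult.commute)
  also have "\<dots> = real (card (\<Union>c\<in>C. {s\<in>S. f s = c}))"
    by (subst card_UN_disjoint) (use assms in auto)
  also have "\<dots> \<le> real (card S)"
    using assms by (intro of_nat_mono card_mono) auto
  finally show ?thesis .
qed

theorem balog_szemeredi_gowers:
  fixes A D :: "'g::group_add set" and q :: real
  assumes finA: "finite A" and finD: "finite D" and A: "A \<noteq> {}" and q: "q > 0"
    and symD: "\<And>x. x \<in> D \<Longrightarrow> - x \<in> D"
    and dense: "(real (card A))\<^sup>2 / q \<le> real (card {p\<in>A \<times> A. - fst p + snd p \<in> D})"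
  obtains V where "V \<subseteq> A" "real (card A) / (4 * q) \<le> real (card V)"
    "real (card ((\<lambda>(a, b). - a + b) ` (V \<times> V))) * real (card A) ^ 3 \<le> 1024 * q ^ 5 * real (card D) ^ 4"
proof -
  define n where "n = real (card A)"
  have n: "n > 0" using finA A by (auto simp: n_def card_gt_0_iff)
  define adj where "adj a b \<longleftrightarrow> - a + b \<in> D" for a b
  have adj_imp: "adj b a" if "adj a b" for a b
    using symD[of "- a + b"] that by (simp add: adj_def minus_add)
  have adj_sym: "adj a b \<longleftrightarrow> adj b a" for a b
    using adj_imp by blast
  define N where "N c = {a\<in>A. adj a c}" for c
  have finN: "finite (N c)" for c using finA by (simp add: N_def)
  define d where "d c = real (card (N c))" for c
  have "real (card {p\<in>A \<times> A. - fst p + snd p \<in> D}) = (\<Sum>p\<in>A \<times> A. of_bool (adj (fst p) (snd p)))"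
    using finA by (simp add: real_card_filter adj_def del: sum_of_bool_eq)
  also have "\<dots> = (\<Sum>a\<in>A. \<Sum>c\<in>A. of_bool (adj a c))"
    by (simp add: sum.cartesian_product case_prod_beta)
  also have "\<dots> = (\<Sum>c\<in>A. d c)"
    by (subst sum.swap) (use finA in \<open>simp add: d_def N_def real_card_filter del: sum_of_bool_eq\<close>)
  finally have sum_d: "n\<^sup>2 / q \<le> (\<Sum>c\<in>A. d c)" using dense by (simp add: n_def)
  have "(n\<^sup>2 / q)\<^sup>2 \<le> (\<Sum>c\<in>A. d c)\<^sup>2"
    using sum_d q by (intro power_mono) auto
  also have "\<dots> \<le> (\<Sum>c\<in>A. (d c)\<^sup>2) * n"
    unfolding n_def by (rule sum_squared_le_sum_of_squares)
  finally have sum_d2: "n ^ 3 / q\<^sup>2 \<le> (\<Sum>c\<in>A. (d c)\<^sup>2)"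
  proof -
    assume "(n\<^sup>2 / q)\<^sup>2 \<le> (\<Sum>c\<in>A. (d c)\<^sup>2) * n"
    moreover have "(n\<^sup>2 / q)\<^sup>2 = n ^ 3 / q\<^sup>2 * n" by (simp add: power_divide eval_nat_numeral)
    ultimately have "n ^ 3 / q\<^sup>2 * n \<le> (\<Sum>c\<in>A. (d c)\<^sup>2) * n" by linarith
    then show ?thesis using n by (rule mult_right_le_imp_le)
  qed
  \<comment> \<open>A bad pair has fewer than \<open>\<theta> * n\<close> common neighbours. This
    value makes \<open>8 * (\<theta> * n ^ 3)\<close> half of the lower bound
    \<open>n ^ 3 / q\<^sup>2\<close> for the sum of squared degrees.\<close>
  define \<theta> where "\<theta> = 1 / (16 * q\<^sup>2)"
  have \<theta>: "\<theta> > 0" using q by (simp add: \<theta>_def)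
  define W where "W a b = {c\<in>A. adj a c \<and> adj b c}" for a b
  define bad where "bad a b \<longleftrightarrow> real (card (W a b)) < \<theta> * n" for a b
  define B where "B c = real (card {p\<in>N c \<times> N c. bad (fst p) (snd p)})" for c
  have "(\<Sum>c\<in>A. B c) = (\<Sum>c\<in>A. \<Sum>p\<in>A \<times> A. of_bool (adj (fst p) c \<and> adj (snd p) c \<and> bad (fst p) (snd p)))"
  proof (rule sum.cong)
    fix c
    have "{p\<in>N c \<times> N c. bad (fst p) (snd p)}
        = {p\<in>A \<times> A. adj (fst p) c \<and> adj (snd p) c \<and> bad (fst p) (snd p)}"
      by (auto simp: N_def)
    then show "B c = (\<Sum>p\<in>A \<times> A. of_bool (adj (fst p) c \<and> adj (snd p) c \<and> bad (fst p) (snd p)))"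
      using finA by (simp add: B_def real_card_filter del: sum_of_bool_eq)
  qed simp
  also have "\<dots> = (\<Sum>p\<in>A \<times> A. \<Sum>c\<in>A. of_bool (adj (fst p) c \<and> adj (snd p) c \<and> bad (fst p) (snd p)))"
    by (rule sum.swap)
  also have "\<dots> \<le> (\<Sum>p\<in>A \<times> A. \<theta> * n)"
  proof (rule sum_mono)
    fix p
    show "(\<Sum>c\<in>A. of_bool (adj (fst p) c \<and> adj (snd p) c \<and> bad (fst p) (snd p))) \<le> \<theta> * n"
    proof (cases "bad (fst p) (snd p)")
      case True
      then have "(\<Sum>c\<in>A. of_bool (adj (fst p) c \<and> adj (snd p) c \<and> bad (fst p) (snd p)))
          = real (card (W (fst p) (snd p)))"
        using finA by (simp add: W_def real_card_filter del: sum_of_bool_eq)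
      with True show ?thesis by (simp add: bad_def)
    qed (use \<theta> n in simp)
  qed
  also have "\<dots> = \<theta> * n ^ 3"
    by (simp add: card_cartesian_product n_def power3_eq_cube)
  finally have sum_B: "(\<Sum>c\<in>A. B c) \<le> \<theta> * n ^ 3" .
  \<comment> \<open>Averaging the difference yields one vertex with both properties: large degree,
    and at most an eighth of the pairs in its neighbourhood bad.\<close>
  have "\<exists>c\<in>A. n\<^sup>2 / (2 * q\<^sup>2) \<le> (d c)\<^sup>2 - 8 * B c"
  proof (rule ccontr)
    assume "\<not> ?thesis"
    then have "(\<Sum>c\<in>A. (d c)\<^sup>2 - 8 * B c) < (\<Sum>c\<in>A. n\<^sup>2 / (2 * q\<^sup>2))"
      using finA A by (intro sum_strict_mono) auto
    also have "\<dots> = n ^ 3 / (2 * q\<^sup>2)"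
      by (simp add: n_def power2_eq_square power3_eq_cube)
    finally have "(\<Sum>c\<in>A. (d c)\<^sup>2) - 8 * (\<Sum>c\<in>A. B c) < n ^ 3 / (2 * q\<^sup>2)"
      by (simp add: sum_subtractf sum_distrib_left)
    moreover have "8 * (\<theta> * n ^ 3) = n ^ 3 / (2 * q\<^sup>2)" by (simp add: \<theta>_def)
    ultimately show False using sum_d2 sum_B by (simp add: field_simps)
  qed
  then obtain c where c: "c \<in> A" "n\<^sup>2 / (2 * q\<^sup>2) \<le> (d c)\<^sup>2 - 8 * B c" by blast
  have Bpos: "B c \<ge> 0" by (simp add: B_def)
  have dpos: "d c \<ge> 0" by (simp add: d_def)
  have "(n / (2 * q))\<^sup>2 \<le> (d c)\<^sup>2"
  proof -
    have "(n / (2 * q))\<^sup>2 \<le> n\<^sup>2 / (2 * q\<^sup>2)" using q by (simp add: power_divide power_mult_distrib divide_simps)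
    with c(2) Bpos show ?thesis by linarith
  qed
  then have d_lower: "n / (2 * q) \<le> d c" using dpos n q by (simp add: power2_le_iff_abs_le)
  have d_pos: "d c > 0" using d_lower n q by (smt (verit) divide_pos_pos)
  have B_upper: "8 * B c \<le> (d c)\<^sup>2"
  proof -
    have "0 \<le> n\<^sup>2 / (2 * q\<^sup>2)" by simp
    with c(2) show ?thesis by linarith
  qed
  define bd where "bd a = real (card {b\<in>N c. bad a b})" for a
  have sum_bd: "(\<Sum>a\<in>N c. bd a) = B c"
    unfolding B_def bd_def real_card_filter[OF finN] real_card_filter[OF finite_cartesian_product[OF finN finN]]
    by (simp add: sum.cartesian_product case_prod_beta del: sum_of_bool_eq)
  \<comment> \<open>By Markov's inequality at least half of the neighbourhood has no more than
    \<open>d c / 4\<close> bad partners.\<close>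
  define V where "V = {a\<in>N c. bd a \<le> d c / 4}"
  have finV: "finite V" using finN by (simp add: V_def)
  have "(d c / 4) * real (card (N c - V)) \<le> (\<Sum>a\<in>N c - V. bd a)"
    using sum_mono[of "N c - V" "\<lambda>_. d c / 4" bd] by (force simp: V_def mult.commute)
  also have "\<dots> \<le> (\<Sum>a\<in>N c. bd a)" using finN by (intro sum_mono2) (auto simp: bd_def)
  finally have "(d c / 4) * real (card (N c - V)) \<le> (d c)\<^sup>2 / 8" using sum_bd B_upper by simp
  then have "real (card (N c - V)) \<le> d c / 2" using d_pos by (simp add: power2_eq_square field_simps)
  moreover have "real (card (N c - V)) = d c - real (card V)"
    using finV finN card_mono[of "N c" V] by (subst card_Diff_subset) (auto simp: V_def d_def of_nat_diff)
  ultimately have V_lower: "d c / 2 \<le> real (card V)" by simp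
  let ?X = "(\<lambda>(a, b). - a + b) ` (V \<times> V)"
  \<comment> \<open>Lower bound for the number of paths \<open>a, c1, v, c2, b\<close>:
    \<open>d c / 2\<close> choices of \<open>v\<close>, as \<open>a\<close> and \<open>b\<close>
    exclude at most \<open>d c / 4\<close> each, and \<open>\<theta> * n\<close> choices for each of
    \<open>c1\<close> and \<open>c2\<close>.\<close>
  define k where "k = (d c / 2) * (\<theta> * n)\<^sup>2"
  have "k * real (card ?X) \<le> real (card (D \<times> D \<times> D \<times> D))"
  proof (rule card_times_fibre_le[where f = "\<lambda>(x, y, z, w). x + y + z + w"])
    fix x assume "x \<in> ?X"
    then obtain a b where ab: "a \<in> V" "b \<in> V" "x = - a + b" by auto
    define G where "G = {v\<in>N c. \<not> bad a v \<and> \<not> bad b v}"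
    define T where "T = (SIGMA v:G. W a v \<times> W v b)"
    have W_sym: "W e f = W f e" for e f by (auto simp: W_def)
    have finW: "finite (W e f)" for e f using finA by (simp add: W_def)
    have "real (card (N c)) \<le> real (card (G \<union> {v\<in>N c. bad a v} \<union> {v\<in>N c. bad b v}))"
      using finN by (intro of_nat_mono card_mono) (auto simp: G_def)
    also have "\<dots> \<le> real (card G) + bd a + bd b"
      unfolding bd_def of_nat_add [symmetric] of_nat_le_iff
      by (rule order_trans[OF card_Un_le add_right_mono[OF card_Un_le]])
    finally have G: "d c / 2 \<le> real (card G)" using ab by (simp add: V_def d_def)
    have W: "\<theta> * n \<le> real (card (W a v))" "\<theta> * n \<le> real (card (W v b))" if "v \<in> G" for v
      using that W_sym[of v b] by (auto simp: G_def bad_def)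
    have "k \<le> real (card G) * (\<theta> * n)\<^sup>2" unfolding k_def using G by (intro mult_right_mono) auto
    also have "\<dots> = (\<Sum>v\<in>G. (\<theta> * n) * (\<theta> * n))" by (simp add: power2_eq_square)
    also have "\<dots> \<le> (\<Sum>v\<in>G. real (card (W a v)) * real (card (W v b)))"
      using W \<theta> n by (intro sum_mono mult_mono) auto
    also have "\<dots> = real (card T)"
      using finW finN by (simp add: T_def G_def card_cartesian_product)
    also have "\<dots> \<le> real (card {s\<in>D \<times> D \<times> D \<times> D. (\<lambda>(x, y, z, w). x + y + z + w) s = x})"
    proof -
      let ?g = "\<lambda>(v, c1, c2). (- a + c1, - c1 + v, - v + c2, - c2 + b)"
      have "inj_on ?g T"
        by (auto simp: inj_on_def)
      moreover have "?g ` T \<subseteq> {s\<in>D \<times> D \<times> D \<times> D. (\<lambda>(x, y, z, w). x + y + z + w) s = x}"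
      proof (clarsimp simp: T_def W_def ab(3) add.assoc)
        fix v c1 c2 assume "adj a c1" "adj v c1" "adj v c2" "adj b c2"
        then show "- a + c1 \<in> D \<and> - c1 + v \<in> D \<and> - v + c2 \<in> D \<and> - c2 + b \<in> D"
          using adj_sym[of v c1] adj_sym[of b c2] by (simp add: adj_def)
      qed
      ultimately show ?thesis using finD by (intro of_nat_mono card_inj_on_le) auto
    qed
    finally show "k \<le> real (card {s\<in>D \<times> D \<times> D \<times> D. (\<lambda>(x, y, z, w). x + y + z + w) s = x})" .
  qed (use finD finV in auto)
  moreover have "n ^ 3 \<le> 1024 * q ^ 5 * k"
  proof -
    have "1024 * q ^ 5 * k = 4 * q * n\<^sup>2 * (d c / 2)"
    proof -
      have "q ^ 5 = q * (q\<^sup>2)\<^sup>2" by (simp flip: power_mult power_Suc)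
      then show ?thesis using q by (simp add: k_def \<theta>_def power_divide power_mult_distrib)
    qed
    also have "\<dots> \<ge> 4 * q * n\<^sup>2 * (n / (2 * q) / 2)"
      using d_lower q n by (intro mult_left_mono) auto
    finally show ?thesis using q by (simp add: power2_eq_square power3_eq_cube)
  qed
  ultimately have "real (card ?X) * n ^ 3 \<le> 1024 * q ^ 5 * real (card D) ^ 4"
  proof -
    assume 1: "k * real (card ?X) \<le> real (card (D \<times> D \<times> D \<times> D))" and 2: "n ^ 3 \<le> 1024 * q ^ 5 * k"
    have "real (card ?X) * n ^ 3 \<le> real (card ?X) * (1024 * q ^ 5 * k)"
      using 2 by (intro mult_left_mono) auto
    also have "\<dots> = 1024 * q ^ 5 * (k * real (card ?X))" by simp
    also have "\<dots> \<le> 1024 * q ^ 5 * real (card (D \<times> D \<times> D \<times> D))"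
      using 1 q by (intro mult_left_mono) auto
    finally show ?thesis by (simp add: card_cartesian_product power4_eq_xxxx mult.assoc)
  qed
  moreover have "V \<subseteq> A" by (auto simp: V_def N_def)
  moreover have "n / (4 * q) \<le> real (card V)" using V_lower d_lower by simp
  ultimately show ?thesis using that by (simp add: n_def)
qed

text \<open>Cauchy-Schwarz over the fibres of \<open>f\<close>; the sum counts ordered pairs with
  equal image. Applied to the difference map on \<open>V \<times> V\<close> and to the pivot
  map.\<close>

lemma card_square_le_collisions:
  assumes "finite S"
  shows "(real (card S))\<^sup>2 \<le> real (card (f ` S)) * (\<Sum>s\<in>S. real (card {t\<in>S. f t = f s}))"
proof -
  define c where "c y = real (card {t\<in>S. f t = y})" for y
  have "real (card S) = (\<Sum>y\<in>f ` S. c y)"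
    unfolding c_def using sum.image_gen[OF assms, of "\<lambda>_. 1::real" f] by simp
  then have "(real (card S))\<^sup>2 \<le> (\<Sum>y\<in>f ` S. (c y)\<^sup>2) * real (card (f ` S))"
    by (simp add: sum_squared_le_sum_of_squares)
  also have "(\<Sum>y\<in>f ` S. (c y)\<^sup>2) = (\<Sum>s\<in>S. c (f s))"
    by (subst sum.image_gen[OF assms, of _ f])
       (intro sum.cong, simp_all add: c_def power2_eq_square)
  finally show ?thesis by (simp add: c_def mult.commute)
qed

section \<open>Iterated sumsets and popular differences\<close>

primrec nfold_sum :: "nat \<Rightarrow> 'g::monoid_add set \<Rightarrow> 'g set" where
  "nfold_sum 0 H = {0}"
| "nfold_sum (Suc n) H = nfold_sum n H + H"

lemma singleton_zero_plus [simp]: "{0} + H = (H :: 'g::monoid_add set)"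
  by (auto simp: set_plus_def)

lemma nfold_sum_add:
  "x \<in> nfold_sum m H \<Longrightarrow> y \<in> nfold_sum n H \<Longrightarrow> x + y \<in> nfold_sum (m + n) H"
proof (induction n arbitrary: y)
  case (Suc n)
  then obtain z h where "y = z + h" "z \<in> nfold_sum n H" "h \<in> H"
    by (auto elim: set_plus_elim)
  with Suc.IH[of z] Suc.prems show ?case
    by (auto simp: add.assoc[symmetric])
qed simp

lemma finite_nfold_sum: "finite H \<Longrightarrow> finite (nfold_sum n H)"
  by (induction n) (auto intro: finite_set_plus)

lemma nfold_sum_mono: "0 \<in> H \<Longrightarrow> m \<le> n \<Longrightarrow> nfold_sum m H \<subseteq> nfold_sum n H"
proof (induction n)
  case (Suc n)
  have "nfold_sum n H \<subseteq> nfold_sum (Suc n) H"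
    using Suc.prems by (metis add_0_right nfold_sum.simps(2) set_plus_intro subsetI)
  with Suc show ?case by (auto simp: le_Suc_eq)
qed simp

lemma nfold_sum_uminus:
  fixes H :: "'g::group_add set"
  assumes "\<And>x. x \<in> H \<Longrightarrow> - x \<in> H"
  shows "x \<in> nfold_sum n H \<Longrightarrow> - x \<in> nfold_sum n H"
proof (induction n arbitrary: x)
  case (Suc n)
  then obtain z h where "x = z + h" "z \<in> nfold_sum n H" "h \<in> H"
    by (auto elim: set_plus_elim)
  then show ?case
    using nfold_sum_add[of "- h" "Suc 0" H "- z" n] Suc.IH[of z] assms
    by (simp add: minus_add)
qed simp

text \<open>The candidate for an approximate subgroup. Without commutativity a small
  \<open>- V + V\<close> does not control longer sums of \<open>V\<close>, but it does control sums
  of those right differences that have many representations.\<close>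

definition popular_differences :: "'g::group_add set \<Rightarrow> real \<Rightarrow> 'g set" where
  "popular_differences V k = {x. k \<le> real (card {p\<in>V \<times> V. fst p - snd p = x})}"

lemma popular_differences_subset:
  assumes "k > 0"
  shows "popular_differences V k \<subseteq> (\<lambda>p. fst p - snd p) ` (V \<times> V)"
proof
  fix x assume "x \<in> popular_differences V k"
  then have "card {p\<in>V \<times> V. fst p - snd p = x} \<noteq> 0"
    using assms by (auto simp: popular_differences_def)
  then have "{p\<in>V \<times> V. fst p - snd p = x} \<noteq> {}" by (auto simp only: card.empty)
  then show "x \<in> (\<lambda>p. fst p - snd p) ` (V \<times> V)" by blast
qed

lemma finite_popular_differences:
  "finite V \<Longrightarrow> k > 0 \<Longrightarrow> finite (popular_differences V k)"
  by (rule finite_subset[OF popular_differences_subset]) simp_all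

lemma zero_in_popular_differences:
  assumes "finite V" "k \<le> real (card V)"
  shows "0 \<in> popular_differences V k"
proof -
  have "{p\<in>V \<times> V. fst p - snd p = 0} = (\<lambda>x. (x, x)) ` V" by auto
  then show ?thesis using assms
    by (simp add: popular_differences_def card_image inj_on_def)
qed

lemma uminus_in_popular_differences:
  assumes "finite V" "x \<in> popular_differences V k"
  shows "- x \<in> popular_differences V k"
proof -
  have "card {p\<in>V \<times> V. fst p - snd p = x} \<le> card {p\<in>V \<times> V. fst p - snd p = - x}"
    using assms(1) by (intro card_inj_on_le[of prod.swap]) auto
  then show ?thesis using assms(2) by (simp add: popular_differences_def)
qed

text \<open>
  If \<open>h = a - b\<close>, then \<open>z + h + v = (z + a) + (- b + v)\<close>: every popular difference \<open>h\<close> yields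
  many ways to write \<open>z + h + v\<close> as a sum from \<open>Z + V\<close> and \<open>- V + V\<close>.
\<close>
lemma card_plus_popular_differences:
  assumes fin: "finite Z" "finite V" and k: "k > 0"
  shows "k * real (card (Z + popular_differences V k + V))
    \<le> real (card (Z + V)) * real (card ((\<lambda>(a, b). - a + b) ` (V \<times> V)))"
proof -
  let ?X = "(\<lambda>(a, b). - a + b) ` (V \<times> V)"
  have "k * real (card (Z + popular_differences V k + V)) \<le> real (card ((Z + V) \<times> ?X))"
  proof (rule card_times_fibre_le[where f = "\<lambda>p. fst p + snd p"])
    fix c assume "c \<in> Z + popular_differences V k + V"
    then obtain z h v where zhv: "c = z + h + v" "z \<in> Z" "h \<in> popular_differences V k" "v \<in> V"
      by (auto elim!: set_plus_elim)
    let ?F = "{p\<in>V \<times> V. fst p - snd p = h}" and ?g = "\<lambda>p. (z + fst p, - snd p + v)"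
    have "k \<le> real (card ?F)" using zhv by (simp add: popular_differences_def)
    also have "\<dots> \<le> real (card {p\<in>(Z + V) \<times> ?X. fst p + snd p = c})"
    proof (intro of_nat_mono card_inj_on_le[where f = ?g])
      show "inj_on ?g ?F" by (auto simp: inj_on_def)
      show "?g ` ?F \<subseteq> {p\<in>(Z + V) \<times> ?X. fst p + snd p = c}"
        using zhv by (auto simp: add.assoc diff_conv_add_uminus simp del: add_uminus_conv_diff)
      show "finite {p\<in>(Z + V) \<times> ?X. fst p + snd p = c}"
        using fin by (simp add: finite_set_plus)
    qed
    finally show "k \<le> real (card {p\<in>(Z + V) \<times> ?X. fst p + snd p = c})" .
  qed (use fin k in \<open>auto intro!: finite_set_plus finite_popular_differences\<close>)
  then show ?thesis by (simp add: card_cartesian_product)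
qed

text \<open>The summand \<open>V\<close> on the right acts as a catalyst: inserting one more
  \<open>H\<close> in front of it costs the factor \<open>q * card V\<close> divided by
  \<open>card V / (2 * q)\<close>, that is \<open>2 * q\<^sup>2\<close>, and \<open>V\<close> is
  available again for the next insertion.\<close>

lemma card_nfold_popular_differences:
  fixes V :: "'g::group_add set"
  assumes V: "finite V" "V \<noteq> {}" and q: "q > 0"
    and small: "real (card ((\<lambda>(a, b). - a + b) ` (V \<times> V))) \<le> q * real (card V)"
  defines "H \<equiv> popular_differences V (real (card V) / (2 * q))"
  shows "real (card (nfold_sum n H + V)) \<le> (2 * q\<^sup>2) ^ n * real (card V)"
proof (induction n)
  case 0
  then show ?case using q by (simp flip: set_zero)
next
  case (Suc n)
  have V0: "real (card V) > 0" using V by (simp add: card_gt_0_iff)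
  have k: "real (card V) / (2 * q) > 0" using V0 q by simp
  have finH: "finite H" unfolding H_def using V k by (intro finite_popular_differences)
  have "real (card V) / (2 * q) * real (card (nfold_sum n H + H + V))
      \<le> real (card (nfold_sum n H + V)) * real (card ((\<lambda>(a, b). - a + b) ` (V \<times> V)))"
    unfolding H_def using V k finH by (intro card_plus_popular_differences finite_nfold_sum) (auto simp: H_def)
  also have "\<dots> \<le> ((2 * q\<^sup>2) ^ n * real (card V)) * (q * real (card V))"
    using Suc small q by (intro mult_mono) auto
  finally show ?case using V0 q by (simp add: field_simps power2_eq_square)
qed

text \<open>The equations \<open>- d + b = - c + a\<close> and \<open>c - d = a - b\<close> are
  equivalent, so the energy that Cauchy-Schwarz extracts from the few left differences is also
  energy of the right differences. Unpopular differences account for less than half of it;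
  pigeonholing the popular pairs over \<open>b\<close> gives the translate.\<close>

lemma popular_differences_translate:
  fixes V :: "'g::group_add set"
  assumes V: "finite V" "V \<noteq> {}" and q: "q > 0"
    and small: "real (card ((\<lambda>(a, b). - a + b) ` (V \<times> V))) \<le> q * real (card V)"
  defines "H \<equiv> popular_differences V (real (card V) / (2 * q))"
  shows "\<exists>b\<in>V. real (card V) / (2 * q) \<le> real (card {a\<in>V. a - b \<in> H})"
proof (rule ccontr)
  define n where "n = real (card V)"
  have n: "n > 0" using V by (simp add: n_def card_gt_0_iff)
  define r where "r x = real (card {p\<in>V \<times> V. fst p - snd p = x})" for x
  assume "\<not> ?thesis"
  then have few: "real (card {a\<in>V. a - b \<in> H}) < n / (2 * q)" if "b \<in> V" for b
    using that by (auto simp: n_def)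
  have r_le: "r x \<le> n" for x
    unfolding r_def n_def using V(1)
    by (intro of_nat_mono card_inj_on_le[of fst])
       (auto simp: inj_on_def diff_conv_add_uminus simp del: add_uminus_conv_diff)
  have r_less: "r x < n / (2 * q)" if "x \<notin> H" for x
    using that by (auto simp: H_def popular_differences_def r_def n_def)
  have "(n\<^sup>2)\<^sup>2 \<le> real (card ((\<lambda>(a, b). - a + b) ` (V \<times> V))) *
      (\<Sum>p\<in>V \<times> V. real (card {t\<in>V \<times> V. (\<lambda>(a, b). - a + b) t = (\<lambda>(a, b). - a + b) p}))"
    using card_square_le_collisions[of "V \<times> V" "\<lambda>(a, b). - a + b"] V(1)
    by (simp add: n_def card_cartesian_product power2_eq_square)
  also have "\<dots> \<le> (q * n) * (\<Sum>p\<in>V \<times> V. real (card {t\<in>V \<times> V. (\<lambda>(a, b). - a + b) t = (\<lambda>(a, b). - a + b) p}))"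
    using small by (intro mult_right_mono) (auto simp: n_def sum_nonneg)
  also have "(\<Sum>p\<in>V \<times> V. real (card {t\<in>V \<times> V. (\<lambda>(a, b). - a + b) t = (\<lambda>(a, b). - a + b) p}))
      = (\<Sum>c\<in>V. \<Sum>a\<in>V. \<Sum>d\<in>V. \<Sum>b\<in>V. of_bool (- d + b = - c + a))"
    using V(1) by (simp add: real_card_filter sum.cartesian_product' del: sum_of_bool_eq)
  also have "\<dots> = (\<Sum>a\<in>V. \<Sum>b\<in>V. \<Sum>c\<in>V. \<Sum>d\<in>V. of_bool (c - d = a - b))"
  proof -
    have "- d + b = - c + a \<longleftrightarrow> c - d = a - b" for a b c d :: 'g
    proof -
      have "- d + b = - c + a \<longleftrightarrow> c + (- d + b) = a"
        by (metis add_minus_cancel minus_add_cancel)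
      also have "\<dots> \<longleftrightarrow> c - d + b = a"
        by (simp only: diff_conv_add_uminus add.assoc)
      finally show ?thesis by (simp only: eq_diff_eq)
    qed
    note iff = this
    have "(\<Sum>c\<in>V. \<Sum>a\<in>V. \<Sum>d\<in>V. \<Sum>b\<in>V. of_bool (- d + b = - c + a))
        = (\<Sum>a\<in>V. \<Sum>c\<in>V. \<Sum>d\<in>V. \<Sum>b\<in>V. of_bool (- d + b = - c + a) :: real)"
      by (rule sum.swap)
    also have "\<dots> = (\<Sum>a\<in>V. \<Sum>c\<in>V. \<Sum>b\<in>V. \<Sum>d\<in>V. of_bool (c - d = a - b))"
      unfolding iff by (intro sum.cong refl sum.swap)
    also have "\<dots> = (\<Sum>a\<in>V. \<Sum>b\<in>V. \<Sum>c\<in>V. \<Sum>d\<in>V. of_bool (c - d = a - b))"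
      by (intro sum.cong refl sum.swap)
    finally show ?thesis .
  qed
  also have "\<dots> = (\<Sum>b\<in>V. \<Sum>a\<in>V. r (a - b))"
    by (subst sum.swap) (use V(1) in \<open>simp add: r_def real_card_filter sum.cartesian_product' del: sum_of_bool_eq\<close>)
  also have "\<dots> < (\<Sum>b\<in>V. n\<^sup>2 / q)"
  proof (rule sum_strict_mono)
    fix b assume b: "b \<in> V"
    \<comment> \<open>Popular differences are estimated by the trivial bound \<open>n\<close>, the
      others by the threshold.\<close>
    have "(\<Sum>a\<in>V. r (a - b)) \<le> (\<Sum>a\<in>V. of_bool (a - b \<in> H) * n + n / (2 * q))"
      using r_le r_less n q by (intro sum_mono) (auto simp: less_imp_le intro: add_increasing2)
    also have "\<dots> = real (card {a\<in>V. a - b \<in> H}) * n + n * (n / (2 * q))"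
      using V(1) by (simp add: sum.distrib real_card_filter n_def del: sum_of_bool_eq flip: sum_distrib_right)
    also have "\<dots> < n / (2 * q) * n + n * (n / (2 * q))"
      using mult_strict_right_mono[OF few[OF b] n] by (rule add_strict_right_mono)
    also have "\<dots> = n\<^sup>2 / q" using q by (simp add: power2_eq_square field_simps)
    finally show "(\<Sum>a\<in>V. r (a - b)) < n\<^sup>2 / q" .
  qed (use V in auto)
  finally show False
    using n q by (simp add: n_def[symmetric] power2_eq_square)
qed

section \<open>Finitely supported probability measures on a group\<close>

definition mean :: "('a \<Rightarrow> real) \<Rightarrow> ('a \<Rightarrow> real) \<Rightarrow> real" where
  "mean \<nu> \<phi> = (\<Sum>g | \<nu> g \<noteq> 0. \<nu> g * \<phi> g)"

definition prob :: "('a \<Rightarrow> real) \<Rightarrow> bool" where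
  "prob \<nu> \<longleftrightarrow> finite {g. \<nu> g \<noteq> 0} \<and> (\<forall>g. 0 \<le> \<nu> g) \<and> mean \<nu> (\<lambda>_. 1) = 1"

definition autocorr :: "('g::group_add \<Rightarrow> real) \<Rightarrow> 'g \<Rightarrow> real" where
  "autocorr \<nu> x = mean \<nu> (\<lambda>g. \<nu> (g + x))"

lemma prob_finite [simp]: "prob \<nu> \<Longrightarrow> finite {g. \<nu> g \<noteq> 0}"
  and prob_nonneg [simp]: "prob \<nu> \<Longrightarrow> 0 \<le> \<nu> g"
  by (simp_all add: prob_def)

lemma mean_eq_sum:
  assumes "finite S" "\<And>g. g \<notin> S \<Longrightarrow> \<nu> g = 0"
  shows "mean \<nu> \<phi> = (\<Sum>g\<in>S. \<nu> g * \<phi> g)"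
  unfolding mean_def using assms by (intro sum.mono_neutral_left) auto

lemma mean_mono:
  assumes "prob \<nu>" "\<And>g. \<nu> g \<noteq> 0 \<Longrightarrow> \<phi> g \<le> \<psi> g"
  shows "mean \<nu> \<phi> \<le> mean \<nu> \<psi>"
  unfolding mean_def using assms by (intro sum_mono mult_left_mono) auto

lemma mean_const [simp]: "prob \<nu> \<Longrightarrow> mean \<nu> (\<lambda>_. c) = c"
  unfolding prob_def mean_def by (simp flip: sum_distrib_right)

lemma mean_add: "mean \<nu> (\<lambda>g. \<phi> g + \<psi> g) = mean \<nu> \<phi> + mean \<nu> \<psi>"
  by (simp add: mean_def distrib_left sum.distrib)

lemma mean_cmult: "mean \<nu> (\<lambda>g. c * \<phi> g) = c * mean \<nu> \<phi>"
  by (simp add: mean_def sum_distrib_left mult_ac)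

lemma mean_sum: "mean \<nu> (\<lambda>g. \<Sum>y\<in>Y. \<phi> y g) = (\<Sum>y\<in>Y. mean \<nu> (\<phi> y))"
  unfolding mean_def sum_distrib_left by (rule sum.swap)

lemma mean_nonneg: "prob \<nu> \<Longrightarrow> (\<And>g. 0 \<le> \<phi> g) \<Longrightarrow> 0 \<le> mean \<nu> \<phi>"
  unfolding mean_def by (intro sum_nonneg) auto

lemma sum_prob_le_1:
  assumes "prob \<nu>" "finite T"
  shows "(\<Sum>g\<in>T. \<nu> g) \<le> 1"
proof -
  have "(\<Sum>g\<in>T. \<nu> g) \<le> (\<Sum>g\<in>T \<union> {g. \<nu> g \<noteq> 0}. \<nu> g)"
    using assms by (intro sum_mono2) auto
  also have "\<dots> = mean \<nu> (\<lambda>_. 1)"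
    using assms by (subst mean_eq_sum[of "T \<union> {g. \<nu> g \<noteq> 0}"]) auto
  finally show ?thesis using assms by simp
qed

text \<open>The substitution \<open>h = g + x\<close> exhibits \<open>autocorr \<nu>\<close> as the
  law of \<open>- g + h\<close> for independent \<open>g\<close> and \<open>h\<close> with law
  \<open>\<nu>\<close>. Inherited properties are proved by fixing \<open>g\<close> in this
  form.\<close>

lemma mean_autocorr:
  fixes \<nu> :: "'g::group_add \<Rightarrow> real"
  assumes "prob \<nu>"
  shows "mean (autocorr \<nu>) \<phi> = mean \<nu> (\<lambda>g. mean \<nu> (\<lambda>h. \<phi> (- g + h)))"
proof -
  define S where "S = {g. \<nu> g \<noteq> 0}"
  define T where "T = (\<lambda>(g, h). - g + h) ` (S \<times> S)"
  have S: "finite S" using assms by (simp add: S_def)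
  then have T: "finite T" by (simp add: T_def)
  have inner: "(\<Sum>x\<in>T. \<nu> (g + x) * \<phi> x) = mean \<nu> (\<lambda>h. \<phi> (- g + h))" if g: "g \<in> S" for g
  proof -
    have "(\<Sum>x\<in>T. \<nu> (g + x) * \<phi> x) = (\<Sum>x\<in>(\<lambda>h. - g + h) ` S. \<nu> (g + x) * \<phi> x)"
    proof (rule sum.mono_neutral_right[OF T])
      show "\<forall>i\<in>T - (\<lambda>h. - g + h) ` S. \<nu> (g + i) * \<phi> i = 0"
      proof
        fix i assume i: "i \<in> T - (\<lambda>h. - g + h) ` S"
        have "i = - g + (g + i)" by (simp add: add.assoc[symmetric])
        with i have "g + i \<notin> S" by blast
        then show "\<nu> (g + i) * \<phi> i = 0" by (simp add: S_def)
      qed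
    qed (use g in \<open>auto simp: T_def\<close>)
    also have "\<dots> = (\<Sum>h\<in>S. \<nu> h * \<phi> (- g + h))"
      by (subst sum.reindex) (auto simp: inj_on_def add.assoc[symmetric])
    finally show ?thesis by (simp add: mean_def S_def)
  qed
  have "autocorr \<nu> x = 0" if "x \<notin> T" for x
  proof -
    have "\<nu> (g + x) = 0" if "g \<in> S" for g
    proof (rule ccontr)
      assume "\<nu> (g + x) \<noteq> 0"
      moreover have "x = - g + (g + x)" by (simp add: add.assoc[symmetric])
      ultimately have "x \<in> T" unfolding T_def using that by (force simp: S_def)
      with \<open>x \<notin> T\<close> show False ..
    qed
    then show ?thesis by (auto simp: autocorr_def mean_def S_def intro: sum.neutral)
  qed
  then have "mean (autocorr \<nu>) \<phi> = (\<Sum>x\<in>T. autocorr \<nu> x * \<phi> x)"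
    by (rule mean_eq_sum[OF T])
  also have "\<dots> = (\<Sum>x\<in>T. \<Sum>g\<in>S. \<nu> g * (\<nu> (g + x) * \<phi> x))"
    by (simp add: autocorr_def mean_def S_def sum_distrib_right mult.assoc)
  also have "\<dots> = (\<Sum>g\<in>S. \<nu> g * (\<Sum>x\<in>T. \<nu> (g + x) * \<phi> x))"
    by (subst sum.swap) (simp add: sum_distrib_left)
  also have "\<dots> = (\<Sum>g\<in>S. \<nu> g * mean \<nu> (\<lambda>h. \<phi> (- g + h)))"
    using inner by simp
  finally show ?thesis by (simp add: mean_def S_def)
qed

lemma prob_autocorr [simp]:
  fixes \<nu> :: "'g::group_add \<Rightarrow> real"
  assumes "prob \<nu>"
  shows "prob (autocorr \<nu>)"
  unfolding prob_def
proof (intro conjI allI)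
  define S where "S = {g. \<nu> g \<noteq> 0}"
  have "{g. autocorr \<nu> g \<noteq> 0} \<subseteq> (\<lambda>(g, h). - g + h) ` (S \<times> S)"
  proof
    fix x assume "x \<in> {g. autocorr \<nu> g \<noteq> 0}"
    then have "(\<Sum>g\<in>S. \<nu> g * \<nu> (g + x)) \<noteq> 0" by (simp add: autocorr_def mean_def S_def)
    then obtain g where "g \<in> S" "\<nu> g * \<nu> (g + x) \<noteq> 0"
      by (rule sum.not_neutral_contains_not_neutral)
    then have "g \<in> S" "g + x \<in> S" by (auto simp: S_def)
    moreover have "x = - g + (g + x)" by (simp add: add.assoc[symmetric])
    ultimately show "x \<in> (\<lambda>(g, h). - g + h) ` (S \<times> S)" by force
  qed
  then show "finite {g. autocorr \<nu> g \<noteq> 0}"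
    by (rule finite_subset) (use assms in \<open>simp add: S_def\<close>)
  show "0 \<le> autocorr \<nu> g" for g using assms by (simp add: autocorr_def mean_nonneg)
  show "mean (autocorr \<nu>) (\<lambda>_. 1) = 1" using assms by (simp add: mean_autocorr)
qed

lemma autocorr_le:
  assumes "prob \<nu>" "\<And>g. \<nu> g \<le> s"
  shows "autocorr \<nu> x \<le> s"
  unfolding autocorr_def using mean_mono[OF assms(1), of "\<lambda>g. \<nu> (g + x)" "\<lambda>_. s"] assms by simp

text \<open>Translation invariance of the sum of squares together with
  \<open>2 * u * v \<le> u\<^sup>2 + v\<^sup>2\<close>. It turns an L2 bound at one step into a
  supremum bound at the next.\<close>

lemma autocorr_le_mean:
  assumes "prob \<nu>"
  shows "autocorr \<nu> x \<le> mean \<nu> \<nu>"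
proof -
  define S where "S = {g. \<nu> g \<noteq> 0}"
  have S: "finite S" using assms by (simp add: S_def)
  have "(\<Sum>g\<in>S. (\<nu> (g + x))\<^sup>2) = (\<Sum>h\<in>(\<lambda>g. g + x) ` S. (\<nu> h)\<^sup>2)"
    by (subst sum.reindex) (auto simp: inj_on_def)
  also have "\<dots> \<le> (\<Sum>h\<in>S. (\<nu> h)\<^sup>2)"
  proof -
    have "(\<Sum>h\<in>(\<lambda>g. g + x) ` S. (\<nu> h)\<^sup>2) \<le> (\<Sum>h\<in>(\<lambda>g. g + x) ` S \<union> S. (\<nu> h)\<^sup>2)"
      using S by (intro sum_mono2) auto
    also have "\<dots> = (\<Sum>h\<in>S. (\<nu> h)\<^sup>2)"
      using S by (intro sum.mono_neutral_right) (auto simp: S_def)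
    finally show ?thesis .
  qed
  finally have le: "(\<Sum>g\<in>S. (\<nu> (g + x))\<^sup>2) \<le> (\<Sum>h\<in>S. (\<nu> h)\<^sup>2)" .
  have "2 * autocorr \<nu> x = (\<Sum>g\<in>S. 2 * \<nu> g * \<nu> (g + x))"
    by (simp add: autocorr_def mean_def S_def sum_distrib_left mult_ac)
  also have "\<dots> \<le> (\<Sum>g\<in>S. (\<nu> g)\<^sup>2 + (\<nu> (g + x))\<^sup>2)"
    by (intro sum_mono) (rule sum_squares_bound)
  also have "\<dots> \<le> 2 * (\<Sum>g\<in>S. (\<nu> g)\<^sup>2)" using le by (simp add: sum.distrib)
  finally show ?thesis by (simp add: mean_def S_def power2_eq_square)
qed

lemma autocorr_uminus:
  assumes "prob \<nu>"
  shows "autocorr \<nu> (- x) = autocorr \<nu> x"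
proof -
  define S where "S = {g. \<nu> g \<noteq> 0}"
  have S: "finite S" using assms by (simp add: S_def)
  have "autocorr \<nu> y = (\<Sum>(g, h)\<in>{p\<in>S \<times> S. snd p = fst p + y}. \<nu> g * \<nu> h)" for y
  proof -
    have "(\<Sum>(g, h)\<in>{p\<in>S \<times> S. snd p = fst p + y}. \<nu> g * \<nu> h)
        = (\<Sum>(g, h)\<in>(\<lambda>g. (g, g + y)) ` {g\<in>S. g + y \<in> S}. \<nu> g * \<nu> h)"
      by (intro sum.cong) auto
    also have "\<dots> = (\<Sum>g\<in>{g\<in>S. g + y \<in> S}. \<nu> g * \<nu> (g + y))"
      by (subst sum.reindex) (auto simp: inj_on_def)
    also have "\<dots> = autocorr \<nu> y"
      unfolding autocorr_def mean_def S_def[symmetric]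
      using S by (intro sum.mono_neutral_left) (auto simp: S_def)
    finally show ?thesis ..
  qed
  note eq = this
  show ?thesis
    unfolding eq
    by (rule sum.reindex_bij_witness[where i = prod.swap and j = prod.swap])
       (auto simp: add.assoc mult.commute)
qed

section \<open>From flat measures to approximate subgroups\<close>

text \<open>The length 35 is what the pivoting argument consumes; the exponents are not optimised.\<close>
theorem approximate_subgroup_of_flat_measure:
  fixes \<nu> :: "'g::group_add \<Rightarrow> real"
  assumes \<nu>: "prob \<nu>" "\<And>g. \<nu> g \<le> s" and s: "s > 0" and K: "K \<ge> 2"
    and flat: "s / K \<le> mean (autocorr \<nu>) (autocorr \<nu>)"
  obtains H b where "finite H" "0 \<in> H" "\<And>x. x \<in> H \<Longrightarrow> - x \<in> H"
    "\<nu> b \<noteq> 0" "\<And>x. x \<in> H \<Longrightarrow> \<exists>g h. \<nu> g \<noteq> 0 \<and> \<nu> h \<noteq> 0 \<and> x = g - h"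
    "1 / K ^ 111 \<le> mean \<nu> (\<lambda>g. of_bool (g - b \<in> H))"
    "real (card (nfold_sum 35 H)) \<le> K ^ 6568 * real (card H)" "real (card H) \<le> K ^ 189 / s"
proof -
  define \<rho> where "\<rho> = autocorr \<nu>"
  have \<rho>: "prob \<rho>" "\<And>x. \<rho> x \<le> s" "\<And>x. \<rho> (- x) = \<rho> x"
    using \<nu> by (auto simp: \<rho>_def autocorr_le autocorr_uminus)
  define S where "S = {g. \<nu> g \<noteq> 0}"
  have S: "finite S" using \<nu> by (simp add: S_def)
  \<comment> \<open>The thresholds are chosen so that discarding small values of
    \<open>\<nu> a\<close>, \<open>\<nu> b\<close> and \<open>\<rho> (- a + b)\<close> loses at most
    \<open>s / (8 * K) + s / (8 * K) + s / (4 * K)\<close>, half of the mass \<open>s / K\<close>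
    provided by \<open>flat\<close>.\<close>
  define A where "A = {g. s / (8 * K) \<le> \<nu> g}"
  define D where "D = {x. s / (4 * K) \<le> \<rho> x}"
  have thr: "s / (8 * K) > 0" "s / (4 * K) > 0" using s K by simp_all
  have AS: "A \<subseteq> S"
  proof
    fix g assume "g \<in> A"
    then have "0 < \<nu> g" using thr(1) unfolding A_def mem_Collect_eq by linarith
    then show "g \<in> S" by (simp add: S_def)
  qed
  then have finA: "finite A" using S finite_subset by blast
  have finD: "finite D"
  proof (rule finite_subset[OF _ prob_finite[OF \<rho>(1)]])
    show "D \<subseteq> {x. \<rho> x \<noteq> 0}" using thr(2) unfolding D_def by (smt (verit) Collect_mono)
  qed
  have "s / (8 * K) * real (card A) \<le> (\<Sum>g\<in>A. \<nu> g)"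
    using sum_mono[of A "\<lambda>_. s / (8 * K)" \<nu>] by (simp add: A_def mult.commute)
  also have "\<dots> \<le> 1" using \<nu>(1) finA by (rule sum_prob_le_1)
  finally have card_A: "real (card A) \<le> 8 * K / s" using s K by (simp add: field_simps)
  have "s / (4 * K) * real (card D) \<le> (\<Sum>g\<in>D. \<rho> g)"
    using sum_mono[of D "\<lambda>_. s / (4 * K)" \<rho>] by (simp add: D_def mult.commute)
  also have "\<dots> \<le> 1" using \<rho>(1) finD by (rule sum_prob_le_1)
  finally have card_D: "real (card D) \<le> 4 * K / s" using s K by (simp add: field_simps)
  define \<Gamma> where "\<Gamma> = {p\<in>A \<times> A. - fst p + snd p \<in> D}"
  have \<Gamma>_le: "real (card \<Gamma>) \<le> (real (card A))\<^sup>2"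
    using card_mono[of "A \<times> A" \<Gamma>] finA
    by (simp add: \<Gamma>_def card_cartesian_product power2_eq_square flip: of_nat_mult)
  have "s / K \<le> (\<Sum>a\<in>S. \<Sum>b\<in>S. \<nu> a * (\<nu> b * \<rho> (- a + b)))"
    using flat unfolding mean_autocorr[OF \<nu>(1)]
    by (simp add: mean_def \<rho>_def S_def sum_distrib_left)
  also have "\<dots> \<le> (\<Sum>a\<in>S. \<Sum>b\<in>S. s ^ 3 * of_bool ((a, b) \<in> \<Gamma>) + s / (8 * K) * (\<nu> b * \<rho> (- a + b))
      + s / (8 * K) * (\<nu> a * \<rho> (- a + b)) + s / (4 * K) * (\<nu> a * \<nu> b))"
  proof (intro sum_mono)
    fix a b
    have nn: "0 \<le> \<nu> a" "0 \<le> \<nu> b" "0 \<le> \<rho> (- a + b)" using \<nu> \<rho> by auto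
    have nn2: "0 \<le> s / (8 * K) * (\<nu> b * \<rho> (- a + b))" "0 \<le> s / (8 * K) * (\<nu> a * \<rho> (- a + b))"
      "0 \<le> s / (4 * K) * (\<nu> a * \<nu> b)" "0 \<le> s ^ 3 * of_bool ((a, b) \<in> \<Gamma>)"
      using nn s K by auto
    consider "a \<notin> A" | "b \<notin> A" | "- a + b \<notin> D" | "(a, b) \<in> \<Gamma>" by (auto simp: \<Gamma>_def)
    then show "\<nu> a * (\<nu> b * \<rho> (- a + b)) \<le> s ^ 3 * of_bool ((a, b) \<in> \<Gamma>)
      + s / (8 * K) * (\<nu> b * \<rho> (- a + b)) + s / (8 * K) * (\<nu> a * \<rho> (- a + b)) + s / (4 * K) * (\<nu> a * \<nu> b)"
    proof cases
      case 1
      then have "\<nu> a * (\<nu> b * \<rho> (- a + b)) \<le> s / (8 * K) * (\<nu> b * \<rho> (- a + b))"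
        using nn by (intro mult_right_mono) (auto simp: A_def)
      with nn2 show ?thesis by linarith
    next
      case 2
      then have "\<nu> b * (\<nu> a * \<rho> (- a + b)) \<le> s / (8 * K) * (\<nu> a * \<rho> (- a + b))"
        using nn by (intro mult_right_mono) (auto simp: A_def)
      with nn2 show ?thesis by (simp add: mult_ac)
    next
      case 3
      then have "\<rho> (- a + b) * (\<nu> a * \<nu> b) \<le> s / (4 * K) * (\<nu> a * \<nu> b)"
        using nn by (intro mult_right_mono) (auto simp: D_def)
      with nn2 show ?thesis by (simp add: mult_ac)
    next
      case 4
      have "\<nu> a * (\<nu> b * \<rho> (- a + b)) \<le> s * (s * s)"
        using nn \<nu> \<rho> s by (intro mult_mono) auto
      with nn2 4 show ?thesis by (simp add: power3_eq_cube)
    qed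
  qed
  also have "\<dots> = s ^ 3 * (\<Sum>a\<in>S. \<Sum>b\<in>S. of_bool ((a, b) \<in> \<Gamma>))
      + s / (8 * K) * (\<Sum>a\<in>S. \<Sum>b\<in>S. \<nu> b * \<rho> (- a + b))
      + s / (8 * K) * (\<Sum>a\<in>S. \<Sum>b\<in>S. \<nu> a * \<rho> (- a + b))
      + s / (4 * K) * (\<Sum>a\<in>S. \<Sum>b\<in>S. \<nu> a * \<nu> b)"
    by (simp add: sum.distrib sum_distrib_left del: sum_of_bool_eq)
  also have "\<dots> \<le> s ^ 3 * real (card \<Gamma>) + s / (8 * K) * 1 + s / (8 * K) * 1 + s / (4 * K) * 1"
  proof -
    have "(\<Sum>a\<in>S. \<Sum>b\<in>S. of_bool ((a, b) \<in> \<Gamma>)) = real (card {p\<in>S \<times> S. p \<in> \<Gamma>})"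
      using S by (simp add: real_card_filter sum.cartesian_product' del: sum_of_bool_eq)
    also have "{p\<in>S \<times> S. p \<in> \<Gamma>} = \<Gamma>" using AS by (auto simp: \<Gamma>_def)
    finally have 1: "(\<Sum>a\<in>S. \<Sum>b\<in>S. of_bool ((a, b) \<in> \<Gamma>)) = real (card \<Gamma>)" .
    have sum_\<nu>: "(\<Sum>g\<in>S. \<nu> g) \<le> 1" using sum_prob_le_1[OF \<nu>(1) S] .
    have "(\<Sum>a\<in>S. \<rho> (- a + b)) = (\<Sum>x\<in>(\<lambda>a. - a + b) ` S. \<rho> x)" for b
      by (subst sum.reindex) (auto simp: inj_on_def)
    then have \<rho>1: "(\<Sum>a\<in>S. \<rho> (- a + b)) \<le> 1" for b
      using sum_prob_le_1[OF \<rho>(1), of "(\<lambda>a. - a + b) ` S"] S by simp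
    have "(\<Sum>b\<in>S. \<rho> (- a + b)) = (\<Sum>x\<in>(\<lambda>b. - a + b) ` S. \<rho> x)" for a
      by (subst sum.reindex) (auto simp: inj_on_def)
    then have \<rho>2: "(\<Sum>b\<in>S. \<rho> (- a + b)) \<le> 1" for a
      using sum_prob_le_1[OF \<rho>(1), of "(\<lambda>b. - a + b) ` S"] S by simp
    have "(\<Sum>a\<in>S. \<Sum>b\<in>S. \<nu> b * \<rho> (- a + b)) = (\<Sum>b\<in>S. \<nu> b * (\<Sum>a\<in>S. \<rho> (- a + b)))"
      by (subst sum.swap) (simp add: sum_distrib_left)
    also have "\<dots> \<le> (\<Sum>b\<in>S. \<nu> b * 1)" using \<rho>1 \<nu> by (intro sum_mono mult_left_mono) auto
    finally have 2: "(\<Sum>a\<in>S. \<Sum>b\<in>S. \<nu> b * \<rho> (- a + b)) \<le> 1" using sum_\<nu> by simp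
    have "(\<Sum>a\<in>S. \<Sum>b\<in>S. \<nu> a * \<rho> (- a + b)) = (\<Sum>a\<in>S. \<nu> a * (\<Sum>b\<in>S. \<rho> (- a + b)))"
      by (simp add: sum_distrib_left)
    also have "\<dots> \<le> (\<Sum>a\<in>S. \<nu> a * 1)" using \<rho>2 \<nu> by (intro sum_mono mult_left_mono) auto
    finally have 3: "(\<Sum>a\<in>S. \<Sum>b\<in>S. \<nu> a * \<rho> (- a + b)) \<le> 1" using sum_\<nu> by simp
    have "(\<Sum>a\<in>S. \<Sum>b\<in>S. \<nu> a * \<nu> b) = (\<Sum>a\<in>S. \<nu> a) * (\<Sum>b\<in>S. \<nu> b)"
      by (simp add: sum_product)
    also have "\<dots> \<le> 1 * 1" using sum_\<nu> \<nu> by (intro mult_mono) (auto intro: sum_nonneg)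
    finally have 4: "(\<Sum>a\<in>S. \<Sum>b\<in>S. \<nu> a * \<nu> b) \<le> 1" by simp
    show ?thesis unfolding 1 using 2 3 4 s K by (intro add_mono mult_left_mono) auto
  qed
  finally have "s / (2 * K) \<le> s ^ 3 * real (card \<Gamma>)" using K by (simp add: field_simps)
  then have \<Gamma>: "1 / (2 * K * s\<^sup>2) \<le> real (card \<Gamma>)"
    using s K by (simp add: field_simps power2_eq_square power3_eq_cube)
  have "(1 / (2 * K * s))\<^sup>2 \<le> 1 / (2 * K * s\<^sup>2)"
    using s K by (simp add: power_divide power_mult_distrib divide_simps power2_eq_square)
  also have "\<dots> \<le> (real (card A))\<^sup>2" using \<Gamma> \<Gamma>_le by (rule order_trans)
  finally have card_A_ge: "1 / (2 * K * s) \<le> real (card A)"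
    by (rule power2_le_imp_le) simp
  moreover have "0 < 1 / (2 * K * s)" using s K by simp
  ultimately have A0: "real (card A) > 0" by linarith
  then have Ane: "A \<noteq> {}" by auto
  \<comment> \<open>The quotient of \<open>(8 * K / s)\<^sup>2\<close>, the upper bound for the
    number of pairs, and the lower bound \<open>1 / (2 * K * s\<^sup>2)\<close> for the
    edges.\<close>
  define q where "q = 128 * K ^ 3"
  have q: "q > 0" using K by (simp add: q_def)
  have "(real (card A))\<^sup>2 / q \<le> (8 * K / s)\<^sup>2 / q"
    using card_A q by (intro divide_right_mono power_mono) auto
  also have "\<dots> = 1 / (2 * K * s\<^sup>2)"
    using s K by (simp add: q_def power_divide power_mult_distrib power2_eq_square power3_eq_cube)
  finally have dense: "(real (card A))\<^sup>2 / q \<le> real (card {p\<in>A \<times> A. - fst p + snd p \<in> D})"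
    using \<Gamma> by (simp add: \<Gamma>_def)
  obtain V where V: "V \<subseteq> A" "real (card A) / (4 * q) \<le> real (card V)"
    "real (card ((\<lambda>(a, b). - a + b) ` (V \<times> V))) * real (card A) ^ 3 \<le> 1024 * q ^ 5 * real (card D) ^ 4"
    by (rule balog_szemeredi_gowers[OF finA finD Ane q _ dense]) (auto simp: D_def \<rho>)
  have finV: "finite V" using V(1) finA finite_subset by blast
  have V0: "real (card V) > 0" using V(2) A0 q by (smt (verit) divide_pos_pos)
  then have Vne: "V \<noteq> {}" by auto
  have pow2: "2 ^ n \<le> K ^ n" for n using K by (intro power_mono) auto
  have Kpow: "K ^ m \<le> K ^ n" if "m \<le> n" for m n using K that by (intro power_increasing) auto
  have q_le: "q \<le> K ^ 10"
  proof -
    have "q = 2 ^ 7 * K ^ 3" by (simp add: q_def)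
    also have "\<dots> \<le> K ^ 7 * K ^ 3" using K by (intro mult_right_mono pow2) auto
    finally show ?thesis by (simp flip: power_add)
  qed
  have D_le: "real (card D) \<le> 8 * K\<^sup>2 * real (card A)"
  proof -
    have "4 * K / s = 8 * K\<^sup>2 * (1 / (2 * K * s))" using s K by (simp add: power2_eq_square)
    also have "\<dots> \<le> 8 * K\<^sup>2 * real (card A)" using card_A_ge by (intro mult_left_mono) auto
    finally show ?thesis using card_D by linarith
  qed
  \<comment> \<open>The exponent is 24 + 8 + 60: the constant \<open>2 ^ 24\<close>, the factor
    \<open>K ^ 8\<close> from \<open>D_le\<close>, and \<open>q ^ 6\<close> with
    \<open>q \<le> K ^ 10\<close>.\<close>
  define Q where "Q = K ^ 92"
  have Q: "Q > 0" using K by (simp add: Q_def)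
  have small: "real (card ((\<lambda>(a, b). - a + b) ` (V \<times> V))) \<le> Q * real (card V)"
  proof -
    let ?x = "real (card ((\<lambda>(a, b). - a + b) ` (V \<times> V)))" and ?n = "real (card A)"
    have "?x * ?n ^ 3 \<le> 1024 * q ^ 5 * real (card D) ^ 4" by (rule V(3))
    also have "\<dots> \<le> 1024 * q ^ 5 * (8 * K\<^sup>2 * ?n) ^ 4"
      using D_le q by (intro mult_left_mono power_mono) auto
    also have "\<dots> = (2 ^ 22 * K ^ 8 * q ^ 5 * ?n) * ?n ^ 3"
      by (simp add: power_mult_distrib flip: power_mult power_Suc)
    finally have "?x \<le> 2 ^ 22 * K ^ 8 * q ^ 5 * ?n" using A0 by simp
    also have "\<dots> \<le> 2 ^ 22 * K ^ 8 * q ^ 5 * (4 * q * real (card V))"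
      using V(2) q K by (intro mult_left_mono) (auto simp: field_simps)
    also have "\<dots> = 2 ^ 24 * K ^ 8 * q ^ 6 * real (card V)" by (simp add: eval_nat_numeral)
    also have "\<dots> \<le> K ^ 24 * K ^ 8 * (K ^ 10) ^ 6 * real (card V)"
      using q_le q K by (intro mult_right_mono mult_mono pow2 power_mono) auto
    also have "\<dots> = Q * real (card V)" by (simp add: Q_def flip: power_mult power_add)
    finally show ?thesis .
  qed
  define H where "H = popular_differences V (real (card V) / (2 * Q))"
  have k: "real (card V) / (2 * Q) > 0" using V0 Q by simp
  have "1 \<le> Q" unfolding Q_def using K by (intro one_le_power) simp
  then have Q1: "1 \<le> 2 * Q" by simp
  have finH: "finite H" unfolding H_def using finV k by (rule finite_popular_differences)
  have "2 * Q \<le> K * Q" using K Q by (intro mult_right_mono) auto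
  then have twoQ: "2 * Q \<le> K ^ 93" by (simp add: Q_def flip: power_Suc)
  have card_le_plus: "real (card Z) \<le> real (card (Z + V))" if "finite Z" for Z
  proof -
    obtain v where "v \<in> V" using Vne by auto
    then show ?thesis
      using that finV
      by (intro of_nat_mono card_inj_on_le[of "\<lambda>z. z + v"] finite_set_plus) (auto simp: inj_on_def)
  qed
  \<comment> \<open>Each summand costs \<open>2 * Q\<^sup>2\<close>, at most \<open>K\<close> to the
    power 2 * 92 + 1. Replacing \<open>V\<close> by \<open>H\<close> costs a further
    \<open>K ^ 93\<close>, whence 6568 = 185 * 35 + 93.\<close>
  have nfold: "real (card (nfold_sum n H)) \<le> K ^ (185 * n) * real (card V)" for n
  proof -
    have "real (card (nfold_sum n H)) \<le> real (card (nfold_sum n H + V))"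
      using finH by (intro card_le_plus finite_nfold_sum)
    also have "\<dots> \<le> (2 * Q\<^sup>2) ^ n * real (card V)"
      unfolding H_def using finV Vne Q small by (rule card_nfold_popular_differences)
    also have "\<dots> \<le> (K ^ 185) ^ n * real (card V)"
    proof (intro mult_right_mono power_mono)
      have "2 * Q\<^sup>2 = 2 * K ^ 184" by (simp add: Q_def flip: power_mult)
      also have "\<dots> \<le> K * K ^ 184" using K by (intro mult_right_mono) auto
      finally show "2 * Q\<^sup>2 \<le> K ^ 185" by (simp flip: power_Suc)
    qed (use Q in auto)
    finally show ?thesis by (simp add: power_mult)
  qed
  obtain b where b: "b \<in> V" "real (card V) / (2 * Q) \<le> real (card {a\<in>V. a - b \<in> H})"
    using popular_differences_translate[OF finV Vne Q small] unfolding H_def by blast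
  have V_le_b: "real (card V) \<le> K ^ 93 * real (card {a\<in>V. a - b \<in> H})"
  proof -
    have "real (card V) \<le> 2 * Q * real (card {a\<in>V. a - b \<in> H})"
      using b(2) Q by (simp add: field_simps)
    also have "\<dots> \<le> K ^ 93 * real (card {a\<in>V. a - b \<in> H})"
      using twoQ by (intro mult_right_mono) auto
    finally show ?thesis .
  qed
  have "real (card {a\<in>V. a - b \<in> H}) \<le> real (card H)"
    using finH by (intro of_nat_mono card_inj_on_le[of "\<lambda>a. a - b"])
      (auto simp: inj_on_def diff_conv_add_uminus simp del: add_uminus_conv_diff)
  then have "K ^ 93 * real (card {a\<in>V. a - b \<in> H}) \<le> K ^ 93 * real (card H)"
    using K by (intro mult_left_mono) auto
  with V_le_b have V_le_H: "real (card V) \<le> K ^ 93 * real (card H)" by linarith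
  show ?thesis
  proof (rule that)
    show "finite H" by (rule finH)
    show "0 \<in> H" unfolding H_def
      using finV V0 Q Q1 by (intro zero_in_popular_differences) (auto simp: divide_le_eq)
    show "- x \<in> H" if "x \<in> H" for x
      using uminus_in_popular_differences[OF finV] that by (simp add: H_def)
    show "\<nu> b \<noteq> 0" using b(1) V(1) AS by (auto simp: S_def)
    show "\<exists>g h. \<nu> g \<noteq> 0 \<and> \<nu> h \<noteq> 0 \<and> x = g - h" if "x \<in> H" for x
      using that popular_differences_subset[OF k] V(1) AS unfolding H_def S_def by fastforce
    show "real (card (nfold_sum 35 H)) \<le> K ^ 6568 * real (card H)"
    proof -
      have "real (card (nfold_sum 35 H)) \<le> K ^ (185 * 35) * real (card V)" by (rule nfold)
      also have "\<dots> \<le> K ^ (185 * 35) * (K ^ 93 * real (card H))"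
        using V_le_H K by (intro mult_left_mono) auto
      finally show ?thesis by (simp flip: power_add mult.assoc)
    qed
    show "real (card H) \<le> K ^ 189 / s"
    proof -
      have "real (card H) \<le> K ^ 185 * real (card V)" using nfold[of 1] by simp
      also have "\<dots> \<le> K ^ 185 * real (card A)"
        using V(1) finA K by (intro mult_left_mono of_nat_mono card_mono) auto
      also have "\<dots> \<le> K ^ 185 * (8 * K / s)" using card_A K by (intro mult_left_mono) auto
      also have "\<dots> \<le> K ^ 185 * (K ^ 4 / s)"
      proof (intro mult_left_mono divide_right_mono)
        have "8 * K = 2 ^ 3 * K" by simp
        also have "\<dots> \<le> K ^ 3 * K" using K by (intro mult_right_mono pow2) auto
        finally show "8 * K \<le> K ^ 4" by (simp flip: power_Suc2)
      qed (use K s in auto)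
      also have "\<dots> = K ^ 189 / s" by (simp flip: power_add)
      finally show ?thesis .
    qed
    \<comment> \<open>The exponent collects 10 from \<open>q\<close>, 93 from the passage to the
      translate by \<open>b\<close>, 2 from the size and threshold of \<open>A\<close>, and 6 for
      the constant 64.\<close>
    show "1 / K ^ 111 \<le> mean \<nu> (\<lambda>g. of_bool (g - b \<in> H))"
    proof -
      let ?W = "{a\<in>V. a - b \<in> H}"
      have "1 / (2 * K * s) \<le> real (card A)" by (rule card_A_ge)
      also have "\<dots> \<le> 4 * q * real (card V)" using V(2) q by (simp add: field_simps)
      also have "\<dots> \<le> 4 * q * (K ^ 93 * real (card ?W))"
        using V_le_b q by (intro mult_left_mono) auto
      also have "\<dots> \<le> 4 * K ^ 10 * (K ^ 93 * real (card ?W))"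
        using q_le K by (intro mult_right_mono) auto
      finally have "1 / (2 * K * s) \<le> 4 * K ^ 103 * real (card ?W)"
      proof -
        have "K ^ 103 = K ^ 10 * K ^ 93" by (simp flip: power_add)
        then show "1 / (2 * K * s) \<le> 4 * K ^ 10 * (K ^ 93 * real (card ?W)) \<Longrightarrow> ?thesis"
          by (simp only: mult.assoc)
      qed
      then have "1 \<le> 4 * K ^ 103 * real (card ?W) * (2 * K * s)"
        using s K by (simp add: divide_le_eq)
      also have "\<dots> = 64 * (K ^ 103 * K\<^sup>2) * (s / (8 * K) * real (card ?W))"
        using K by (simp add: power2_eq_square)
      also have "\<dots> = (64 * K ^ 105) * (s / (8 * K) * real (card ?W))"
        by (simp flip: power_add)
      also have "\<dots> \<le> K ^ 111 * (s / (8 * K) * real (card ?W))"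
      proof (rule mult_right_mono)
        have "64 * K ^ 105 = 2 ^ 6 * K ^ 105" by simp
        also have "\<dots> \<le> K ^ 6 * K ^ 105" using K by (intro mult_right_mono pow2) auto
        finally show "64 * K ^ 105 \<le> K ^ 111" by (simp flip: power_add)
      qed (use s K in auto)
      finally have "1 / K ^ 111 \<le> s / (8 * K) * real (card ?W)"
        using K by (simp add: divide_le_eq mult.commute)
      also have "\<dots> \<le> (\<Sum>g\<in>?W. \<nu> g)"
        using sum_mono[of ?W "\<lambda>_. s / (8 * K)" \<nu>] V(1) by (auto simp: A_def mult.commute)
      also have "\<dots> = (\<Sum>g\<in>?W. \<nu> g * of_bool (g - b \<in> H))" by simp
      also have "\<dots> \<le> (\<Sum>g\<in>S. \<nu> g * of_bool (g - b \<in> H))"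
        using V(1) AS S \<nu> by (intro sum_mono2) auto
      finally show ?thesis by (simp add: mean_def S_def)
    qed
  qed
qed

section \<open>Pivoting\<close>

text \<open>Models the affine group: \<open>U\<close> are the translations, \<open>slope\<close>
  labels the cosets of \<open>U\<close>, and conjugation on \<open>U\<close> is multiplication by
  the slope. \<open>free\<close> says that a non-translation commutes with no nonzero translation.
  \<open>shift_invariant\<close> provides the step of the pivoting argument that leaves a finite
  proper set of bad pivots.\<close>

locale free_metabelian_action =
  fixes G U :: "'g::group_add set" and slope :: "'g \<Rightarrow> 's"
  assumes add_G: "g \<in> G \<Longrightarrow> h \<in> G \<Longrightarrow> g + h \<in> G"
    and uminus_G: "g \<in> G \<Longrightarrow> - g \<in> G"
    and U_subset: "U \<subseteq> G"
    and zero_U: "0 \<in> U"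
    and add_U: "u \<in> U \<Longrightarrow> v \<in> U \<Longrightarrow> u + v \<in> U"
    and uminus_U: "u \<in> U \<Longrightarrow> - u \<in> U"
    and commute_U: "u \<in> U \<Longrightarrow> v \<in> U \<Longrightarrow> u + v = v + u"
    and commutator_U: "g \<in> G \<Longrightarrow> h \<in> G \<Longrightarrow> g + h - g - h \<in> U"
    and slope_eq_iff: "g \<in> G \<Longrightarrow> h \<in> G \<Longrightarrow> slope g = slope h \<longleftrightarrow> - g + h \<in> U"
    and free: "g \<in> G \<Longrightarrow> g \<notin> U \<Longrightarrow> u \<in> U \<Longrightarrow> g + u = u + g \<Longrightarrow> u = 0"
    and shift_invariant: "u \<in> U \<Longrightarrow> u \<noteq> 0 \<Longrightarrow> finite S \<Longrightarrow> S \<subseteq> U \<Longrightarrow> 0 \<in> S \<Longrightarrow>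
      (\<And>s. s \<in> S \<Longrightarrow> s + u \<in> S) \<Longrightarrow> S = U"
begin

definition conjugate :: "'g \<Rightarrow> 'g \<Rightarrow> 'g" where
  "conjugate g x = g + x - g"

text \<open>For affine maps this multiplies a translation by the difference of the slopes of
  \<open>t2\<close> and \<open>t1\<close>; hence it is additive, commutes with conjugation, and is
  injective for different slopes.\<close>

definition conj_diff :: "'g \<Rightarrow> 'g \<Rightarrow> 'g \<Rightarrow> 'g" where
  "conj_diff t1 t2 x = conjugate t2 x - conjugate t1 x"

lemma diff_U: "u \<in> U \<Longrightarrow> v \<in> U \<Longrightarrow> u - v \<in> U"
  using add_U[of u "- v"] uminus_U by simp

lemma conjugate_U:
  assumes "g \<in> G" "u \<in> U"
  shows "conjugate g u \<in> U"
proof -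
  have "g + u - g - u \<in> U" using assms U_subset by (intro commutator_U) auto
  then have "(g + u - g - u) + u \<in> U" using assms(2) by (rule add_U)
  then show ?thesis by (simp add: conjugate_def)
qed

lemma conjugate_add: "conjugate g (x + y) = conjugate g x + conjugate g y"
  by (simp add: conjugate_def diff_conv_add_uminus add.assoc del: add_uminus_conv_diff)

lemma conjugate_uminus: "conjugate g (- x) = - conjugate g x"
  by (simp add: conjugate_def minus_add diff_conv_add_uminus add.assoc del: add_uminus_conv_diff)

lemma conjugate_minus: "conjugate g (x - y) = conjugate g x - conjugate g y"
  using conjugate_add[of g x "- y"] by (simp add: conjugate_uminus)

lemma conjugate_conj: "conjugate g (conjugate h x) = conjugate (g + h) x"
  by (simp add: conjugate_def minus_add diff_conv_add_uminus add.assoc del: add_uminus_conv_diff)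

lemma conjugate_eq_if_slope_eq:
  assumes "g \<in> G" "h \<in> G" "slope g = slope h" "u \<in> U"
  shows "conjugate g u = conjugate h u"
proof -
  define v where "v = - g + h"
  have v: "v \<in> U" using assms slope_eq_iff by (simp add: v_def)
  have "conjugate h u = conjugate g (conjugate v u)" by (simp add: conjugate_conj v_def add.assoc[symmetric])
  also have "conjugate v u = u" using commute_U[OF v assms(4)] by (simp add: conjugate_def)
  finally show ?thesis by simp
qed

lemma conjugate_commute:
  assumes "g \<in> G" "h \<in> G" "u \<in> U"
  shows "conjugate g (conjugate h u) = conjugate h (conjugate g u)"
proof -
  have "- (g + h) + (h + g) = - h + - g - - h - - g"
    by (simp add: minus_add diff_conv_add_uminus add.assoc del: add_uminus_conv_diff)
  also have "\<dots> \<in> U" using assms by (intro commutator_U uminus_G)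
  finally show ?thesis
    unfolding conjugate_conj using assms add_G by (intro conjugate_eq_if_slope_eq) (simp_all add: slope_eq_iff)
qed

lemma conjugate_free:
  assumes "g \<in> G" "h \<in> G" "slope g \<noteq> slope h" "u \<in> U" "conjugate g u = conjugate h u"
  shows "u = 0"
proof (rule free)
  show "- g + h \<in> G" using assms add_G uminus_G by blast
  show "- g + h \<notin> U" using assms slope_eq_iff by blast
  have "- g + h + u = - g + conjugate h u + h" by (simp add: conjugate_def add.assoc)
  also have "\<dots> = - g + conjugate g u + h" by (simp add: assms)
  also have "\<dots> = u + (- g + h)"
    by (simp add: conjugate_def diff_conv_add_uminus add.assoc[symmetric] del: add_uminus_conv_diff)
  finally show "- g + h + u = u + (- g + h)" .
qed fact

lemma conj_diff_add:
  assumes "t1 \<in> G" "t2 \<in> G" "x \<in> U" "y \<in> U"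
  shows "conj_diff t1 t2 (x + y) = conj_diff t1 t2 x + conj_diff t1 t2 y"
proof -
  have "- conjugate t1 (x + y) = - conjugate t1 x + - conjugate t1 y"
    using commute_U[OF uminus_U[OF conjugate_U[OF assms(1,3)]] uminus_U[OF conjugate_U[OF assms(1,4)]]]
    by (simp add: conjugate_add minus_add)
  then have "conj_diff t1 t2 (x + y) = conjugate t2 x + (conjugate t2 y + - conjugate t1 x) + - conjugate t1 y"
    by (simp only: conj_diff_def diff_conv_add_uminus conjugate_add add.assoc)
  also have "conjugate t2 y + - conjugate t1 x = - conjugate t1 x + conjugate t2 y"
    using assms by (intro commute_U uminus_U conjugate_U)
  finally show ?thesis by (simp only: conj_diff_def diff_conv_add_uminus add.assoc)
qed

lemma conj_diff_U:
  assumes "t1 \<in> G" "t2 \<in> G" "x \<in> U"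
  shows "conj_diff t1 t2 x \<in> U"
  unfolding conj_diff_def using assms by (intro diff_U conjugate_U)

lemma conj_diff_conj:
  assumes "t1 \<in> G" "t2 \<in> G" "h \<in> G" "x \<in> U"
  shows "conj_diff t1 t2 (conjugate h x) = conjugate h (conj_diff t1 t2 x)"
  unfolding conj_diff_def conjugate_minus using assms conjugate_commute by simp

lemma inj_on_conj_diff:
  assumes "t1 \<in> G" "t2 \<in> G" "slope t1 \<noteq> slope t2"
  shows "inj_on (conj_diff t1 t2) U"
proof (rule inj_onI)
  fix x y assume xy: "x \<in> U" "y \<in> U" "conj_diff t1 t2 x = conj_diff t1 t2 y"
  have "conj_diff t1 t2 (x - y) = conj_diff t1 t2 x - conj_diff t1 t2 y"
    using conj_diff_add[OF assms(1,2) diff_U[OF xy(1,2)] xy(2)] by (simp add: eq_diff_eq)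
  then have "conj_diff t1 t2 (x - y) = 0" using xy(3) by simp
  then have "conjugate t1 (x - y) = conjugate t2 (x - y)" by (simp add: conj_diff_def)
  then have "x - y = 0" using assms xy diff_U by (intro conjugate_free[of t1 t2]) auto
  then show "x = y" by simp
qed

text \<open>In field coordinates this is \<open>u + a * g\<close> with \<open>a\<close> the slope of
  \<open>t\<close>, the map of sum-product theory. For different slopes a collision means that
  \<open>g\<close> is a quotient of a difference of translations by a difference of slopes.\<close>

definition pivot :: "'g \<Rightarrow> 'g \<times> 'g \<Rightarrow> 'g" where
  "pivot g p = fst p + conjugate (snd p) g"

lemma pivot_collision:
  assumes "u1 \<in> U" "u2 \<in> U" "t1 \<in> G" "t2 \<in> G" "g \<in> U"
    and "pivot g (u1, t1) = pivot g (u2, t2)"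
  shows "conj_diff t1 t2 g = u1 - u2"
proof -
  have "u1 = u2 + (conjugate t2 g - conjugate t1 g)"
    using assms(6) by (simp add: pivot_def eq_diff_eq add_diff_eq)
  also have "\<dots> = conj_diff t1 t2 g + u2"
    unfolding conj_diff_def using assms by (intro commute_U diff_U conjugate_U)
  finally show ?thesis by simp
qed

text \<open>
  The pivot is the first multiple of a nonzero translation for which the map
  \<open>pivot\<close> is injective; if there is none, then \<open>U\<close> is finite and a pivot with few collisions
  exists by averaging. In both cases the image under some \<open>conj_diff t1 t2\<close> of the pivot is a
  short sum of elements of \<open>H\<close>.
\<close>
theorem pivoting:
  assumes finH: "finite H" and HG: "H \<subseteq> G" and H0: "0 \<in> H" and H_sym: "\<And>x. x \<in> H \<Longrightarrow> - x \<in> H"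
    and noncomm: "h1 \<in> H" "h2 \<in> H" "h1 + h2 \<noteq> h2 + h1"
  defines "U0 \<equiv> nfold_sum 4 H \<inter> U" and "n \<equiv> card (slope ` H)"
  shows "card H \<le> card U0 * n" "card U0 * n \<le> card (nfold_sum 5 H)"
    "\<exists>W\<subseteq>U. card W * n \<le> card (nfold_sum 35 H) \<and>
      (card U0 * n \<le> 2 * card W \<or> finite U \<and> card U \<le> 2 * card W)"
proof -
  have "slope ` H \<subseteq> slope ` H" ..
  then obtain T where T: "T \<subseteq> H" "inj_on slope T" "slope ` H = slope ` T"
    unfolding subset_image_inj by blast
  have finT: "finite T" using T(1) finH finite_subset by blast
  have TG: "T \<subseteq> G" using T(1) HG by blast
  have n: "n = card T" using T by (simp add: n_def card_image)
  have finU0: "finite U0" using finH by (simp add: U0_def finite_nfold_sum)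
  have U0U: "U0 \<subseteq> U" by (simp add: U0_def)
  have H1: "x \<in> nfold_sum (Suc 0) H" if "x \<in> H" for x using that by simp
  have sum2: "x + y \<in> nfold_sum k H" if "x \<in> nfold_sum i H" "y \<in> nfold_sum j H" "k = i + j" for x y i j k

    using nfold_sum_add[OF that(1,2)] that(3) by simp
  have neg: "- x \<in> nfold_sum k H" if "x \<in> nfold_sum k H" for x k
    using nfold_sum_uminus[OF H_sym that] .
  have conjugate_nfold: "conjugate t x \<in> nfold_sum (Suc (Suc k)) H" if "t \<in> H" "x \<in> nfold_sum k H" for t x k
  proof -
    have "t + x \<in> nfold_sum (Suc k) H" using sum2[OF H1[OF that(1)] that(2)] by simp
    then show ?thesis
      unfolding conjugate_def diff_conv_add_uminus
      by (rule sum2[OF _ H1[OF H_sym[OF that(1)]]]) simp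
  qed
  have diff_nfold: "x - y \<in> nfold_sum k H"
    if "x \<in> nfold_sum i H" "y \<in> nfold_sum j H" "k = i + j" for x y i j k
    using sum2[OF that(1) neg[OF that(2)] that(3)] by simp
  have cd_nfold: "conj_diff t1 t2 x \<in> nfold_sum (2 * k + 4) H"
    if "t1 \<in> H" "t2 \<in> H" "x \<in> nfold_sum k H" for t1 t2 x k
    unfolding conj_diff_def
    by (rule diff_nfold[OF conjugate_nfold[OF that(2,3)] conjugate_nfold[OF that(1,3)]]) simp
  have transversal: "inj_on (\<lambda>(x, t). x + t) (W \<times> T)" if "W \<subseteq> U" for W
  proof (rule inj_onI, clarify)
    fix x t y s assume *: "x \<in> W" "t \<in> T" "y \<in> W" "s \<in> T" "x + t = y + s"
    have "t = - x + y + s" using *(5) by (metis add.assoc minus_add_cancel)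
    then have eq: "- s + t = conjugate (- s) (- x + y)" by (simp add: conjugate_def add.assoc)
    have "- x + y \<in> U" "- s \<in> G" using * that TG by (auto intro!: uminus_U add_U uminus_G)
    then have "- s + t \<in> U" unfolding eq using conjugate_U by blast
    then have "slope s = slope t" using slope_eq_iff * TG by blast
    then have "s = t" using T(2) * by (auto dest: inj_onD)
    with * show "x = y \<and> t = s" by simp
  qed
  \<comment> \<open>One further summand multiplies a set of translations by the number of slopes,
    because elements of \<open>T\<close> lie in different cosets of \<open>U\<close>.\<close>
  have card_transversal: "card W * n \<le> card (nfold_sum (Suc k) H)" if "W \<subseteq> U" "W \<subseteq> nfold_sum k H" for W k
  proof -
    have "card W * n = card ((\<lambda>(x, t). x + t) ` (W \<times> T))"
      using transversal[OF that(1)] by (simp add: card_image card_cartesian_product n)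
    also have "\<dots> \<le> card (nfold_sum (Suc k) H)"
      using that(2) T(1) finH by (intro card_mono finite_nfold_sum) auto
    finally show ?thesis .
  qed
  show "card U0 * n \<le> card (nfold_sum 5 H)"
    using card_transversal[of U0 4] U0U by (simp add: U0_def del: nfold_sum.simps)
  show "card H \<le> card U0 * n"
  proof -
    have "H \<subseteq> (\<lambda>(u, t). t + u) ` (U0 \<times> T)"
    proof
      fix h assume h: "h \<in> H"
      then have "slope h \<in> slope ` T" unfolding T(3)[symmetric] by simp
      then obtain t where t: "t \<in> T" "slope h = slope t" by auto
      have "- t + h \<in> U" using slope_eq_iff[of t h] t h TG HG by auto
      moreover have "- t + h \<in> nfold_sum 4 H"
        using nfold_sum_mono[OF H0, of 2 4] sum2[OF H1 H1, of "- t" h 2] h t T(1) H_sym by auto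
      ultimately show "h \<in> (\<lambda>(u, t). t + u) ` (U0 \<times> T)"
        using t(1) by (intro image_eqI[of _ _ "(- t + h, t)"]) (auto simp: U0_def add.assoc[symmetric])
    qed
    then have "card H \<le> card (U0 \<times> T)"
      by (rule surj_card_le[rotated]) (use finU0 finT in simp)
    then show ?thesis by (simp add: card_cartesian_product n)
  qed
  \<comment> \<open>The commutator of a non-commuting pair is a nonzero translation. It has four
    summands from \<open>H\<close>, which is why \<open>U0\<close> is built from fourfold
    sums.\<close>
  define u0 where "u0 = h1 + h2 - h1 - h2"
  have u0: "u0 \<in> U0" "u0 \<noteq> 0"
  proof -
    have 2: "h1 + h2 \<in> nfold_sum 2 H"
      by (rule sum2[OF H1 H1]) (use noncomm in simp_all)
    have 3: "h1 + h2 - h1 \<in> nfold_sum 3 H"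
      unfolding diff_conv_add_uminus
      by (rule sum2[OF 2 H1]) (use noncomm H_sym in simp_all)
    have "u0 \<in> nfold_sum 4 H"
      unfolding u0_def diff_conv_add_uminus[of _ h2]
      by (rule sum2[OF 3 H1]) (use noncomm H_sym in simp_all)
    moreover have "u0 \<in> U" unfolding u0_def using noncomm HG by (intro commutator_U) auto
    ultimately show "u0 \<in> U0" by (simp add: U0_def)
    show "u0 \<noteq> 0"
      using noncomm(3) by (metis diff_add_cancel diff_eq_eq eq_iff_diff_eq_0 u0_def add_0)
  qed
  have zero_U0: "0 \<in> U0"
    using nfold_sum_mono[OF H0, of 0 4] zero_U by (auto simp: U0_def)
  \<comment> \<open>A single slope would be that of \<open>0 \<in> H\<close>; then all of
    \<open>H\<close> would be translations and commute.\<close>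
  have "\<exists>t1\<in>T. \<exists>t2\<in>T. slope t1 \<noteq> slope t2"
  proof (rule ccontr)
    assume "\<not> ?thesis"
    then have same: "slope t1 = slope t2" if "t1 \<in> T" "t2 \<in> T" for t1 t2 using that by blast
    have "slope h = slope 0" if "h \<in> H" for h
    proof -
      have "slope h \<in> slope ` T" "slope 0 \<in> slope ` T"
        unfolding T(3)[symmetric] using that H0 by simp_all
      then obtain t1 t2 where "t1 \<in> T" "t2 \<in> T" "slope h = slope t1" "slope 0 = slope t2" by auto
      then show ?thesis using same[of t1 t2] by simp
    qed
    note slope_0 = this
    have "h \<in> U" if "h \<in> H" for h
      using slope_eq_iff[of 0 h] slope_0[OF that] that HG H0 by auto
    then show False using noncomm commute_U by blast
  qed
  then obtain s1 s2 where s12: "s1 \<in> T" "s2 \<in> T" "s1 \<noteq> s2" by auto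
  have T_slope: "slope t1 \<noteq> slope t2" if "t1 \<in> T" "t2 \<in> T" "t1 \<noteq> t2" for t1 t2
    using that T(2) by (auto dest: inj_onD)
  define P where "P = U0 \<times> T"
  define m where "m = card P"
  have finP: "finite P" using finU0 finT by (simp add: P_def)
  have m: "m = card U0 * n" by (simp add: m_def P_def card_cartesian_product n)
  \<comment> \<open>The bad pivots. Each solves one of finitely many equations
    \<open>conj_diff t1 t2 g = u1 - u2\<close> with different slopes, and injectivity leaves at most
    one solution of each, so \<open>S\<close> is finite.\<close>
  define S where "S = {g\<in>U. \<not> inj_on (pivot g) P}"
  have same_slope: "u1 = u2" if "pivot g (u1, t) = pivot g (u2, t)" for g u1 u2 t
    using that by (simp add: pivot_def)
  have S_witness: "\<exists>t1\<in>T. \<exists>t2\<in>T. \<exists>u1\<in>U0. \<exists>u2\<in>U0. t1 \<noteq> t2 \<and> conj_diff t1 t2 g = u1 - u2" if "g \<in> S" for g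
  proof -
    from that obtain u1 t1 u2 t2 where *: "u1 \<in> U0" "u2 \<in> U0" "t1 \<in> T" "t2 \<in> T" "(u1, t1) \<noteq> (u2, t2)"
      "pivot g (u1, t1) = pivot g (u2, t2)" "g \<in> U"
      by (auto simp: S_def inj_on_def P_def)
    then have "t1 \<noteq> t2" using same_slope by blast
    moreover have "conj_diff t1 t2 g = u1 - u2"
      using * U0U TG by (intro pivot_collision) auto
    ultimately show ?thesis using * by blast
  qed
  have finS: "finite S"
  proof (rule finite_subset)
    show "S \<subseteq> (\<Union>(t1, t2)\<in>{p\<in>T \<times> T. fst p \<noteq> snd p}. \<Union>(u1, u2)\<in>U0 \<times> U0. conj_diff t1 t2 -` {u1 - u2} \<inter> U)"
    proof
      fix g assume g: "g \<in> S"
      with S_witness[OF g]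
      show "g \<in> (\<Union>(t1, t2)\<in>{p\<in>T \<times> T. fst p \<noteq> snd p}. \<Union>(u1, u2)\<in>U0 \<times> U0. conj_diff t1 t2 -` {u1 - u2} \<inter> U)"
        by (fastforce simp: S_def)
    qed
    have "finite (conj_diff t1 t2 -` {c} \<inter> U)" if "t1 \<in> T" "t2 \<in> T" "t1 \<noteq> t2" for t1 t2 c
      using that TG T_slope by (intro finite_vimage_IntI inj_on_conj_diff) auto
    then show "finite (\<Union>(t1, t2)\<in>{p\<in>T \<times> T. fst p \<noteq> snd p}. \<Union>(u1, u2)\<in>U0 \<times> U0. conj_diff t1 t2 -` {u1 - u2} \<inter> U)"
      using finT finU0 by (intro finite_UN_I finite_subset[of "{p\<in>T \<times> T. fst p \<noteq> snd p}" "T \<times> T"]) auto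
  qed
  have "\<exists>g\<in>U. \<exists>t1\<in>T. \<exists>t2\<in>T. t1 \<noteq> t2 \<and> conj_diff t1 t2 g \<in> nfold_sum 20 H \<and>
      (m \<le> 2 * card (pivot g ` P) \<or> finite U \<and> card U \<le> 2 * card (pivot g ` P))"
  proof (cases "S = U")
    case False
    have "0 \<in> S"
    proof -
      have "pivot 0 (0, s1) = pivot 0 (0, s2)" by (simp add: pivot_def conjugate_def)
      then have "\<not> inj_on (pivot 0) P"
        using s12 zero_U0 unfolding inj_on_def P_def by blast
      then show ?thesis using zero_U by (simp add: S_def)
    qed
    \<comment> \<open>A good pivot next to a bad one. The good one makes \<open>pivot\<close>
      injective; the collision at the bad one controls its image under
      \<open>conj_diff\<close>.\<close>
    then obtain g' where g': "g' \<in> S" "g' + u0 \<notin> S"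
      using shift_invariant[of u0 S] u0 U0U finS False by (auto simp: S_def)
    have gU: "g' \<in> U" "g' + u0 \<in> U" "u0 \<in> U" using g' u0 U0U add_U by (auto simp: S_def)
    then have "inj_on (pivot (g' + u0)) P" using g'(2) by (simp add: S_def)
    then have "m = card (pivot (g' + u0) ` P)" by (simp add: card_image m_def)
    moreover obtain t1 t2 u1 u2 where *: "t1 \<in> T" "t2 \<in> T" "u1 \<in> U0" "u2 \<in> U0" "t1 \<noteq> t2"
      "conj_diff t1 t2 g' = u1 - u2"
      using S_witness[OF g'(1)] by blast
    \<comment> \<open>The pivot itself need not be a short sum, but its image is: 8 summands for
      \<open>u1 - u2\<close> and 2 * 4 + 4 for the image of \<open>u0\<close>.\<close>
    moreover have "conj_diff t1 t2 (g' + u0) \<in> nfold_sum 20 H"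
    proof -
      have "conj_diff t1 t2 (g' + u0) = u1 - u2 + conj_diff t1 t2 u0"
        using * TG gU conj_diff_add[of t1 t2 g' u0] by auto
      moreover have "u1 - u2 \<in> nfold_sum (4 + 4) H"
        using * by (intro diff_nfold[of _ 4 _ 4]) (auto simp: U0_def simp del: nfold_sum.simps)
      moreover have "conj_diff t1 t2 u0 \<in> nfold_sum (2 * 4 + 4) H"
        using * T(1) u0 by (intro cd_nfold) (auto simp: U0_def simp del: nfold_sum.simps)
      ultimately show ?thesis using sum2[of "u1 - u2" "4 + 4" _ "2 * 4 + 4" 20] by simp
    qed
    ultimately show ?thesis using gU(2) by (intro bexI[of _ "g' + u0"] bexI[of _ t1] bexI[of _ t2]) auto
  next
    case True
    with finS have finU: "finite U" by simp
    define N where "N = real (card U)"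
    have N: "N > 0" using finU zero_U by (auto simp: N_def card_gt_0_iff)
    have m0: "m > 0"
      using zero_U0 s12 finP by (auto simp: m_def P_def card_gt_0_iff)
    define c where "c g = (\<Sum>p\<in>P. real (card {p'\<in>P. pivot g p' = pivot g p}))" for g
    have "(\<Sum>g\<in>U. c g) = (\<Sum>g\<in>U. \<Sum>p\<in>P. \<Sum>p'\<in>P. of_bool (pivot g p' = pivot g p))"
      unfolding c_def using finP by (simp add: real_card_filter del: sum_of_bool_eq)
    also have "\<dots> = (\<Sum>p\<in>P. \<Sum>g\<in>U. \<Sum>p'\<in>P. of_bool (pivot g p' = pivot g p))"
      by (rule sum.swap)
    also have "\<dots> = (\<Sum>p\<in>P. \<Sum>p'\<in>P. \<Sum>g\<in>U. of_bool (pivot g p' = pivot g p))"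
      by (intro sum.cong refl sum.swap)
    also have "\<dots> = (\<Sum>p\<in>P. \<Sum>p'\<in>P. real (card {g\<in>U. pivot g p' = pivot g p}))"
      using finU by (simp add: real_card_filter del: sum_of_bool_eq)
    \<comment> \<open>A diagonal pair collides for every \<open>g\<close>, any other pair for at
      most one: equal slopes force equal translations, and otherwise \<open>conj_diff\<close> is
      injective.\<close>
    also have "\<dots> \<le> (\<Sum>p\<in>P. \<Sum>p'\<in>P. N * of_bool (p' = p) + 1)"
    proof (intro sum_mono)
      fix p p' assume p: "p \<in> P" "p' \<in> P"
      show "real (card {g\<in>U. pivot g p' = pivot g p}) \<le> N * of_bool (p' = p) + 1"
      proof (cases "p' = p")
        case False
        obtain u t u' t' where pt: "p = (u, t)" "p' = (u', t')" by fastforce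
        then have ut: "u \<in> U" "u' \<in> U" "t \<in> T" "t' \<in> T" "t \<in> G" "t' \<in> G"
          using p U0U TG by (auto simp: P_def)
        have "g = h" if "g \<in> {g\<in>U. pivot g p' = pivot g p}" "h \<in> {g\<in>U. pivot g p' = pivot g p}" for g h
        proof -
          have *: "pivot g (u', t') = pivot g (u, t)" "pivot h (u', t') = pivot h (u, t)" "g \<in> U" "h \<in> U"
            using that pt by auto
          have "t' \<noteq> t" using same_slope[of g u' t u] * False pt by auto
          then have inj: "inj_on (conj_diff t' t) U" using T_slope ut by (intro inj_on_conj_diff) auto
          have "conj_diff t' t g = u' - u" "conj_diff t' t h = u' - u"
            using * ut by (auto intro: pivot_collision)
          then show "g = h" by (intro inj_onD[OF inj _ *(3,4)]) simp
        qed
        then have "card {g\<in>U. pivot g p' = pivot g p} \<le> Suc 0"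
          using finU by (subst card_le_Suc0_iff_eq) auto
        then show ?thesis using False by simp
      qed (simp add: N_def)
    qed
    also have "\<dots> = real m * N + (real m)\<^sup>2"
      using finP by (simp add: sum.distrib m_def power2_eq_square distrib_left flip: sum_distrib_left)
    finally have sum_c: "(\<Sum>g\<in>U. c g) \<le> real m * N + (real m)\<^sup>2" .
    have "\<exists>g\<in>U. c g \<le> real m + (real m)\<^sup>2 / N"
    proof (rule ccontr)
      assume "\<not> ?thesis"
      then have "(\<Sum>g\<in>U. real m + (real m)\<^sup>2 / N) < (\<Sum>g\<in>U. c g)"
        using finU zero_U by (intro sum_strict_mono) auto
      then show False using sum_c N by (simp add: N_def[symmetric] distrib_left mult.commute)
    qed
    then obtain g where g: "g \<in> U" "c g \<le> real m + (real m)\<^sup>2 / N" by blast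
    obtain t1 t2 u1 u2 where *: "t1 \<in> T" "t2 \<in> T" "u1 \<in> U0" "u2 \<in> U0" "t1 \<noteq> t2"
      "conj_diff t1 t2 g = u1 - u2"
      using S_witness[of g] g(1) True by blast
    have "u1 - u2 \<in> nfold_sum (4 + 4) H"
      using * by (intro diff_nfold[of _ 4 _ 4]) (auto simp: U0_def simp del: nfold_sum.simps)
    then have "conj_diff t1 t2 g \<in> nfold_sum 20 H"
      using *(6) nfold_sum_mono[OF H0, of 8 20] by auto
    \<comment> \<open>With few collisions the image has at least \<open>1 / (1 / m + 1 / N)\<close>
      elements, hence at least half of the smaller of \<open>m\<close> and \<open>N\<close>.\<close>
    moreover have "m \<le> 2 * card (pivot g ` P) \<or> card U \<le> 2 * card (pivot g ` P)"
    proof (rule ccontr)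
      define k where "k = real (card (pivot g ` P))"
      assume "\<not> ?thesis"
      then have k: "2 * k < real m" "2 * k < N" by (auto simp: k_def N_def)
      have "(real m)\<^sup>2 \<le> k * c g"
        using card_square_le_collisions[OF finP, of "pivot g"] by (simp add: c_def k_def m_def)
      also have "\<dots> \<le> k * (real m + (real m)\<^sup>2 / N)"
        using g(2) by (intro mult_left_mono) (auto simp: k_def)
      finally have "2 * (real m)\<^sup>2 \<le> (2 * k) * real m + (2 * k) * ((real m)\<^sup>2 / N)"
        by (simp add: distrib_left)
      also have "\<dots> < real m * real m + N * ((real m)\<^sup>2 / N)"
        using k m0 N by (intro add_strict_mono mult_strict_right_mono) auto
      also have "\<dots> = 2 * (real m)\<^sup>2" using N by (simp add: power2_eq_square)
      finally show False by simp
    qed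
    ultimately show ?thesis using g(1) * finU by blast
  qed
  then obtain g t1 t2 where gt: "g \<in> U" "t1 \<in> T" "t2 \<in> T" "t1 \<noteq> t2" "conj_diff t1 t2 g \<in> nfold_sum 20 H"
    "m \<le> 2 * card (pivot g ` P) \<or> finite U \<and> card U \<le> 2 * card (pivot g ` P)"
    by blast
  then have tG: "t1 \<in> G" "t2 \<in> G" "t1 \<in> H" "t2 \<in> H" using TG T(1) by auto
  \<comment> \<open>Applying \<open>conj_diff t1 t2\<close> preserves the size and makes the
    elements short: 12 summands for the part in \<open>U0\<close> and 20 + 2 for the conjugated
    pivot, in all 34. A representative of the slope makes 35.\<close>
  define W where "W = conj_diff t1 t2 ` pivot g ` P"
  have im_U: "pivot g ` P \<subseteq> U"
    using gt(1) U0U TG by (auto simp: pivot_def P_def intro!: add_U conjugate_U)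
  have "card W = card (pivot g ` P)"
    unfolding W_def using gt T_slope tG im_U
    by (intro card_image inj_on_subset[OF inj_on_conj_diff]) auto
  moreover have W: "W \<subseteq> U" using im_U tG by (auto simp: W_def intro!: conj_diff_U)
  moreover have "card W * n \<le> card (nfold_sum (Suc 34) H)"
  proof (rule card_transversal[OF W], rule subsetI)
    fix x assume "x \<in> W"
    then obtain u t where x: "x = conj_diff t1 t2 (u + conjugate t g)" "u \<in> U0" "t \<in> T"
      by (auto simp: W_def P_def pivot_def)
    then have ut: "u \<in> U" "t \<in> G" "t \<in> H" using U0U TG T(1) by auto
    have "x = conj_diff t1 t2 u + conjugate t (conj_diff t1 t2 g)"
      using ut tG gt(1) x(1) by (simp add: conj_diff_add conj_diff_conj conjugate_U)
    moreover have "conj_diff t1 t2 u \<in> nfold_sum (2 * 4 + 4) H"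
      using x tG by (intro cd_nfold) (auto simp: U0_def simp del: nfold_sum.simps)
    moreover have "conjugate t (conj_diff t1 t2 g) \<in> nfold_sum (Suc (Suc 20)) H"
      using ut gt by (intro conjugate_nfold)
    ultimately show "x \<in> nfold_sum 34 H"
      by (simp only:) (erule (1) sum2, simp)
  qed
  ultimately show "\<exists>W\<subseteq>U. card W * n \<le> card (nfold_sum 35 H) \<and>
      (card U0 * n \<le> 2 * card W \<or> finite U \<and> card U \<le> 2 * card W)"
    using gt(6) m by (auto intro!: exI[of _ W] simp del: nfold_sum.simps)
qed

end

section \<open>The affine group of a field\<close>

text \<open>
  The carrier of the field varies with \<open>p\<close>, so affine maps are extended by the identity outside the
  carrier and become elements of a group of bijections of the whole type. This group is an instance of
  \<^class>\<open>group_add\<close>, written additively although it is not commutative.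
\<close>
typedef 'a bijection = "{f :: 'a \<Rightarrow> 'a. bij f}" morphisms app Bijection
  by (rule exI[of _ id]) simp

instantiation bijection :: (type) group_add
begin

definition "0 = Bijection id"
definition "f + g = Bijection (app f \<circ> app g)"
definition "- f = Bijection (inv_into UNIV (app f))"
definition "f - g = f + (- g :: 'a bijection)"

lemma bij_app: "bij (app f)"
  using app by blast

lemma app_zero [simp]: "app 0 = id"
  by (simp add: zero_bijection_def Bijection_inverse)

lemma app_plus: "app (f + g) = app f \<circ> app g"
  unfolding plus_bijection_def by (rule Bijection_inverse) (simp add: bij_comp bij_app)

lemma app_uminus: "app (- f) = inv_into UNIV (app f)"
  by (simp add: uminus_bijection_def Bijection_inverse bij_imp_bij_inv bij_app)

instance
proof
  fix a b c :: "'a bijection"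
  show "a + b + c = a + (b + c)" by (simp add: app_inject[symmetric] app_plus comp_assoc)
  show "0 + a = a" "a + 0 = a" by (simp_all add: app_inject[symmetric] app_plus)
  show "- a + a = 0"
    by (simp add: app_inject[symmetric] app_plus app_uminus bij_is_inj[OF bij_app])
  show "a + - b = a - b" by (simp add: minus_bijection_def)
qed

end

lemma app_plus_apply [simp]: "app (f + g) x = app f (app g x)"
  by (simp add: app_plus)

lemma bijection_eqI: "(\<And>x. app f x = app g x) \<Longrightarrow> f = g"
  by (simp add: app_inject[symmetric] fun_eq_iff)

text \<open>The extra assumption holds vacuously in characteristic zero, where no such finite
  \<open>S\<close> exists, and in prime fields, where every nonzero element generates the additive
  group. It fails in proper extensions of a prime field \<open>F_p\<close>, with the prime field as
  \<open>S\<close>.\<close>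

locale affine_plane = field R for R :: "'a ring" (structure) +
  assumes shift_invariant_carrier:
    "\<lbrakk>c \<in> carrier R; c \<noteq> \<zero>; finite S; S \<subseteq> carrier R; \<zero> \<in> S; \<And>s. s \<in> S \<Longrightarrow> s \<oplus> c \<in> S\<rbrakk> \<Longrightarrow> S = carrier R"
begin

text \<open>Meaningful only for nonzero \<open>a\<close>; for \<open>a = \<zero>\<close> the
  argument of \<open>Bijection\<close> is not a bijection.\<close>

definition aff :: "'a \<Rightarrow> 'a \<Rightarrow> 'a bijection" where
  "aff a b = Bijection (\<lambda>x. if x \<in> carrier R then a \<otimes> x \<oplus> b else x)"

definition Aff :: "'a bijection set" where
  "Aff = {aff a b | a b. a \<in> carrier R - {\<zero>} \<and> b \<in> carrier R}"

definition shifts :: "'a bijection set" where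
  "shifts = aff \<one> ` carrier R"

definition slope :: "'a bijection \<Rightarrow> 'a" where
  "slope g = app g \<one> \<ominus> app g \<zero>"

lemma inv_nonzero [simp]:
  assumes "a \<in> carrier R" "a \<noteq> \<zero>"
  shows "inv a \<in> carrier R" "inv a \<noteq> \<zero>" "a \<otimes> inv a = \<one>" "inv a \<otimes> a = \<one>"
  using assms field_Units by (auto simp: Units_l_inv_ex)

lemma mult_nonzero [simp]:
  "\<lbrakk>a \<in> carrier R; b \<in> carrier R; a \<noteq> \<zero>; b \<noteq> \<zero>\<rbrakk> \<Longrightarrow> a \<otimes> b \<noteq> \<zero>"
  using integral by blast

lemma app_aff:
  assumes "a \<in> carrier R" "a \<noteq> \<zero>" "b \<in> carrier R"
  shows "app (aff a b) = (\<lambda>x. if x \<in> carrier R then a \<otimes> x \<oplus> b else x)"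
proof -
  have "bij (\<lambda>x. if x \<in> carrier R then a \<otimes> x \<oplus> b else x)" (is "bij ?f")
  proof (rule o_bij)
    let ?g = "\<lambda>x. if x \<in> carrier R then inv a \<otimes> (x \<ominus> b) else x"
    have "inv a \<otimes> (a \<otimes> x \<oplus> b \<ominus> b) = x" if "x \<in> carrier R" for x
    proof -
      have "inv a \<otimes> (a \<otimes> x \<oplus> b \<ominus> b) = (inv a \<otimes> a) \<otimes> x"
        using that assms inv_nonzero(1)[OF assms(1,2)] by algebra
      with that assms show ?thesis by simp
    qed
    then show "?g \<circ> ?f = id" using assms by (auto simp: fun_eq_iff)
    have "a \<otimes> (inv a \<otimes> (x \<ominus> b)) \<oplus> b = x" if "x \<in> carrier R" for x
    proof -
      have "a \<otimes> (inv a \<otimes> (x \<ominus> b)) \<oplus> b = (a \<otimes> inv a) \<otimes> (x \<ominus> b) \<oplus> b"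
        using that assms inv_nonzero(1)[OF assms(1,2)] by algebra
      also have "\<dots> = x \<ominus> b \<oplus> b" using that assms by simp
      also have "\<dots> = x" using that assms by algebra
      finally show ?thesis .
    qed
    then show "?f \<circ> ?g = id" using assms by (auto simp: fun_eq_iff)
  qed
  then show ?thesis by (simp add: aff_def Bijection_inverse)
qed

lemma aff_in_Aff [simp]:
  "\<lbrakk>a \<in> carrier R; a \<noteq> \<zero>; b \<in> carrier R\<rbrakk> \<Longrightarrow> aff a b \<in> Aff"
  by (auto simp: Aff_def)

lemma AffE:
  assumes "g \<in> Aff"
  obtains a b where "a \<in> carrier R" "a \<noteq> \<zero>" "b \<in> carrier R" "g = aff a b"
  using assms by (auto simp: Aff_def)

lemma slope_aff [simp]:
  assumes "a \<in> carrier R" "a \<noteq> \<zero>" "b \<in> carrier R"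
  shows "slope (aff a b) = a"
proof -
  have "a \<otimes> \<one> \<oplus> b \<ominus> (a \<otimes> \<zero> \<oplus> b) = a" using assms by algebra
  then show ?thesis using assms by (simp add: slope_def app_aff)
qed

lemma app_aff_zero [simp]:
  assumes "a \<in> carrier R" "a \<noteq> \<zero>" "b \<in> carrier R"
  shows "app (aff a b) \<zero> = b"
  using assms by (simp add: app_aff)

lemma aff_plus:
  assumes "a \<in> carrier R" "a \<noteq> \<zero>" "b \<in> carrier R" "c \<in> carrier R" "c \<noteq> \<zero>" "d \<in> carrier R"
  shows "aff a b + aff c d = aff (a \<otimes> c) (a \<otimes> d \<oplus> b)"
proof (rule bijection_eqI)
  fix x
  have "a \<otimes> c \<noteq> \<zero>" using assms integral by blast
  moreover have "a \<otimes> (c \<otimes> x \<oplus> d) \<oplus> b = a \<otimes> c \<otimes> x \<oplus> (a \<otimes> d \<oplus> b)" if "x \<in> carrier R"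
    using that assms by algebra
  ultimately show "app (aff a b + aff c d) x = app (aff (a \<otimes> c) (a \<otimes> d \<oplus> b)) x"
    using assms by (simp add: app_aff)
qed

lemma aff_one_zero: "aff \<one> \<zero> = 0"
  by (rule bijection_eqI) (simp add: app_aff)

lemma aff_uminus:
  assumes "a \<in> carrier R" "a \<noteq> \<zero>" "b \<in> carrier R"
  shows "- aff a b = aff (inv a) (\<ominus> (inv a \<otimes> b))"
proof (rule group_add_class.minus_unique)
  have "a \<otimes> (\<ominus> (inv a \<otimes> b)) \<oplus> b = \<ominus> ((a \<otimes> inv a) \<otimes> b) \<oplus> b"
    using assms inv_nonzero(1)[OF assms(1,2)] by algebra
  also have "\<dots> = \<zero>" using assms by (simp add: l_neg)
  finally show "aff a b + aff (inv a) (\<ominus> (inv a \<otimes> b)) = 0"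
    using assms by (simp add: aff_plus aff_one_zero)
qed

lemma Aff_plus: "g \<in> Aff \<Longrightarrow> h \<in> Aff \<Longrightarrow> g + h \<in> Aff"
  by (auto elim!: AffE simp: aff_plus)

lemma Aff_uminus: "g \<in> Aff \<Longrightarrow> - g \<in> Aff"
  by (auto elim!: AffE simp: aff_uminus)

lemma slope_in_carrier: "g \<in> Aff \<Longrightarrow> slope g \<in> carrier R"
  and slope_nonzero: "g \<in> Aff \<Longrightarrow> slope g \<noteq> \<zero>"
  by (auto elim!: AffE)

lemma slope_plus: "g \<in> Aff \<Longrightarrow> h \<in> Aff \<Longrightarrow> slope (g + h) = slope g \<otimes> slope h"
  by (auto elim!: AffE simp: aff_plus)

lemma slope_uminus: "g \<in> Aff \<Longrightarrow> slope (- g) = inv (slope g)"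
  by (auto elim!: AffE simp: aff_uminus)

lemma Aff_app_in_carrier: "g \<in> Aff \<Longrightarrow> x \<in> carrier R \<Longrightarrow> app g x \<in> carrier R"
  by (auto elim!: AffE simp: app_aff)

lemma Aff_eq_aff: "g \<in> Aff \<Longrightarrow> g = aff (slope g) (app g \<zero>)"
  by (auto elim!: AffE)

lemma shifts_iff: "g \<in> shifts \<longleftrightarrow> g \<in> Aff \<and> slope g = \<one>"
proof
  assume "g \<in> shifts"
  then show "g \<in> Aff \<and> slope g = \<one>" by (auto simp: shifts_def)
next
  assume "g \<in> Aff \<and> slope g = \<one>"
  then show "g \<in> shifts"
    using Aff_eq_aff[of g] Aff_app_in_carrier[of g \<zero>] by (auto simp: shifts_def)
qed

lemma line_unique:
  assumes "a \<in> carrier R" "b \<in> carrier R" "c \<in> carrier R" "d \<in> carrier R" "x \<in> carrier R" "y \<in> carrier R"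
    and "x \<noteq> y" "a \<otimes> x \<oplus> b = c \<otimes> x \<oplus> d" "a \<otimes> y \<oplus> b = c \<otimes> y \<oplus> d"
  shows "a = c \<and> b = d"
proof -
  have "(a \<ominus> c) \<otimes> (x \<ominus> y) = (a \<otimes> x \<oplus> b \<ominus> (c \<otimes> x \<oplus> d)) \<ominus> (a \<otimes> y \<oplus> b \<ominus> (c \<otimes> y \<oplus> d))"
    using assms(1-6) by algebra
  also have "\<dots> = \<zero> \<ominus> \<zero>"
  proof -
    have "a \<otimes> x \<oplus> b \<ominus> (c \<otimes> x \<oplus> d) = \<zero>" "a \<otimes> y \<oplus> b \<ominus> (c \<otimes> y \<oplus> d) = \<zero>"
      using assms by simp_all
    then show ?thesis by simp
  qed
  finally have "(a \<ominus> c) \<otimes> (x \<ominus> y) = \<zero>" by simp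
  then have "a \<ominus> c = \<zero> \<or> x \<ominus> y = \<zero>" using assms integral by blast
  then have ac: "a = c" using assms by simp
  have "b = (a \<otimes> x \<oplus> b) \<ominus> a \<otimes> x" using assms(1-6) by algebra
  also have "\<dots> = (c \<otimes> x \<oplus> d) \<ominus> c \<otimes> x" using assms(8) ac by simp
  also have "\<dots> = d" using assms(1-6) by algebra
  finally show ?thesis using ac by simp
qed

sublocale free_metabelian_action Aff shifts slope
proof
  fix g h u v :: "'a bijection"
  show "g + h \<in> Aff" if "g \<in> Aff" "h \<in> Aff" using that by (rule Aff_plus)
  show "- g \<in> Aff" if "g \<in> Aff" using that by (rule Aff_uminus)
  show "shifts \<subseteq> Aff" by (auto simp: shifts_iff)
  show "0 \<in> shifts" unfolding shifts_def aff_one_zero[symmetric] by simp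
  show "u + v \<in> shifts" if "u \<in> shifts" "v \<in> shifts"
    using that by (simp add: shifts_iff Aff_plus slope_plus)
  show "- u \<in> shifts" if "u \<in> shifts"
    using that by (simp add: shifts_iff Aff_uminus slope_uminus)
  show "u + v = v + u" if "u \<in> shifts" "v \<in> shifts"
    using that by (auto simp: shifts_def aff_plus a_comm)
  show "g + h - g - h \<in> shifts" if gh: "g \<in> Aff" "h \<in> Aff"
  proof -
    have *: "slope g \<in> carrier R" "slope h \<in> carrier R" "slope g \<noteq> \<zero>" "slope h \<noteq> \<zero>"
      using gh by (auto intro: slope_in_carrier dest: slope_nonzero)
    have "slope (g + h + - g + - h) = slope g \<otimes> slope h \<otimes> inv (slope g) \<otimes> inv (slope h)"
      using gh by (simp add: slope_plus slope_uminus Aff_plus Aff_uminus del: add_uminus_conv_diff)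
    also have "\<dots> = (slope g \<otimes> inv (slope g)) \<otimes> (slope h \<otimes> inv (slope h))"
      using * inv_nonzero(1)[OF *(1,3)] inv_nonzero(1)[OF *(2,4)] by algebra
    also have "\<dots> = \<one>" using * by simp
    finally show ?thesis
      using gh Aff_plus[OF Aff_plus[OF Aff_plus[OF gh] Aff_uminus[OF gh(1)]] Aff_uminus[OF gh(2)]]
      by (simp add: shifts_iff)
  qed
  show "slope g = slope h \<longleftrightarrow> - g + h \<in> shifts" if gh: "g \<in> Aff" "h \<in> Aff"
  proof -
    have *: "slope g \<in> carrier R" "slope h \<in> carrier R" "slope g \<noteq> \<zero>" "slope h \<noteq> \<zero>"
      using gh by (auto intro: slope_in_carrier dest: slope_nonzero)
    have "- g + h \<in> shifts \<longleftrightarrow> inv (slope g) \<otimes> slope h = \<one>"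
      using gh by (simp add: shifts_iff Aff_plus Aff_uminus slope_plus slope_uminus)
    also have "\<dots> \<longleftrightarrow> slope g = slope h"
    proof
      assume 1: "inv (slope g) \<otimes> slope h = \<one>"
      have "slope h = (slope g \<otimes> inv (slope g)) \<otimes> slope h" using * by simp
      also have "\<dots> = slope g \<otimes> (inv (slope g) \<otimes> slope h)"
        using * inv_nonzero(1)[OF *(1,3)] by algebra
      finally show "slope g = slope h" using 1 * by simp
    qed (use * in auto)
    finally show ?thesis ..
  qed
  show "u = 0" if A: "g \<in> Aff" "g \<notin> shifts" "u \<in> shifts" "g + u = u + g"
  proof -
    obtain a b where g: "a \<in> carrier R" "a \<noteq> \<zero>" "b \<in> carrier R" "g = aff a b"
      using A(1) by (rule AffE)
    obtain c where u: "c \<in> carrier R" "u = aff \<one> c" using A(3) by (auto simp: shifts_def)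
    have "a \<noteq> \<one>" using A(2) g by (auto simp: shifts_def)
    have "app (g + u) \<zero> = app (u + g) \<zero>" using A(4) by simp
    then have eq: "a \<otimes> c \<oplus> b = b \<oplus> c" using g u by (simp add: app_aff)
    have "(a \<ominus> \<one>) \<otimes> c = (a \<otimes> c \<oplus> b) \<ominus> (b \<oplus> c)" using g u by algebra
    also have "\<dots> = \<zero>" using eq g u by simp
    finally have "a \<ominus> \<one> = \<zero> \<or> c = \<zero>" using g u integral by blast
    then have "c = \<zero>" using \<open>a \<noteq> \<one>\<close> g by simp
    then show ?thesis using u aff_one_zero by simp
  qed
  show "S = shifts"
    if A: "u \<in> shifts" "u \<noteq> 0" "finite S" "S \<subseteq> shifts" "0 \<in> S" "\<And>s. s \<in> S \<Longrightarrow> s + u \<in> S" for S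
  proof -
    obtain c where u: "c \<in> carrier R" "u = aff \<one> c" using A(1) by (auto simp: shifts_def)
    have "c \<noteq> \<zero>" using A(2) u aff_one_zero by auto
    have "(\<lambda>g. app g \<zero>) ` S = carrier R"
    proof (rule shift_invariant_carrier[OF u(1) \<open>c \<noteq> \<zero>\<close>])
      show "(\<lambda>g. app g \<zero>) ` S \<subseteq> carrier R" using A(4) by (auto simp: shifts_def)
      show "\<zero> \<in> (\<lambda>g. app g \<zero>) ` S" using A(5) by force
      fix s assume "s \<in> (\<lambda>g. app g \<zero>) ` S"
      then obtain g where g: "g \<in> S" "s = app g \<zero>" by auto
      then obtain d where d: "d \<in> carrier R" "g = aff \<one> d" using A(4) by (auto simp: shifts_def)
      have "app (g + u) \<zero> = s \<oplus> c" using g d u by (simp add: app_aff a_comm)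
      then show "s \<oplus> c \<in> (\<lambda>g. app g \<zero>) ` S" using A(6)[OF g(1)] by (metis imageI)
    qed (use A in simp)
    moreover have "aff \<one> (app g \<zero>) = g" if "g \<in> S" for g
      using that \<open>S \<subseteq> shifts\<close> by (auto simp: shifts_def)
    ultimately have "shifts = (\<lambda>g. g) ` S"
      unfolding shifts_def by (metis (no_types, lifting) image_cong image_image)
    then show ?thesis by simp
  qed
qed

lemma card_shifts: "finite (carrier R) \<Longrightarrow> card shifts = card (carrier R)"
  and finite_shifts_iff: "finite shifts \<longleftrightarrow> finite (carrier R)"
proof -
  have "inj_on (aff \<one>) (carrier R)"
    by (rule inj_on_inverseI[of _ "\<lambda>g. app g \<zero>"]) simp
  then show "finite (carrier R) \<Longrightarrow> card shifts = card (carrier R)"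
    and "finite shifts \<longleftrightarrow> finite (carrier R)"
    by (simp_all add: shifts_def card_image finite_image_iff)
qed

section \<open>Counting rich affine maps\<close>

definition hits :: "'a set \<Rightarrow> 'a bijection \<Rightarrow> nat" where
  "hits Y g = card {y\<in>Y. app g y \<in> Y}"

text \<open>An affine map is determined by its values at two points. Each map in \<open>M\<close>
  provides at least \<open>k\<^sup>2 / 2\<close> ordered pairs of distinct points of
  \<open>Y\<close> mapped into \<open>Y\<close>, where \<open>k \<ge> 2\<close> is used to remove
  the diagonal, and all these pairs with their images embed into the fourth power of
  \<open>Y\<close>.\<close>

lemma card_rich_le:
  assumes Y: "Y \<subseteq> carrier R" "finite Y" and M: "M \<subseteq> Aff" "finite M"
    and rich: "\<And>g. g \<in> M \<Longrightarrow> k \<le> real (hits Y g)" and k: "k \<ge> 2"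
  shows "real (card M) * k\<^sup>2 \<le> 2 * real (card Y) ^ 4"
proof -
  define Z where "Z g = {y\<in>Y. app g y \<in> Y}" for g
  have finZ: "finite (Z g)" for g using Y by (simp add: Z_def)
  define T where "T = (SIGMA g:M. {p\<in>Z g \<times> Z g. fst p \<noteq> snd p})"
  have "real (card M) * (k\<^sup>2 / 2) = (\<Sum>g\<in>M. k\<^sup>2 / 2)" by simp
  also have "\<dots> \<le> (\<Sum>g\<in>M. real (card {p\<in>Z g \<times> Z g. fst p \<noteq> snd p}))"
  proof (rule sum_mono)
    fix g assume "g \<in> M"
    define z where "z = real (card (Z g))"
    have z: "k \<le> z" using rich[OF \<open>g \<in> M\<close>] by (simp add: z_def Z_def hits_def)
    have eq: "{p\<in>Z g \<times> Z g. fst p \<noteq> snd p} = Z g \<times> Z g - (\<lambda>x. (x, x)) ` Z g" by auto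
    have "card {p\<in>Z g \<times> Z g. fst p \<noteq> snd p} = card (Z g) * card (Z g) - card (Z g)"
      using finZ unfolding eq by (subst card_Diff_subset)
        (auto simp: card_cartesian_product card_image inj_on_def)
    then have "real (card {p\<in>Z g \<times> Z g. fst p \<noteq> snd p}) = z * (z - 1)"
      by (simp add: z_def of_nat_diff algebra_simps)
    moreover have "k * (k / 2) \<le> z * (z - 1)" using z k by (intro mult_mono) auto
    ultimately show "k\<^sup>2 / 2 \<le> real (card {p\<in>Z g \<times> Z g. fst p \<noteq> snd p})"
      by (simp add: power2_eq_square)
  qed
  also have "\<dots> = real (card T)" using M finZ by (simp add: T_def)
  also have "\<dots> \<le> real (card (Y \<times> Y \<times> Y \<times> Y))"
  proof (intro of_nat_mono card_inj_on_le)
    let ?f = "\<lambda>(g, x, y). (x, y, app g x, app g y)"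
    show "inj_on ?f T"
    proof (rule inj_onI)
      fix p q assume pq: "p \<in> T" "q \<in> T" "?f p = ?f q"
      obtain g x y h x' y' where pq_eq: "p = (g, x, y)" "q = (h, x', y')" by (metis prod_cases3)
      with pq have *: "(g, x, y) \<in> T" "(h, x', y') \<in> T" "x = x'" "y = y'"
        "app g x = app h x'" "app g y = app h y'"
        by auto
      then have xy: "x \<in> carrier R" "y \<in> carrier R" "x \<noteq> y" "g \<in> Aff" "h \<in> Aff"
        using Y M by (auto simp: T_def Z_def)
      obtain a b where g: "a \<in> carrier R" "a \<noteq> \<zero>" "b \<in> carrier R" "g = aff a b"
        using xy(4) by (rule AffE)
      obtain c d where h: "c \<in> carrier R" "c \<noteq> \<zero>" "d \<in> carrier R" "h = aff c d"
        using xy(5) by (rule AffE)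
      have "a = c \<and> b = d"
        using * xy g h by (intro line_unique[of a b c d x y]) (auto simp: app_aff)
      with g h * pq_eq show "p = q" by simp
    qed
    show "?f ` T \<subseteq> Y \<times> Y \<times> Y \<times> Y" by (auto simp: T_def Z_def)
  qed (use Y in simp)
  also have "\<dots> = real (card Y) ^ 4" by (simp add: card_cartesian_product eval_nat_numeral)
  finally show ?thesis by simp
qed

text \<open>
  Second moment over all non-vertical lines of the finite plane, including the horizontal ones:
  two points with distinct abscissae lie on exactly one line, so the numbers of points of
  \<open>Y \<times> Y\<close> on the lines are nearly uncorrelated.
\<close>
lemma card_rich_le_finite_field:
  assumes Y: "Y \<subseteq> carrier R" "finite Y" and M: "M \<subseteq> Aff" "finite M" and fin: "finite (carrier R)"
    and rich: "\<And>g. g \<in> M \<Longrightarrow> k \<le> real (hits Y g)"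
    and k: "2 * (real (card Y))\<^sup>2 \<le> k * real (card (carrier R))" "k > 0"
  shows "real (card M) * k\<^sup>2 \<le> 4 * real (card (carrier R)) * (real (card Y))\<^sup>2"
proof -
  define F where "F = carrier R"
  define p where "p = real (card F)"
  define n where "n = real (card Y)"
  have p: "p > 0" using fin zero_closed unfolding p_def F_def by (metis card_gt_0_iff empty_iff of_nat_0_less_iff)
  define on where "on a b x y \<longleftrightarrow> a \<otimes> x \<oplus> b = y" for a b x y
  define c where "c a b = real (card {x\<in>Y. a \<otimes> x \<oplus> b \<in> Y})" for a b
  have c_eq: "c a b = (\<Sum>x\<in>Y. \<Sum>y\<in>Y. of_bool (on a b x y))" for a b
    unfolding c_def real_card_filter[OF Y(2)]
  proof (intro sum.cong refl)
    fix x
    have "(\<Sum>y\<in>Y. of_bool (on a b x y)) = (\<Sum>y\<in>Y. if y = a \<otimes> x \<oplus> b then 1 else (0 :: real))"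
      by (intro sum.cong) (auto simp: on_def)
    then show "of_bool (a \<otimes> x \<oplus> b \<in> Y) = (\<Sum>y\<in>Y. of_bool (on a b x y) :: real)"
      using Y(2) by simp
  qed
  have one_b: "(\<Sum>b\<in>F. of_bool (on a b x y)) = (1 :: real)" if "a \<in> F" "x \<in> Y" "y \<in> Y" for a x y
  proof -
    have car: "a \<in> carrier R" "x \<in> carrier R" "y \<in> carrier R" using that Y by (auto simp: F_def)
    have "on a b x y \<longleftrightarrow> b = y \<ominus> a \<otimes> x" if "b \<in> F" for b
    proof
      assume "on a b x y"
      then have "y \<ominus> a \<otimes> x = (a \<otimes> x \<oplus> b) \<ominus> a \<otimes> x" by (simp add: on_def)
      also have "\<dots> = b" using car that unfolding F_def by algebra
      finally show "b = y \<ominus> a \<otimes> x" ..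
    next
      assume "b = y \<ominus> a \<otimes> x"
      moreover have "a \<otimes> x \<oplus> (y \<ominus> a \<otimes> x) = y" using car by algebra
      ultimately show "on a b x y" by (simp add: on_def)
    qed
    then have "(\<Sum>b\<in>F. of_bool (on a b x y)) = (\<Sum>b\<in>F. if b = y \<ominus> a \<otimes> x then 1 else (0 :: real))"
      by (intro sum.cong) auto
    also have "\<dots> = 1" using car fin by (simp add: F_def)
    finally show ?thesis .
  qed
  have sum_c: "(\<Sum>a\<in>F. \<Sum>b\<in>F. c a b) = p * n\<^sup>2"
  proof -
    have "(\<Sum>b\<in>F. c a b) = n\<^sup>2" if a: "a \<in> F" for a
    proof -
      have "(\<Sum>b\<in>F. c a b) = (\<Sum>x\<in>Y. \<Sum>b\<in>F. \<Sum>y\<in>Y. of_bool (on a b x y))"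
        unfolding c_eq by (rule sum.swap)
      also have "\<dots> = (\<Sum>x\<in>Y. \<Sum>y\<in>Y. \<Sum>b\<in>F. of_bool (on a b x y))"
        by (intro sum.cong refl sum.swap)
      also have "\<dots> = (\<Sum>x\<in>Y. \<Sum>y\<in>Y. 1)" using one_b[OF a] by (intro sum.cong refl)
      finally show ?thesis by (simp add: n_def power2_eq_square)
    qed
    then show ?thesis by (simp add: p_def)
  qed
  \<comment> \<open>A point lies on \<open>p\<close> non-vertical lines, two different points on at
    most one.\<close>
  have pair: "(\<Sum>a\<in>F. \<Sum>b\<in>F. of_bool (on a b x y) * of_bool (on a b x' y'))
      \<le> p * of_bool (x = x' \<and> y = y') + (1 :: real)" if Yxy: "x \<in> Y" "y \<in> Y" "x' \<in> Y" "y' \<in> Y" for x y x' y'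
  proof (cases "x = x' \<and> y = y'")
    case True
    have "(\<Sum>a\<in>F. \<Sum>b\<in>F. of_bool (on a b x y) * of_bool (on a b x' y')) = (\<Sum>a\<in>F. \<Sum>b\<in>F. of_bool (on a b x y) :: real)"
      using True by (intro sum.cong refl) auto
    also have "\<dots> = (\<Sum>a\<in>F. 1)" using one_b[OF _ Yxy(1,2)] by (intro sum.cong refl)
    finally show ?thesis using True by (simp add: p_def)
  next
    case False
    let ?Q = "{q\<in>F \<times> F. on (fst q) (snd q) x y \<and> on (fst q) (snd q) x' y'}"
    have "q = r" if "q \<in> ?Q" "r \<in> ?Q" for q r
    proof -
      have xx: "x \<noteq> x'" using that False by (auto simp: on_def)
      have "fst q = fst r \<and> snd q = snd r"
        using that Yxy Y xx by (intro line_unique[of _ _ _ _ x x']) (auto simp: on_def F_def)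
      then show ?thesis by (simp add: prod_eq_iff)
    qed
    then have "card ?Q \<le> Suc 0"
      using fin by (subst card_le_Suc0_iff_eq) (auto simp: F_def)
    moreover have "(\<Sum>a\<in>F. \<Sum>b\<in>F. of_bool (on a b x y) * of_bool (on a b x' y')) = real (card ?Q)"
      using fin by (simp add: real_card_filter F_def sum.cartesian_product' of_bool_conj del: sum_of_bool_eq)
    ultimately show ?thesis using False by (simp only: of_bool_eq)
  qed
  have sum_c2: "(\<Sum>a\<in>F. \<Sum>b\<in>F. (c a b)\<^sup>2) \<le> p * n\<^sup>2 + n ^ 4"
  proof -
    define J where "J = (\<lambda>a b q q'. of_bool (on a b (fst q) (snd q)) * of_bool (on a b (fst q') (snd q')) :: real)"
    have "(c a b)\<^sup>2 = (\<Sum>q\<in>Y \<times> Y. \<Sum>q'\<in>Y \<times> Y. J a b q q')" for a b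
    proof -
      have "c a b = (\<Sum>q\<in>Y \<times> Y. of_bool (on a b (fst q) (snd q)))"
        by (simp add: c_eq sum.cartesian_product' del: sum_of_bool_eq)
      then show ?thesis by (simp add: power2_eq_square sum_product J_def del: sum_of_bool_eq)
    qed
    then have "(\<Sum>a\<in>F. \<Sum>b\<in>F. (c a b)\<^sup>2) = (\<Sum>a\<in>F. \<Sum>b\<in>F. \<Sum>q\<in>Y \<times> Y. \<Sum>q'\<in>Y \<times> Y. J a b q q')"
      by simp
    also have "\<dots> = (\<Sum>a\<in>F. \<Sum>q\<in>Y \<times> Y. \<Sum>q'\<in>Y \<times> Y. \<Sum>b\<in>F. J a b q q')"
      by (intro sum.cong refl, subst sum.swap, intro sum.cong refl sum.swap)
    also have "\<dots> = (\<Sum>q\<in>Y \<times> Y. \<Sum>q'\<in>Y \<times> Y. \<Sum>a\<in>F. \<Sum>b\<in>F. J a b q q')"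
      by (subst sum.swap, intro sum.cong refl sum.swap)
    also have "\<dots> \<le> (\<Sum>q\<in>Y \<times> Y. \<Sum>q'\<in>Y \<times> Y. p * of_bool (q = q') + 1)"
    proof (intro sum_mono)
      fix q q' assume "q \<in> Y \<times> Y" "q' \<in> Y \<times> Y"
      then show "(\<Sum>a\<in>F. \<Sum>b\<in>F. J a b q q') \<le> p * of_bool (q = q') + 1"
        using pair[of "fst q" "snd q" "fst q'" "snd q'"]
        unfolding J_def prod_eq_iff mem_Times_iff by blast
    qed
    also have "\<dots> = p * n\<^sup>2 + n ^ 4"
      using Y(2) by (simp add: sum.distrib card_cartesian_product n_def power2_eq_square eval_nat_numeral
          distrib_left mult_ac flip: sum_distrib_left)
    finally show ?thesis .
  qed
  \<comment> \<open>The average of \<open>c\<close> over all \<open>p\<^sup>2\<close> pairs of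
    coefficients, as the total is \<open>p * n\<^sup>2\<close>.\<close>
  define e where "e = n\<^sup>2 / p"
  have "(\<Sum>a\<in>F. \<Sum>b\<in>F. (c a b - e)\<^sup>2)
      = (\<Sum>a\<in>F. \<Sum>b\<in>F. (c a b)\<^sup>2 - (2 * e) * c a b + e\<^sup>2)"
    by (intro sum.cong refl) (simp add: power2_diff)
  also have "\<dots> = (\<Sum>a\<in>F. \<Sum>b\<in>F. (c a b)\<^sup>2) - (2 * e) * (\<Sum>a\<in>F. \<Sum>b\<in>F. c a b) + p * (p * e\<^sup>2)"
    by (simp only: sum.distrib sum_subtractf flip: sum_distrib_left) (simp add: p_def)
  also have "\<dots> \<le> (p * n\<^sup>2 + n ^ 4) - (2 * e) * (p * n\<^sup>2) + p * (p * e\<^sup>2)"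
    unfolding sum_c using sum_c2 by simp
  also have "\<dots> = p * n\<^sup>2" using p by (simp add: e_def power_divide eval_nat_numeral)
  finally have var: "(\<Sum>a\<in>F. \<Sum>b\<in>F. (c a b - e)\<^sup>2) \<le> p * n\<^sup>2" .
  have "real (card M) * (k / 2)\<^sup>2 = (\<Sum>g\<in>M. (k / 2)\<^sup>2)" by simp
  also have "\<dots> \<le> (\<Sum>g\<in>M. (c (slope g) (app g \<zero>) - e)\<^sup>2)"
  proof (intro sum_mono power_mono)
    fix g assume g: "g \<in> M"
    then obtain a b where ab: "a \<in> carrier R" "a \<noteq> \<zero>" "b \<in> carrier R" "g = aff a b"
      using M AffE by blast
    have "{y\<in>Y. app g y \<in> Y} = {y\<in>Y. a \<otimes> y \<oplus> b \<in> Y}" using ab Y by (auto simp: app_aff)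
    then have "k \<le> c (slope g) (app g \<zero>)" using rich[OF g] ab by (simp add: hits_def c_def)
    \<comment> \<open>Richness is at least twice the average, so every map in \<open>M\<close>
      contributes at least \<open>(k / 2)\<^sup>2\<close> to the variance.\<close>
    moreover have "e \<le> k / 2" using k p by (simp add: e_def p_def n_def F_def field_simps)
    ultimately show "k / 2 \<le> c (slope g) (app g \<zero>) - e" by simp
  qed (use k in simp)
  also have "\<dots> = (\<Sum>q\<in>(\<lambda>g. (slope g, app g \<zero>)) ` M. (c (fst q) (snd q) - e)\<^sup>2)"
  proof (subst sum.reindex)
    show "inj_on (\<lambda>g. (slope g, app g \<zero>)) M"
      using M(1) by (intro inj_on_inverseI[of _ "\<lambda>q. aff (fst q) (snd q)"]) (auto simp: Aff_eq_aff[symmetric])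
  qed simp
  also have "\<dots> \<le> (\<Sum>q\<in>F \<times> F. (c (fst q) (snd q) - e)\<^sup>2)"
    using fin M(1) by (intro sum_mono2) (auto simp: F_def intro: slope_in_carrier Aff_app_in_carrier)
  also have "\<dots> \<le> p * n\<^sup>2" using var by (simp add: sum.cartesian_product')
  finally show ?thesis by (simp add: p_def n_def F_def power_divide)
qed

end

section \<open>Rich lines\<close>

lemma finite_card_le_2:
  assumes "\<And>x y z. \<lbrakk>x \<in> S; y \<in> S; z \<in> S; x \<noteq> y; y \<noteq> z; x \<noteq> z\<rbrakk> \<Longrightarrow> False"
  shows "finite S \<and> card S \<le> 2"
proof (rule ccontr)
  assume "\<not> ?thesis"
  then have "\<exists>T\<subseteq>S. card T = 3"
    using infinite_arbitrarily_large[of S 3] obtain_subset_with_card_n[of 3 S]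
    by (cases "finite S") auto
  then show False using assms by (auto simp: card_3_iff)
qed

text \<open>Cauchy-Schwarz on \<open>T\<close>. With \<open>T\<close> a set of rich maps, for which
  there are upper bounds on the cardinality, it bounds the norm from below.\<close>

lemma square_mean_le_card:
  assumes "prob \<nu>" "finite T"
  shows "(\<Sum>g\<in>T. \<nu> g)\<^sup>2 \<le> real (card T) * mean \<nu> \<nu>"
proof -
  have "(\<Sum>g\<in>T. (\<nu> g)\<^sup>2) \<le> (\<Sum>g\<in>T \<union> {g. \<nu> g \<noteq> 0}. (\<nu> g)\<^sup>2)"
    using assms by (intro sum_mono2) auto
  also have "\<dots> = mean \<nu> \<nu>"
    using assms by (subst mean_eq_sum[of "T \<union> {g. \<nu> g \<noteq> 0}"]) (auto simp: power2_eq_square)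
  finally have "(\<Sum>g\<in>T. (\<nu> g)\<^sup>2) * real (card T) \<le> mean \<nu> \<nu> * real (card T)"
    by (intro mult_right_mono) auto
  then show ?thesis
    using sum_squared_le_sum_of_squares[of \<nu> T] by (simp add: mult.commute)
qed

lemma mean_le_const:
  assumes "prob \<nu>" "\<And>g. \<nu> g \<noteq> 0 \<Longrightarrow> \<phi> g \<le> c"
  shows "mean \<nu> \<phi> \<le> c"
  using mean_mono[of \<nu> \<phi> "\<lambda>_. c"] assms by simp

lemma mean_multc: "mean \<nu> (\<lambda>g. \<phi> g * c) = mean \<nu> \<phi> * c"
  by (simp add: mean_def sum_distrib_right mult.assoc)

lemma mean_autocorr_self_le:
  assumes "prob \<nu>"
  shows "mean (autocorr \<nu>) (autocorr \<nu>) \<le> mean \<nu> \<nu>"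
  using assms by (intro mean_le_const) (auto intro: autocorr_le_mean)

section \<open>Measures on the affine group that reflect general position\<close>

context affine_plane
begin

definition spread :: "('a bijection \<Rightarrow> real) \<Rightarrow> real \<Rightarrow> bool" where
  "spread \<nu> \<delta> \<longleftrightarrow> (\<forall>g. \<nu> g \<noteq> 0 \<longrightarrow> g \<in> Aff) \<and>
    (\<forall>a\<in>carrier R. mean \<nu> (\<lambda>g. of_bool (slope g = a)) \<le> \<delta>) \<and>
    (\<forall>x\<in>carrier R. \<forall>y\<in>carrier R. mean \<nu> (\<lambda>g. of_bool (app g x = y)) \<le> \<delta>)"

lemma app_minus_plus_eq_iff: "app (- g + h) x = y \<longleftrightarrow> app h x = app g y"
proof -
  have "app h x = app g (app (- g + h) x)" by (simp flip: app_plus_apply add.assoc)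
  moreover have "inj (app g)" by (simp add: bij_is_inj bij_app)
  ultimately show ?thesis by (metis inj_eq)
qed

text \<open>Fix the first factor \<open>g\<close> of \<open>- g + h\<close>. A prescribed slope of
  the product prescribes the slope of \<open>h\<close>, and mapping \<open>x\<close> to
  \<open>y\<close> means that \<open>h\<close> maps \<open>x\<close> to \<open>app g y\<close>; the
  bounds for \<open>\<nu>\<close> apply to \<open>h\<close>.\<close>

lemma spread_autocorr:
  assumes \<nu>: "prob \<nu>" and "spread \<nu> \<delta>"
  shows "spread (autocorr \<nu>) \<delta>"
  unfolding spread_def
proof (intro conjI allI impI ballI)
  have Aff: "g \<in> Aff" if "\<nu> g \<noteq> 0" for g using assms that by (simp add: spread_def)
  show "x \<in> Aff" if "autocorr \<nu> x \<noteq> 0" for x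
  proof -
    have "(\<Sum>g | \<nu> g \<noteq> 0. \<nu> g * \<nu> (g + x)) \<noteq> 0"
      using that by (simp add: autocorr_def mean_def)
    then obtain g where "\<nu> g * \<nu> (g + x) \<noteq> 0"
      by (rule sum.not_neutral_contains_not_neutral)
    then have "- g + (g + x) \<in> Aff" by (intro Aff_plus Aff_uminus Aff) auto
    then show ?thesis by simp
  qed
  show "mean (autocorr \<nu>) (\<lambda>g. of_bool (slope g = a)) \<le> \<delta>" if a: "a \<in> carrier R" for a
    unfolding mean_autocorr[OF \<nu>]
  proof (rule mean_le_const[OF \<nu>])
    fix g assume g: "\<nu> g \<noteq> 0"
    have "mean \<nu> (\<lambda>h. of_bool (slope (- g + h) = a)) \<le> mean \<nu> (\<lambda>h. of_bool (slope h = slope g \<otimes> a))"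
    proof (rule mean_mono[OF \<nu>])
      fix h assume h: "\<nu> h \<noteq> 0"
      have "slope g \<otimes> slope (- g + h) = slope h"
        using Aff[OF g] Aff[OF h] by (simp add: Aff_plus Aff_uminus flip: slope_plus)
      then show "of_bool (slope (- g + h) = a) \<le> (of_bool (slope h = slope g \<otimes> a) :: real)" by auto
    qed
    also have "\<dots> \<le> \<delta>" using assms a Aff[OF g] slope_in_carrier by (simp add: spread_def)
    finally show "mean \<nu> (\<lambda>h. of_bool (slope (- g + h) = a)) \<le> \<delta>" .
  qed
  show "mean (autocorr \<nu>) (\<lambda>g. of_bool (app g x = y)) \<le> \<delta>" if "x \<in> carrier R" "y \<in> carrier R" for x y
    unfolding mean_autocorr[OF \<nu>] app_minus_plus_eq_iff
  proof (rule mean_le_const[OF \<nu>])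
    fix g assume g: "\<nu> g \<noteq> 0"
    show "mean \<nu> (\<lambda>h. of_bool (app h x = app g y)) \<le> \<delta>"
      using assms that Aff[OF g] Aff_app_in_carrier by (simp add: spread_def)
  qed
qed

text \<open>The mean of \<open>hits Y\<close> is the sum over \<open>w \<in> Y\<close> of the
  probability that \<open>w\<close> lies in the image of \<open>Y\<close> under \<open>g\<close>.
  After Cauchy-Schwarz, a point \<open>w\<close> in the images under both \<open>g\<close> and
  \<open>h\<close> yields a point of \<open>Y\<close> that \<open>- g + h\<close> maps back into
  \<open>Y\<close>.\<close>

lemma mean_hits_autocorr:
  assumes \<nu>: "prob \<nu>" and Y: "finite Y" "Y \<noteq> {}"
  shows "(mean \<nu> (hits Y))\<^sup>2 / real (card Y) \<le> mean (autocorr \<nu>) (hits Y)"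
proof -
  define i :: "'a bijection \<Rightarrow> 'a \<Rightarrow> real" where "i g w = of_bool (w \<in> app g ` Y)" for g w
  have inj: "inj (app g)" for g :: "'a bijection" by (simp add: bij_is_inj bij_app)
  have hits: "real (hits Y g) = (\<Sum>w\<in>Y. i g w)" for g
  proof -
    have "hits Y g = card (app g ` {y\<in>Y. app g y \<in> Y})"
      unfolding hits_def by (rule card_image[symmetric]) (use inj inj_on_subset in blast)
    also have "app g ` {y\<in>Y. app g y \<in> Y} = {w\<in>Y. w \<in> app g ` Y}" by auto
    finally show ?thesis using Y by (simp add: i_def real_card_filter del: sum_of_bool_eq)
  qed
  have le: "(\<Sum>w\<in>Y. i g w * i h w) \<le> real (hits Y (- g + h))" for g h
  proof -
    have "(\<Sum>w\<in>Y. i g w * i h w) = real (card {w\<in>Y. w \<in> app g ` Y \<and> w \<in> app h ` Y})"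
      using Y by (simp add: i_def real_card_filter of_bool_conj del: sum_of_bool_eq)
    also have "\<dots> \<le> real (card (app h ` {y\<in>Y. app (- g + h) y \<in> Y}))"
    proof (intro of_nat_mono card_mono)
      show "{w\<in>Y. w \<in> app g ` Y \<and> w \<in> app h ` Y} \<subseteq> app h ` {y\<in>Y. app (- g + h) y \<in> Y}"
      proof
        fix w assume "w \<in> {w\<in>Y. w \<in> app g ` Y \<and> w \<in> app h ` Y}"
        then obtain y z where *: "y \<in> Y" "z \<in> Y" "w = app g y" "w = app h z" by auto
        then have "app (- g + h) z = y" by (simp add: app_minus_plus_eq_iff del: app_plus_apply)
        then show "w \<in> app h ` {y\<in>Y. app (- g + h) y \<in> Y}" using * by blast
      qed
    qed (use Y in simp)
    also have "\<dots> \<le> real (hits Y (- g + h))"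
      unfolding hits_def using Y by (intro of_nat_mono card_image_le) auto
    finally show ?thesis .
  qed
  have "(mean \<nu> (hits Y))\<^sup>2 = (\<Sum>w\<in>Y. mean \<nu> (\<lambda>g. i g w))\<^sup>2"
    by (simp add: hits mean_sum)
  also have "\<dots> \<le> (\<Sum>w\<in>Y. (mean \<nu> (\<lambda>g. i g w))\<^sup>2) * real (card Y)"
    by (rule sum_squared_le_sum_of_squares)
  finally have "(mean \<nu> (hits Y))\<^sup>2 / real (card Y) \<le> (\<Sum>w\<in>Y. (mean \<nu> (\<lambda>g. i g w))\<^sup>2)"
    using Y by (simp add: divide_le_eq card_gt_0_iff)
  also have "\<dots> = mean \<nu> (\<lambda>g. mean \<nu> (\<lambda>h. \<Sum>w\<in>Y. i g w * i h w))"
    by (simp add: mean_sum mean_cmult mean_multc power2_eq_square)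
  also have "\<dots> \<le> mean \<nu> (\<lambda>g. mean \<nu> (\<lambda>h. hits Y (- g + h)))"
    using le by (intro mean_mono \<nu>) auto
  also have "\<dots> = mean (autocorr \<nu>) (hits Y)" by (simp add: mean_autocorr[OF \<nu>])
  finally show ?thesis .
qed

text \<open>If \<open>g - b \<in> H\<close>, the slope of \<open>g\<close> is that of
  \<open>b\<close> times a slope of \<open>H\<close>; a union bound over these slopes finishes. Read
  backwards, a heavy translate needs many slopes.\<close>

lemma slopes_of_heavy_translate:
  assumes \<nu>: "prob \<nu>" and spread: "spread \<nu> \<delta>" and H: "finite H" "H \<subseteq> Aff" and b: "\<nu> b \<noteq> 0"
  shows "mean \<nu> (\<lambda>g. of_bool (g - b \<in> H)) \<le> real (card (slope ` H)) * \<delta>"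
proof -
  have Aff: "g \<in> Aff" if "\<nu> g \<noteq> 0" for g using spread that by (simp add: spread_def)
  have "mean \<nu> (\<lambda>g. of_bool (g - b \<in> H)) \<le> mean \<nu> (\<lambda>g. \<Sum>a\<in>slope ` H. of_bool (slope g = a \<otimes> slope b))"
  proof (rule mean_mono[OF \<nu>])
    fix g assume g: "\<nu> g \<noteq> 0"
    show "of_bool (g - b \<in> H) \<le> (\<Sum>a\<in>slope ` H. of_bool (slope g = a \<otimes> slope b) :: real)"
    proof (cases "g - b \<in> H")
      case True
      have "slope g = slope (g - b) \<otimes> slope b"
        using True H Aff[OF b] by (subst slope_plus[symmetric]) auto
      then have "1 = (of_bool (slope g = slope (g - b) \<otimes> slope b) :: real)" by simp
      also have "\<dots> \<le> (\<Sum>a\<in>slope ` H. of_bool (slope g = a \<otimes> slope b))"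
        by (rule member_le_sum) (use True H in auto)
      finally show ?thesis using True by simp
    qed (simp add: sum_nonneg)
  qed
  also have "\<dots> = (\<Sum>a\<in>slope ` H. mean \<nu> (\<lambda>g. of_bool (slope g = a \<otimes> slope b)))"
    by (rule mean_sum)
  also have "\<dots> \<le> (\<Sum>a\<in>slope ` H. \<delta>)"
    using spread H Aff[OF b] by (intro sum_mono) (auto simp: spread_def slope_in_carrier)
  finally show ?thesis by simp
qed

text \<open>A commuting set of affine maps consists of translations, so that the translate by
  \<open>b\<close> has a single slope, or contains a map with exactly one fixed point
  \<open>x0\<close>. In the latter case everything commuting with that map fixes \<open>x0\<close>,
  and all \<open>g\<close> with \<open>g - b \<in> H\<close> send the preimage of \<open>x0\<close>
  under \<open>b\<close> to \<open>x0\<close>.\<close>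

lemma commuting_heavy_translate:
  assumes \<nu>: "prob \<nu>" and spread: "spread \<nu> \<delta>" and H: "H \<subseteq> Aff" and b: "\<nu> b \<noteq> 0"
    and comm: "\<And>g h. g \<in> H \<Longrightarrow> h \<in> H \<Longrightarrow> g + h = h + g"
  shows "mean \<nu> (\<lambda>g. of_bool (g - b \<in> H)) \<le> \<delta>"
proof (cases "H \<subseteq> shifts")
  case True
  have Aff: "g \<in> Aff" if "\<nu> g \<noteq> 0" for g using spread that by (simp add: spread_def)
  have "mean \<nu> (\<lambda>g. of_bool (g - b \<in> H)) \<le> mean \<nu> (\<lambda>g. of_bool (slope g = slope b))"
  proof (rule mean_mono[OF \<nu>])
    fix g assume g: "\<nu> g \<noteq> 0"
    have "slope g = slope b" if "g - b \<in> H"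
    proof -
      have gb: "g - b \<in> Aff" "slope (g - b) = \<one>" using that True by (auto simp: shifts_iff)
      have "slope g = slope (g - b) \<otimes> slope b"
        using gb Aff[OF b] by (subst slope_plus[symmetric]) auto
      then show ?thesis using gb Aff[OF b] slope_in_carrier by simp
    qed
    then show "of_bool (g - b \<in> H) \<le> (of_bool (slope g = slope b) :: real)" by auto
  qed
  also have "\<dots> \<le> \<delta>" using spread Aff[OF b] slope_in_carrier by (simp add: spread_def)
  finally show ?thesis .
next
  case False
  have Aff: "g \<in> Aff" if "\<nu> g \<noteq> 0" for g using spread that by (simp add: spread_def)
  from False obtain h where h: "h \<in> H" "h \<notin> shifts" by auto
  then obtain a c where ac: "a \<in> carrier R" "a \<noteq> \<zero>" "c \<in> carrier R" "h = aff a c"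
    using H AffE by blast
  have a1: "\<one> \<ominus> a \<in> carrier R" "\<one> \<ominus> a \<noteq> \<zero>" using h(2) ac by (auto simp: shifts_def)
  define x0 where "x0 = inv (\<one> \<ominus> a) \<otimes> c"
  have x0: "x0 \<in> carrier R" using a1 ac by (simp add: x0_def)
  have fixed: "app h x = x \<longleftrightarrow> x = x0" if x: "x \<in> carrier R" for x
  proof -
    have "app h x = x \<longleftrightarrow> (\<one> \<ominus> a) \<otimes> x = c"
    proof -
      have "(\<one> \<ominus> a) \<otimes> x \<ominus> c = x \<ominus> (a \<otimes> x \<oplus> c)" using x ac by algebra
      then have "(\<one> \<ominus> a) \<otimes> x = c \<longleftrightarrow> x = a \<otimes> x \<oplus> c"
        using x ac a1 by (metis a_closed m_closed r_right_minus_eq)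
      then show ?thesis using x ac by (auto simp: app_aff)
    qed
    also have "\<dots> \<longleftrightarrow> x = x0"
    proof
      assume "(\<one> \<ominus> a) \<otimes> x = c"
      then have "x0 = (inv (\<one> \<ominus> a) \<otimes> (\<one> \<ominus> a)) \<otimes> x"
        using m_assoc[OF inv_nonzero(1)[OF a1] a1(1) x] by (simp only: x0_def)
      then show "x = x0" using a1 x by simp
    next
      assume "x = x0"
      then have "(\<one> \<ominus> a) \<otimes> x = ((\<one> \<ominus> a) \<otimes> inv (\<one> \<ominus> a)) \<otimes> c"
        using m_assoc[OF a1(1) inv_nonzero(1)[OF a1] ac(3)] by (simp only: x0_def)
      then show "(\<one> \<ominus> a) \<otimes> x = c" using a1 ac by simp
    qed
    finally show ?thesis .
  qed
  have stab: "app k x0 = x0" if k: "k \<in> H" for k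
  proof -
    have "app h (app k x0) = app (h + k) x0" by simp
    also have "\<dots> = app (k + h) x0" using comm[OF h(1) k] by simp
    also have "\<dots> = app k x0" using fixed[OF x0] by simp
    finally show ?thesis using fixed[of "app k x0"] Aff_app_in_carrier k H x0 by auto
  qed
  define y0 where "y0 = app (- b) x0"
  have "- b \<in> Aff" using Aff[OF b] by (rule Aff_uminus)
  then have y0: "y0 \<in> carrier R" using x0 by (simp add: y0_def Aff_app_in_carrier)
  have "mean \<nu> (\<lambda>g. of_bool (g - b \<in> H)) \<le> mean \<nu> (\<lambda>g. of_bool (app g y0 = x0))"
  proof (rule mean_mono[OF \<nu>])
    fix g
    have "app g y0 = app (g - b) x0"
      by (simp add: y0_def flip: app_plus_apply)
    then show "of_bool (g - b \<in> H) \<le> (of_bool (app g y0 = x0) :: real)" using stab by auto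
  qed
  also have "\<dots> \<le> \<delta>" using spread x0 y0 by (simp add: spread_def)
  finally show ?thesis .
qed

end

text \<open>Pigeonhole: a drop by more than \<open>K\<close> at each of the \<open>I\<close> steps
  would force \<open>K ^ I * e I < 1\<close>.\<close>

lemma exists_slow_step:
  fixes e :: "nat \<Rightarrow> real"
  assumes "e 0 \<le> 1" "K > 0" "I > 0" "1 \<le> K ^ I * e I"
  shows "\<exists>i<I. e i \<le> K * e (Suc i)"
proof (rule ccontr)
  assume "\<not> ?thesis"
  then have step: "K * e (Suc i) < e i" if "i < I" for i using that by (meson not_le)
  have "K ^ Suc i * e (Suc i) < 1" if "i < I" for i
    using that
  proof (induction i)
    case 0
    then show ?case using step[of 0] assms(1) by simp
  next
    case (Suc i)
    have "K ^ Suc (Suc i) * e (Suc (Suc i)) = K ^ Suc i * (K * e (Suc (Suc i)))" by simp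
    also have "\<dots> < K ^ Suc i * e (Suc i)"
      using step[of "Suc i"] Suc.prems assms(2) by (intro mult_strict_left_mono) auto
    also have "\<dots> < 1" using Suc by simp
    finally show ?case .
  qed
  from this[of "I - 1"] assms show False by simp
qed

section \<open>The bound for families of rich affine maps\<close>

context affine_plane
begin

text \<open>Markov's inequality: maps below the threshold contribute at most \<open>k\<close> to the
  mean, the others at most \<open>card Y\<close> each.\<close>

lemma rich_mass:
  assumes \<nu>: "prob \<nu>" and Y: "finite Y" and c: "2 * k \<le> mean \<nu> (hits Y)"
  shows "k \<le> real (card Y) * (\<Sum>g | \<nu> g \<noteq> 0 \<and> k \<le> real (hits Y g). \<nu> g)"
proof -
  have "2 * k \<le> mean \<nu> (hits Y)" by (rule c)
  also have "\<dots> \<le> mean \<nu> (\<lambda>g. real (card Y) * of_bool (k \<le> real (hits Y g)) + max k 0)"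
  proof (rule mean_mono[OF \<nu>])
    fix g
    have "hits Y g \<le> card Y" unfolding hits_def using Y by (intro card_mono) auto
    then show "real (hits Y g) \<le> real (card Y) * of_bool (k \<le> real (hits Y g)) + max k 0" by auto
  qed
  also have "\<dots> = real (card Y) * (\<Sum>g | \<nu> g \<noteq> 0 \<and> k \<le> real (hits Y g). \<nu> g) + max k 0"
  proof -
    have "mean \<nu> (\<lambda>g. of_bool (k \<le> real (hits Y g))) = (\<Sum>g | \<nu> g \<noteq> 0 \<and> k \<le> real (hits Y g). \<nu> g)"
      unfolding mean_def using \<nu> by (intro sum.mono_neutral_cong_right) auto
    then show ?thesis using \<nu> by (simp add: mean_add mean_cmult)
  qed
  finally have le: "2 * k \<le> real (card Y) * (\<Sum>g | \<nu> g \<noteq> 0 \<and> k \<le> real (hits Y g). \<nu> g) + max k 0" .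
  moreover have "0 \<le> real (card Y) * (\<Sum>g | \<nu> g \<noteq> 0 \<and> k \<le> real (hits Y g). \<nu> g)"
    using \<nu> by (intro mult_nonneg_nonneg sum_nonneg) auto
  ultimately show ?thesis by (auto simp: max_def split: if_splits)
qed

text \<open>The parameters play separate roles: \<open>2 * \<tau>\<close> is the average richness
  left after \<open>2 * I\<close> steps, the bound on \<open>K ^ I * \<tau> ^ 4\<close> forces a
  slow pair of steps, \<open>1 \<le> K * \<tau>\<close> lets powers of \<open>\<tau>\<close> be
  absorbed by powers of \<open>K\<close>, and \<open>fin\<close> makes the second-moment count of
  rich maps applicable.\<close>

theorem rich_lines_le:
  assumes L: "finite L" "L \<subseteq> Aff" "L \<noteq> {}"
    and slopes: "inj_on slope L"
    and points: "\<And>x y. x \<in> carrier R \<Longrightarrow> y \<in> carrier R \<Longrightarrow> card {g\<in>L. app g x = y} \<le> 2"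
    and Y: "Y \<subseteq> carrier R" "finite Y" "Y \<noteq> {}"
    and rich: "\<And>g. g \<in> L \<Longrightarrow> \<alpha> * real (card Y) \<le> real (hits Y g)"
    and \<alpha>: "0 < \<alpha>" and I: "I > 0" and \<tau>: "2 * \<tau> \<le> \<alpha> ^ (2 ^ (2 * I))" "\<tau> > 0"
    and \<tau>Y: "2 \<le> \<tau> * real (card Y)"
    and K: "K \<ge> 2" "1 \<le> K * \<tau>" "2 * (real (card Y))\<^sup>2 \<le> K ^ I * \<tau> ^ 4"
    and fin: "finite (carrier R) \<Longrightarrow> 2 * real (card Y) \<le> \<tau> * real (card (carrier R))"
  shows "real (card L) \<le> K ^ 13500"
proof -
  define N where "N = real (card Y)"
  have N: "N > 0" using Y by (simp add: N_def card_gt_0_iff)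
  define M where "M = real (card L)"
  have M: "M > 0" using L by (simp add: M_def card_gt_0_iff)
  define \<nu>0 where "\<nu>0 g = of_bool (g \<in> L) / M" for g
  have mean0: "mean \<nu>0 \<phi> = (\<Sum>g\<in>L. \<phi> g) / M" for \<phi>
    using L by (subst mean_eq_sum[of L]) (auto simp: \<nu>0_def sum_divide_distrib)
  have \<nu>0_nz: "\<nu>0 g \<noteq> 0 \<longleftrightarrow> g \<in> L" for g using M by (simp add: \<nu>0_def)
  have prob0: "prob \<nu>0"
    unfolding prob_def mean0 \<nu>0_nz using L M by (auto simp: \<nu>0_def M_def)
  have spread0: "spread \<nu>0 (2 / M)"
    unfolding spread_def mean0 \<nu>0_nz
  proof (intro conjI ballI allI impI)
    fix a assume "a \<in> carrier R"
    have "card {g\<in>L. slope g = a} \<le> Suc 0"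
      using L slopes by (subst card_le_Suc0_iff_eq) (auto simp: inj_on_def)
    then show "(\<Sum>g\<in>L. of_bool (slope g = a)) / M \<le> 2 / M"
      unfolding real_card_filter[OF L(1), symmetric] using M by (intro divide_right_mono) auto
  next
    fix x y assume "x \<in> carrier R" "y \<in> carrier R"
    then show "(\<Sum>g\<in>L. of_bool (app g x = y)) / M \<le> 2 / M"
      unfolding real_card_filter[OF L(1), symmetric]
      using M points[of x y] by (intro divide_right_mono) auto
  qed (use L in auto)
  define \<nu> where "\<nu> j = (autocorr ^^ j) \<nu>0" for j
  have \<nu>_0: "\<nu> 0 = \<nu>0" and \<nu>_Suc: "\<nu> (Suc j) = autocorr (\<nu> j)" for j by (simp_all add: \<nu>_def)
  have prob: "prob (\<nu> j)" and spread: "spread (\<nu> j) (2 / M)" for j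
    by (induction j) (simp_all add: \<nu>_0 \<nu>_Suc prob0 spread0 spread_autocorr)
  have hits: "\<alpha> ^ (2 ^ j) * N \<le> mean (\<nu> j) (hits Y)" for j
  proof (induction j)
    case 0
    have "M * (\<alpha> * N) = (\<Sum>g\<in>L. \<alpha> * N)" by (simp add: M_def)
    also have "\<dots> \<le> (\<Sum>g\<in>L. real (hits Y g))" using rich by (intro sum_mono) (simp add: N_def)
    finally show ?case using M by (simp add: \<nu>_0 mean0 field_simps)
  next
    case (Suc j)
    have "\<alpha> ^ (2 ^ Suc j) * N = (\<alpha> ^ (2 ^ j) * N)\<^sup>2 / N"
      using N by (simp add: power2_eq_square power_add mult_2)
    also have "\<dots> \<le> (mean (\<nu> j) (hits Y))\<^sup>2 / N"
      using Suc \<alpha> N by (intro divide_right_mono power_mono) auto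
    also have "\<dots> \<le> mean (\<nu> (Suc j)) (hits Y)"
      unfolding \<nu>_Suc N_def using prob Y by (intro mean_hits_autocorr)
    finally show ?case .
  qed
  define e where "e j = mean (\<nu> j) (\<nu> j)" for j
  have e_Suc: "e (Suc j) \<le> e j" for j
    unfolding e_def \<nu>_Suc by (rule mean_autocorr_self_le[OF prob])
  have e_mono: "e k \<le> e j" if "j \<le> k" for j k
    using e_Suc that by (rule lift_Suc_antimono_le)
  define T where "T = {g. \<nu> (2 * I) g \<noteq> 0 \<and> \<tau> * N \<le> real (hits Y g)}"
  have T: "finite T" "T \<subseteq> Aff"
    using prob[of "2 * I"] spread[of "2 * I"] by (auto simp: T_def spread_def intro: finite_subset[OF _ prob_finite])
  have "2 * (\<tau> * N) \<le> mean (\<nu> (2 * I)) (hits Y)"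
    by (rule order_trans[OF _ hits]) (use mult_right_mono[OF \<tau>(1), of N] N in simp)
  then have "\<tau> * N \<le> N * (\<Sum>g\<in>T. \<nu> (2 * I) g)"
    using rich_mass[OF prob Y(2)] unfolding T_def N_def by blast
  then have "\<tau> \<le> (\<Sum>g\<in>T. \<nu> (2 * I) g)" using N by (simp add: mult.commute)
  then have "\<tau>\<^sup>2 \<le> (\<Sum>g\<in>T. \<nu> (2 * I) g)\<^sup>2" using \<tau> by (intro power_mono) auto
  also have "\<dots> \<le> real (card T) * e (2 * I)"
    unfolding e_def by (rule square_mean_le_card[OF prob T(1)])
  finally have T_e: "\<tau>\<^sup>2 \<le> real (card T) * e (2 * I)" .
  have e_nonneg: "0 \<le> e j" for j
    unfolding e_def using prob[of j] by (intro mean_nonneg) auto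
  have e_lower: "\<tau> ^ 4 \<le> 2 * N\<^sup>2 * e (2 * I)"
  proof -
    have "real (card T) * (\<tau> * N)\<^sup>2 \<le> 2 * N ^ 4"
      unfolding N_def using T Y \<tau>Y by (intro card_rich_le) (auto simp: T_def N_def)
    then have "real (card T) * \<tau>\<^sup>2 \<le> 2 * N\<^sup>2"
      using N by (simp add: power_mult_distrib power2_eq_square eval_nat_numeral)
    then have "real (card T) * \<tau>\<^sup>2 * e (2 * I) \<le> 2 * N\<^sup>2 * e (2 * I)"
      using e_nonneg by (intro mult_right_mono)
    moreover have "\<tau>\<^sup>2 * \<tau>\<^sup>2 \<le> real (card T) * e (2 * I) * \<tau>\<^sup>2"
      using T_e by (intro mult_right_mono) auto
    ultimately show ?thesis by (simp add: mult_ac flip: power_add)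
  qed
  \<comment> \<open>The bound \<open>e_lower\<close>, of order \<open>1 / N\<^sup>2\<close>,
    suffices to find the slow step, but the case in which pivoting fills half of the translations
    needs one of order \<open>1 / p\<close>.\<close>
  have e_lower_finite: "\<tau> ^ 4 \<le> 4 * real (card (carrier R)) * e (2 * I)" if "finite (carrier R)"
  proof -
    let ?p = "real (card (carrier R))"
    have "2 * N * N \<le> \<tau> * ?p * N"
      using fin[OF that] N by (intro mult_right_mono) (auto simp: N_def)
    then have "real (card T) * (\<tau> * N)\<^sup>2 \<le> 4 * ?p * N\<^sup>2"
      unfolding N_def using T Y that \<tau> N
      by (intro card_rich_le_finite_field) (auto simp: T_def N_def power2_eq_square mult_ac)
    then have "real (card T) * \<tau>\<^sup>2 \<le> 4 * ?p"
      using N by (simp add: power_mult_distrib power2_eq_square)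
    then have "real (card T) * \<tau>\<^sup>2 * e (2 * I) \<le> 4 * ?p * e (2 * I)"
      using e_nonneg by (intro mult_right_mono)
    moreover have "\<tau>\<^sup>2 * \<tau>\<^sup>2 \<le> real (card T) * e (2 * I) * \<tau>\<^sup>2"
      using T_e by (intro mult_right_mono) auto
    ultimately show ?thesis by (simp add: mult_ac flip: power_add)
  qed
  have e_0: "e 0 \<le> 1"
  proof -
    have "M \<ge> 1" using M by (simp add: M_def)
    then show ?thesis
      unfolding e_def using prob[of 0] by (intro mean_le_const) (auto simp: \<nu>_0 \<nu>0_def)
  qed
  have "2 * N\<^sup>2 * 1 \<le> 2 * N\<^sup>2 * (K ^ I * e (2 * I))"
  proof -
    have "2 * N\<^sup>2 \<le> K ^ I * (2 * N\<^sup>2 * e (2 * I))"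
      by (rule order_trans[OF K(3)[folded N_def] mult_left_mono[OF e_lower]]) (use K(1) in simp)
    then show ?thesis by (simp add: mult_ac)
  qed
  then have "1 \<le> K ^ I * e (2 * I)" using N by (simp only: mult_le_cancel_left) auto
  then obtain i where i: "i < I" "e (2 * i) \<le> K * e (2 * Suc i)"
    using exists_slow_step[of "\<lambda>i. e (2 * i)" K I] e_0 K I by auto
  define s where "s = e (2 * i)"
  define \<mu> where "\<mu> = \<nu> (Suc (2 * i))"
  have e_I: "e (2 * I) \<le> s" unfolding s_def using i by (intro e_mono) simp
  have s: "s > 0"
  proof -
    have "0 < \<tau> ^ 4" using \<tau> by simp
    then have "e (2 * I) \<noteq> 0" using e_lower by (metis mult_zero_right not_less)
    then show ?thesis using e_nonneg[of "2 * I"] e_I by linarith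
  qed
  have \<mu>: "prob \<mu>" "spread \<mu> (2 / M)" unfolding \<mu>_def by (rule prob spread)+
  have \<mu>_le: "\<mu> g \<le> s" for g
    unfolding \<mu>_def s_def e_def \<nu>_Suc by (rule autocorr_le_mean[OF prob])
  have "s / K \<le> mean (autocorr \<mu>) (autocorr \<mu>)"
    using i(2) K(1) by (simp add: s_def e_def \<mu>_def \<nu>_Suc[symmetric] divide_le_eq mult.commute)
  then obtain H b where H: "finite H" "0 \<in> H" "\<And>x. x \<in> H \<Longrightarrow> - x \<in> H" "\<mu> b \<noteq> 0"
    "\<And>x. x \<in> H \<Longrightarrow> \<exists>g h. \<mu> g \<noteq> 0 \<and> \<mu> h \<noteq> 0 \<and> x = g - h"
    "1 / K ^ 111 \<le> mean \<mu> (\<lambda>g. of_bool (g - b \<in> H))"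
    "real (card (nfold_sum 35 H)) \<le> K ^ 6568 * real (card H)" "real (card H) \<le> K ^ 189 / s"
    using approximate_subgroup_of_flat_measure[OF \<mu>(1) \<mu>_le s K(1)] by blast
  have HAff: "H \<subseteq> Aff"
  proof
    fix x assume "x \<in> H"
    then obtain g h where "\<mu> g \<noteq> 0" "\<mu> h \<noteq> 0" "x = g - h" using H(5) by blast
    then show "x \<in> Aff"
      using \<mu>(2) Aff_plus[of g "- h"] Aff_uminus[of h] by (simp add: spread_def)
  qed
  have Kpow: "K ^ m \<le> K ^ n" if "m \<le> n" for m n using K that by (intro power_increasing) auto
  have pow2: "2 ^ n \<le> K ^ n" for n using K by (intro power_mono) auto
  have KK: "K ^ i * K ^ j \<le> K ^ k" if "i + j \<le> k" for i j k
    using Kpow[OF that] by (simp only: power_add)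
  have two_K: "2 * K ^ i \<le> K ^ k" if "Suc i \<le> k" for i k
  proof -
    have "2 * K ^ i \<le> K * K ^ i" using K(1) by (intro mult_right_mono) auto
    then show ?thesis using Kpow[OF that] by simp
  qed
  define n where "n = real (card (slope ` H))"
  have n: "n > 0" using H by (auto simp: n_def card_gt_0_iff)
  have "1 / K ^ 111 \<le> n * (2 / M)"
    using slopes_of_heavy_translate[OF \<mu> H(1) HAff H(4)] H(6) unfolding n_def by linarith
  \<comment> \<open>From here on it suffices to bound the number \<open>n\<close> of slopes by a
    power of \<open>K\<close>.\<close>
  then have M_n: "M \<le> 2 * n * K ^ 111" using M K(1) by (simp add: field_simps)
  show ?thesis
  proof (cases "\<forall>g\<in>H. \<forall>h\<in>H. g + h = h + g")
    case True
    then have "1 / K ^ 111 \<le> 2 / M"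
      using commuting_heavy_translate[OF \<mu> HAff H(4)] H(6) by fastforce
    then have "M \<le> 2 * K ^ 111" using M K(1) by (simp add: field_simps)
    also have "\<dots> \<le> K ^ 13500" by (rule two_K) simp
    finally show ?thesis unfolding M_def .
  next
    case False
    then obtain h1 h2 where h: "h1 \<in> H" "h2 \<in> H" "h1 + h2 \<noteq> h2 + h1" by blast
    define u where "u = real (card (nfold_sum 4 H \<inter> shifts))"
    note piv = pivoting[OF H(1) HAff H(2) H(3) h]
    from piv(3) obtain W where W: "W \<subseteq> shifts" "card W * card (slope ` H) \<le> card (nfold_sum 35 H)"
      "card (nfold_sum 4 H \<inter> shifts) * card (slope ` H) \<le> 2 * card W \<or> finite shifts \<and> card shifts \<le> 2 * card W"
      by blast
    have H_un: "real (card H) \<le> u * n"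
      using piv(1) unfolding u_def n_def by (simp flip: of_nat_mult)
    have un: "u * n \<le> real (card (nfold_sum 35 H))"
    proof -
      have "card (nfold_sum 5 H) \<le> card (nfold_sum 35 H)"
        using nfold_sum_mono[OF H(2), of 5 35] H(1) by (intro card_mono finite_nfold_sum) auto
      then show ?thesis using piv(2) unfolding u_def n_def by (simp flip: of_nat_mult)
    qed
    have u: "u > 0"
    proof -
      have "0 < card H" using H by (auto simp: card_gt_0_iff)
      then have "0 < u * n" using H_un by linarith
      then show ?thesis using n by (simp add: zero_less_mult_iff)
    qed
    have "real (card W) * n \<le> K ^ 6568 * (u * n)"
    proof -
      have "real (card W) * n \<le> real (card (nfold_sum 35 H))"
        using W(2) unfolding n_def by (simp flip: of_nat_mult)
      also have "\<dots> \<le> K ^ 6568 * (u * n)"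
        by (rule order_trans[OF H(7) mult_left_mono[OF H_un]]) (use K(1) in simp)
      finally show ?thesis .
    qed
    then have X_u: "real (card W) \<le> K ^ 6568 * u" using n by simp
    have n_le: "n \<le> K ^ 13350"
      using W(3)
    proof
      assume "card (nfold_sum 4 H \<inter> shifts) * card (slope ` H) \<le> 2 * card W"
      then have "real (card (nfold_sum 4 H \<inter> shifts) * card (slope ` H)) \<le> real (2 * card W)"
        by (simp only: of_nat_le_iff)
      then have "u * n \<le> 2 * real (card W)" by (simp add: u_def n_def)
      also have "\<dots> \<le> u * (2 * K ^ 6568)" using X_u by (simp add: mult_ac)
      finally have "n \<le> 2 * K ^ 6568" using u by simp
      also have "\<dots> \<le> K ^ 13350" by (rule two_K) simp
      finally show ?thesis .
    next
      \<comment> \<open>Now \<open>p\<close> is at most \<open>u\<close> times a power of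
        \<open>K\<close>, while \<open>u * n\<close> is at most a power of \<open>K\<close> over
        \<open>s\<close>, hence at most a power of \<open>K\<close> times \<open>p\<close>.
        Cancelling \<open>p\<close> bounds \<open>n\<close>.\<close>
      assume fX: "finite shifts \<and> card shifts \<le> 2 * card W"
      then have finR: "finite (carrier R)" by (simp add: finite_shifts_iff)
      define p where "p = real (card (carrier R))"
      have p: "p > 0" using finR zero_closed unfolding p_def by (metis card_gt_0_iff empty_iff of_nat_0_less_iff)
      have p_u: "p \<le> 2 * K ^ 6568 * u"
      proof -
        have "p \<le> 2 * real (card W)"
          using of_nat_mono[of "card shifts" "2 * card W", where ?'a = real] fX card_shifts[OF finR]
          by (simp add: p_def)
        with X_u show ?thesis by simp
      qed
      have s_lower: "1 \<le> 4 * K ^ 4 * p * s"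
      proof -
        have "1 \<le> (K * \<tau>) ^ 4" using K(2) by (rule one_le_power)
        also have "\<dots> \<le> K ^ 4 * (4 * p * e (2 * I))"
          unfolding power_mult_distrib p_def using e_lower_finite[OF finR] K(1) by (intro mult_left_mono) auto
        also have "\<dots> \<le> K ^ 4 * (4 * p * s)"
          using e_I p K(1) by (intro mult_left_mono) auto
        finally show ?thesis by (simp add: mult_ac)
      qed
      define A where "A = K ^ 6568"
      define B where "B = K ^ 189"
      define D where "D = K ^ 4"
      have ABD: "A > 0" "B > 0" "D > 0" using K(1) by (simp_all add: A_def B_def D_def)
      have "u * n \<le> A * real (card H)" using un H(7) unfolding A_def by (rule order_trans)
      also have "\<dots> \<le> A * (B / s)" using H(8) ABD unfolding B_def by (intro mult_left_mono) auto
      finally have un_le: "u * n \<le> A * (B / s)" .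
      have "p * n \<le> (2 * A * u) * n" using p_u n unfolding A_def by (intro mult_right_mono) auto
      also have "\<dots> = 2 * A * (u * n)" by simp
      also have "\<dots> \<le> 2 * A * (A * (B / s))" using un_le ABD by (intro mult_left_mono) auto
      also have "\<dots> = 2 * A * A * B * (1 / s)" by simp
      also have "\<dots> \<le> 2 * A * A * B * (4 * D * p)"
        using s_lower s ABD unfolding D_def[symmetric] by (intro mult_left_mono) (auto simp: divide_le_eq)
      also have "\<dots> = p * (8 * ((A * A) * (B * D)))" by simp
      finally have "n \<le> 8 * ((A * A) * (B * D))" using p by (simp only: mult_le_cancel_left_pos)
      \<comment> \<open>The exponents add up to 3 + 2 * 6568 + 189 + 4 = 13332; 13350 and the final
        13500 are rounded up.\<close>
      also have "\<dots> \<le> K ^ 3 * (K ^ 13136 * K ^ 193)"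
      proof (intro mult_mono)
        show "8 \<le> K ^ 3" using pow2[of 3] by simp
        show "A * A \<le> K ^ 13136" unfolding A_def by (rule KK) simp
        show "B * D \<le> K ^ 193" unfolding B_def D_def by (rule KK) simp
      qed (use ABD K(1) in auto)
      also have "\<dots> \<le> K ^ 3 * K ^ 13329" using K(1) by (intro mult_left_mono KK) auto
      also have "\<dots> \<le> K ^ 13350" by (rule KK) simp
      finally show ?thesis .
    qed
    have "M \<le> 2 * n * K ^ 111" by (rule M_n)
    also have "\<dots> \<le> 2 * K ^ 13350 * K ^ 111"
      using n_le K(1) by (intro mult_right_mono mult_left_mono) auto
    also have "\<dots> \<le> K ^ 13351 * K ^ 111"
      using K(1) by (intro mult_right_mono two_K) auto
    also have "\<dots> \<le> K ^ 13500" by (rule KK) simp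
    finally show ?thesis unfolding M_def .
  qed
qed

end

text \<open>
  \<open>2 * I\<close> is the number of convolution steps, \<open>\<tau>\<close> the richness that survives them, and \<open>K\<close>
  the allowed loss at one pair of steps.
\<close>
definition good_parameters :: "real \<Rightarrow> nat \<Rightarrow> nat \<Rightarrow> real \<Rightarrow> real \<Rightarrow> bool" where
  "good_parameters \<alpha> N I \<tau> K \<longleftrightarrow> I > 0 \<and> 2 * \<tau> \<le> \<alpha> ^ (2 ^ (2 * I)) \<and> \<tau> > 0 \<and> 2 \<le> \<tau> * real N \<and>
    K \<ge> 2 \<and> 1 \<le> K * \<tau> \<and> 2 * (real N)\<^sup>2 \<le> K ^ I * \<tau> ^ 4 \<and>
    (\<forall>p. real N powr (1 + ln (2 / \<alpha>) / ln (ln (real N))) \<le> p \<longrightarrow> 2 * real N \<le> \<tau> * p)"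

section \<open>From lines to affine maps\<close>

context affine_plane
begin

definition graph :: "'a bijection \<Rightarrow> ('a \<times> 'a) set" where
  "graph g = (\<lambda>x. (x, app g x)) ` carrier R"

lemma graph_aff:
  assumes "a \<in> carrier R" "a \<noteq> \<zero>" "b \<in> carrier R"
  shows "graph (aff a b) = affine_graph R a b"
  using assms by (auto simp: graph_def affine_graph_def app_aff)

lemma mem_graph_iff: "(x, y) \<in> graph g \<longleftrightarrow> x \<in> carrier R \<and> app g x = y"
  by (auto simp: graph_def)

lemma inj_on_graph: "inj_on graph Aff"
proof (rule inj_onI)
  fix g h assume *: "g \<in> Aff" "h \<in> Aff" "graph g = graph h"
  have "app g x = app h x" if "x \<in> carrier R" for x
    using that *(3) mem_graph_iff by blast
  then have "slope g = slope h" "app g \<zero> = app h \<zero>" by (simp_all add: slope_def)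
  then show "g = h" using * Aff_eq_aff by metis
qed

lemma card_graph_Int:
  assumes "Y \<subseteq> carrier R"
  shows "card (graph g \<inter> Y \<times> Y) = hits Y g"
proof -
  have "graph g \<inter> Y \<times> Y = (\<lambda>x. (x, app g x)) ` {y\<in>Y. app g y \<in> Y}"
    using assms by (auto simp: graph_def)
  then show ?thesis by (simp add: hits_def card_image inj_on_def)
qed

text \<open>The quadratic bound holds because every rich line meets \<open>Y \<times> Y\<close>,
  each point of which lies on at most two lines. It gives finiteness of \<open>L\<close>, on which
  the uniform measure depends, and later covers the small \<open>N\<close>.\<close>

theorem card_general_position_le:
  assumes Y: "Y \<subseteq> carrier R" "finite Y" "Y \<noteq> {}" and L: "L \<subseteq> lines R"
    and gp: "general_position R L" and rich: "\<And>l. l \<in> L \<Longrightarrow> rich \<alpha> Y l" and \<alpha>: "0 < \<alpha>"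
  shows "finite L" "card L \<le> 2 * (card Y)\<^sup>2"
    "\<lbrakk>good_parameters \<alpha> (card Y) I \<tau> K; finite (carrier R) \<Longrightarrow>
        real (card Y) powr (1 + ln (2 / \<alpha>) / ln (ln (real (card Y)))) \<le> real (card (carrier R))\<rbrakk>
      \<Longrightarrow> real (card L) \<le> K ^ 13500"
proof -
  define G where "G = {g\<in>Aff. graph g \<in> L}"
  have GA: "G \<subseteq> Aff" by (auto simp: G_def)
  have img: "graph ` G = L"
  proof
    show "L \<subseteq> graph ` G"
    proof
      fix l assume l: "l \<in> L"
      then obtain a b where ab: "a \<in> carrier R" "b \<in> carrier R" "a \<noteq> \<zero>" "l = affine_graph R a b"
        using L by (auto simp: lines_def)
      then have "l = graph (aff a b)" by (simp add: graph_aff)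
      then show "l \<in> graph ` G" using ab l by (auto simp: G_def)
    qed
  qed (auto simp: G_def)
  have inj: "inj_on graph G" using inj_on_graph GA by (rule inj_on_subset)
  have card_L: "card L = card G" using card_image[OF inj] img by simp
  have hits: "\<alpha> * real (card Y) \<le> real (hits Y g)" if "g \<in> G" for g
    using rich[of "graph g"] that Y(1) by (simp add: G_def rich_def card_graph_Int)
  have slopes: "inj_on slope G"
  proof (rule inj_onI, rule ccontr)
    fix g h assume *: "g \<in> G" "h \<in> G" "slope g = slope h" "g \<noteq> h"
    then have A: "g \<in> Aff" "h \<in> Aff" using GA by auto
    have "graph g = affine_graph R (slope g) (app g \<zero>)" "graph h = affine_graph R (slope g) (app h \<zero>)"
      using A Aff_eq_aff *(3) graph_aff slope_in_carrier slope_nonzero Aff_app_in_carrier zero_closed by metis+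
    then have "parallel R (graph g) (graph h)"
      unfolding parallel_def using A slope_in_carrier Aff_app_in_carrier zero_closed by blast
    moreover have "graph g \<noteq> graph h" using * inj by (auto dest: inj_onD)
    ultimately show False using gp * by (auto simp: general_position_def G_def)
  qed
  have points: "finite {g\<in>G. app g x = y} \<and> card {g\<in>G. app g x = y} \<le> 2"
    if "x \<in> carrier R" for x y
  proof (rule finite_card_le_2)
    fix g h k assume *: "g \<in> {g\<in>G. app g x = y}" "h \<in> {g\<in>G. app g x = y}" "k \<in> {g\<in>G. app g x = y}"
      "g \<noteq> h" "h \<noteq> k" "g \<noteq> k"
    have "(x, y) \<in> graph g \<inter> graph h \<inter> graph k" using * that by (auto simp: mem_graph_iff)
    moreover have "graph g \<noteq> graph h" "graph h \<noteq> graph k" "graph g \<noteq> graph k"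
      using * inj by (auto dest: inj_onD)
    moreover have "graph g \<in> L" "graph h \<in> L" "graph k \<in> L" using * by (auto simp: G_def)
    ultimately show False using gp unfolding general_position_def by blast
  qed
  have cover: "G \<subseteq> (\<Union>q\<in>Y \<times> Y. {g\<in>G. app g (fst q) = snd q})"
  proof
    fix g assume g: "g \<in> G"
    have "0 < \<alpha> * real (card Y)" using \<alpha> Y by (simp add: card_gt_0_iff)
    with hits[OF g] have "hits Y g \<noteq> 0" by auto
    then obtain y where "y \<in> Y" "app g y \<in> Y" unfolding hits_def by (metis (mono_tags, lifting) card_eq_0_iff empty_Collect_eq)
    then show "g \<in> (\<Union>q\<in>Y \<times> Y. {g\<in>G. app g (fst q) = snd q})" using g by force
  qed
  have finU: "finite (\<Union>q\<in>Y \<times> Y. {g\<in>G. app g (fst q) = snd q})"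
    using Y points by (intro finite_UN_I) auto
  then have finG: "finite G" using cover finite_subset by blast
  then show "finite L" using img by blast
  have "card G \<le> card (\<Union>q\<in>Y \<times> Y. {g\<in>G. app g (fst q) = snd q})"
    using finU cover by (rule card_mono)
  also have "\<dots> \<le> (\<Sum>q\<in>Y \<times> Y. card {g\<in>G. app g (fst q) = snd q})"
    using Y by (intro card_UN_le) simp
  also have "\<dots> \<le> (\<Sum>q\<in>Y \<times> Y. 2)" using Y points by (intro sum_mono) auto
  also have "\<dots> = 2 * (card Y)\<^sup>2" by (simp add: card_cartesian_product power2_eq_square)
  finally show "card L \<le> 2 * (card Y)\<^sup>2" by (simp add: card_L)
  show "real (card L) \<le> K ^ 13500"
    if "good_parameters \<alpha> (card Y) I \<tau> K" "finite (carrier R) \<Longrightarrow>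
        real (card Y) powr (1 + ln (2 / \<alpha>) / ln (ln (real (card Y)))) \<le> real (card (carrier R))"
  proof (cases "G = {}")
    case True
    then show ?thesis using that by (simp add: card_L good_parameters_def)
  next
    case False
    show ?thesis
      unfolding card_L
      by (rule rich_lines_le[OF finG GA False slopes _ Y hits \<alpha>])
         (use that points in \<open>auto simp: good_parameters_def\<close>)
  qed
qed

end

text \<open>\<open>N0\<close> and \<open>B\<close> are supplied from outside the locale, so that the
  same constants can serve the complex numbers and all primes.\<close>

lemma (in affine_plane) card_general_position_le_uniform:
  assumes Y: "Y \<subseteq> carrier R" "card Y = N" "N > 0" and L: "L \<subseteq> lines R"
    and gp: "general_position R L" and rich: "\<forall>l\<in>L. rich \<alpha> Y l" and \<alpha>: "0 < \<alpha>"
    and p: "finite (carrier R) \<Longrightarrow>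
      real N powr (1 + ln (2 / \<alpha>) / ln (ln (real N))) \<le> real (card (carrier R))"
    and small: "N < N0 \<Longrightarrow> 2 * (real N)\<^sup>2 \<le> B"
    and large: "\<not> N < N0 \<Longrightarrow> \<exists>I \<tau> K. good_parameters \<alpha> N I \<tau> K \<and> K ^ 13500 \<le> B"
  shows "finite L \<and> real (card L) \<le> B"
proof -
  have Y': "finite Y" "Y \<noteq> {}" using Y by (auto intro: card_ge_0_finite)
  note bounds = card_general_position_le[OF Y(1) Y' L gp bspec[OF rich] \<alpha>]
  have "real (card L) \<le> B"
  proof (cases "N < N0")
    case True
    have "real (card L) \<le> real (2 * N\<^sup>2)" using bounds(2) Y(2) by (simp only: of_nat_le_iff)
    then show ?thesis using small[OF True] by simp
  next
    case False
    then obtain I \<tau> K where *: "good_parameters \<alpha> N I \<tau> K" "K ^ 13500 \<le> B" using large by blast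
    have "real (card L) \<le> K ^ 13500"
      using * p by (intro bounds(3)) (simp_all add: Y(2))
    with *(2) show ?thesis by simp
  qed
  with bounds(1) show ?thesis by simp
qed

section \<open>The complex numbers and the prime fields\<close>

lemma affine_plane_complex: "affine_plane (ring_of_type_algebra :: complex ring)"
proof (intro affine_plane.intro affine_plane_axioms.intro field_from_type_algebra)
  fix c :: complex and S
  assume c: "c \<noteq> \<zero>\<^bsub>ring_of_type_algebra\<^esub>" and S: "finite S" "\<zero>\<^bsub>ring_of_type_algebra\<^esub> \<in> S"
    "\<And>s. s \<in> S \<Longrightarrow> s \<oplus>\<^bsub>ring_of_type_algebra\<^esub> c \<in> S"
  \<comment> \<open>All multiples of \<open>c\<close> would lie in the finite set \<open>S\<close>,
    although they are distinct; the hypotheses are contradictory.\<close>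
  have "of_nat k * c \<in> S" for k
  proof (induction k)
    case (Suc k)
    have "of_nat (Suc k) * c = of_nat k * c + c" by (simp add: distrib_right)
    then show ?case using S(3)[OF Suc] by (simp add: ring_of_type_algebra_def)
  qed (use S(2) in \<open>simp add: ring_of_type_algebra_def\<close>)
  then have "range (\<lambda>k. of_nat k * c) \<subseteq> S" by auto
  moreover have "inj (\<lambda>k. of_nat k * c)" using c by (auto simp: inj_def ring_of_type_algebra_def)
  ultimately have "finite (UNIV :: nat set)" using S(1) finite_imageD finite_subset by blast
  then show "S = carrier ring_of_type_algebra" by simp
qed

lemma affine_plane_residue_ring:
  assumes "Factorial_Ring.prime p"
  shows "affine_plane (residue_ring (int p))"
proof -
  interpret residues_prime p "residue_ring (int p)"
    using assms by unfold_locales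
  show ?thesis
  proof (intro affine_plane.intro affine_plane_axioms.intro is_field)
    fix c and S
    assume c: "c \<in> carrier (residue_ring (int p))" "c \<noteq> \<zero>\<^bsub>residue_ring (int p)\<^esub>"
      and S: "S \<subseteq> carrier (residue_ring (int p))" "\<zero>\<^bsub>residue_ring (int p)\<^esub> \<in> S"
      "\<And>s. s \<in> S \<Longrightarrow> s \<oplus>\<^bsub>residue_ring (int p)\<^esub> c \<in> S"
    have mult: "(int k * c) mod int p \<in> S" for k
    proof (induction k)
      case 0
      then show ?case using S(2) by (simp add: res_zero_eq)
    next
      case (Suc k)
      have "(int k * c mod int p + c) mod int p \<in> S" using S(3)[OF Suc] by (simp add: res_add_eq)
      moreover have "int (Suc k) * c = int k * c + c" by (simp add: distrib_right)
      ultimately show ?case by (simp only: mod_add_left_eq)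
    qed
    have "0 < c" "c < int p" using c by (auto simp: res_carrier_eq res_zero_eq)
    then have "coprime c (int p)" by (simp add: p_coprime_right_int zdvd_not_zless)
    then obtain d where d: "[c * d = 1] (mod int p)" using cong_solve_coprime_int by blast
    show "S = carrier (residue_ring (int p))"
    proof
      show "carrier (residue_ring (int p)) \<subseteq> S"
      proof
        fix y assume "y \<in> carrier (residue_ring (int p))"
        then have y: "0 \<le> y" "y < int p" by (auto simp: res_carrier_eq)
        \<comment> \<open>With \<open>d\<close> the inverse of \<open>c\<close> modulo
          \<open>p\<close>, the residue \<open>y\<close> is reached from 0 by adding
          \<open>c\<close> this many times.\<close>
        define k where "k = nat ((y * d) mod int p)"
        have "int k = (y * d) mod int p" using prime_gt_0_nat[OF assms] by (simp add: k_def)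
        then have "(int k * c) mod int p = (y * d * c) mod int p" by (simp only: mod_mult_left_eq)
        also have "y * d * c = y * (c * d)" by simp
        also have "y * (c * d) mod int p = (y * 1) mod int p"
          by (rule mod_mult_cong[OF refl d[folded res_eq_to_cong]])
        also have "\<dots> = y" using y by simp
        finally show "y \<in> S" using mult[of k] by simp
      qed
    qed (use S in auto)
  qed
qed

section \<open>Choice of the parameters for large \<open>N\<close>\<close>

lemma eventually_parameters:
  fixes \<alpha> :: real
  assumes "0 < \<alpha>" "\<alpha> < 1"
  shows "\<exists>N0. \<forall>N\<ge>N0. \<exists>I \<tau> K. good_parameters \<alpha> N I \<tau> K \<and>
    K ^ 13500 \<le> real N powr (324000 / ln (ln (real N)))"
proof -
  define \<beta> where "\<beta> = - ln \<alpha>"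
  define \<gamma> where "\<gamma> = ln (2 / \<alpha>)"
  have \<beta>: "\<beta> > 0" "\<alpha> = exp (- \<beta>)" using assms by (simp_all add: \<beta>_def)
  have \<gamma>: "\<gamma> > 0" using assms by (simp add: \<gamma>_def)
  \<comment> \<open>Here \<open>x\<close> stands for \<open>ln N\<close>. The first condition keeps
    the rounding in \<open>I\<close> harmless, the second yields \<open>1 \<le> K * \<tau>\<close>,
    the third \<open>2 \<le> \<tau> * N\<close> and the forced slow step, and the fourth the
    comparison of \<open>N\<close> with \<open>p\<close>.\<close>
  have "\<forall>\<^sub>F x in at_top. 8 \<le> ln (x :: real)" by real_asymp
  moreover have "\<forall>\<^sub>F x in at_top. ln 2 + \<beta> * sqrt x \<le> 12 * x / ln x" using \<beta> by real_asymp
  moreover have "\<forall>\<^sub>F x in at_top. ln 2 + 4 * (ln 2 + \<beta> * sqrt x) \<le> x" using \<beta> by real_asymp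
  moreover have "\<forall>\<^sub>F x in at_top. ln 4 + \<beta> * sqrt x \<le> \<gamma> * x / ln x" using \<beta> \<gamma> by real_asymp
  ultimately have "\<forall>\<^sub>F x in at_top. 8 \<le> ln x \<and> ln 2 + \<beta> * sqrt x \<le> 12 * x / ln x \<and>
      ln 2 + 4 * (ln 2 + \<beta> * sqrt x) \<le> x \<and> ln 4 + \<beta> * sqrt x \<le> \<gamma> * x / ln x"
    by (simp add: eventually_conj_iff)
  moreover have "filterlim (\<lambda>N. ln (real N)) at_top sequentially" by real_asymp
  ultimately have "\<forall>\<^sub>F N in sequentially. 8 \<le> ln (ln (real N)) \<and>
      ln 2 + \<beta> * sqrt (ln (real N)) \<le> 12 * ln (real N) / ln (ln (real N)) \<and>
      ln 2 + 4 * (ln 2 + \<beta> * sqrt (ln (real N))) \<le> ln (real N) \<and>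
      ln 4 + \<beta> * sqrt (ln (real N)) \<le> \<gamma> * ln (real N) / ln (ln (real N))"
    by (rule eventually_compose_filterlim)
  then obtain N1 where N1: "\<And>N. N \<ge> N1 \<Longrightarrow> 8 \<le> ln (ln (real N)) \<and>
      ln 2 + \<beta> * sqrt (ln (real N)) \<le> 12 * ln (real N) / ln (ln (real N)) \<and>
      ln 2 + 4 * (ln 2 + \<beta> * sqrt (ln (real N))) \<le> ln (real N) \<and>
      ln 4 + \<beta> * sqrt (ln (real N)) \<le> \<gamma> * ln (real N) / ln (ln (real N))"
    unfolding eventually_sequentially by blast
  show ?thesis
  proof (rule exI[of _ "max N1 2"], intro allI impI)
    fix N assume "max N1 2 \<le> N"
    then have N: "N \<ge> N1" "real N \<ge> 2" by auto
    define x where "x = ln (real N)"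
    define y where "y = ln x"
    define w where "w = \<beta> * sqrt x"
    have E: "8 \<le> y" "ln 2 + w \<le> 12 * x / y" "ln 2 + 4 * (ln 2 + w) \<le> x" "ln 4 + w \<le> \<gamma> * x / y"
      using N1[OF N(1)] by (simp_all add: x_def y_def w_def)
    have x0: "x > 0" using N by (simp add: x_def)
    have Nx: "real N = exp x" using N by (simp add: x_def)
    have w0: "w \<ge> 0" using \<beta> x0 by (simp add: w_def)
    have yx: "y \<le> x" unfolding y_def using ln_less_self[OF x0] by simp
    \<comment> \<open>\<open>2 * I\<close> is at most \<open>y / 2\<close>, so
      \<open>2 ^ (2 * I) \<le> exp (y / 2) = sqrt x\<close>. Since \<open>y \<ge> 8\<close>,
      rounding down \<open>y / 4\<close> still leaves at least \<open>y / 8\<close>.\<close>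
    define I where "I = nat \<lfloor>y / 4\<rfloor>"
    have I: "real I \<le> y / 4" "y / 8 \<le> real I" "I > 0"
      using E(1) unfolding I_def by linarith+
    define \<tau> where "\<tau> = exp (- w) / 2"
    \<comment> \<open>Then \<open>K ^ I\<close> is the cube of \<open>N\<close>: two factors pay for
      \<open>N\<^sup>2\<close>, the third for the constant 2 and \<open>\<tau> ^ 4\<close>.\<close>
    define K where "K = exp (3 * x / real I)"
    have three_x: "12 * x / y \<le> 3 * x / real I"
    proof -
      have "3 * x / (y / 4) \<le> 3 * x / real I"
        using I x0 by (intro divide_left_mono mult_pos_pos) auto
      then show ?thesis by (simp add: field_simps)
    qed
    have \<tau>_exp: "\<tau> = exp (- w - ln 2)" by (simp add: \<tau>_def exp_diff)
    have ln4: "ln 4 = 2 * ln (2 :: real)" using ln_realpow[of 2 2] by simp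
    have "real (2 ^ (2 * I)) \<le> sqrt x"
    proof -
      have "real (2 ^ (2 * I)) = exp (real (2 * I) * ln 2)" by (subst exp_of_nat_mult) simp
      also have "\<dots> \<le> exp (y / 2)"
      proof -
        have "real (2 * I) * ln 2 \<le> real (2 * I) * 1"
          using ln_2_less_1 by (intro mult_left_mono) auto
        also have "\<dots> \<le> y / 2" using I by simp
        finally show ?thesis by simp
      qed
      also have "\<dots> = sqrt x"
      proof -
        have "exp (y / 2) ^ 2 = x" using x0 by (simp add: y_def flip: exp_of_nat_mult)
        then show ?thesis by (metis exp_ge_zero real_sqrt_unique)
      qed
      finally show ?thesis .
    qed
    then have "\<beta> * real (2 ^ (2 * I)) \<le> w" using \<beta> by (simp add: w_def)
    moreover have "\<alpha> ^ (2 ^ (2 * I)) = exp (- (\<beta> * real (2 ^ (2 * I))))"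
      unfolding \<beta>(2) by (subst exp_of_nat_mult[symmetric]) (simp add: mult.commute)
    ultimately have c1: "2 * \<tau> \<le> \<alpha> ^ (2 ^ (2 * I))" by (simp add: \<tau>_def)
    have ln2: "ln 2 > (0 :: real)" by simp
    have c2: "2 \<le> \<tau> * real N"
    proof -
      have "5 * ln 2 + 4 * w \<le> x" using E(3) by simp
      then have "2 * ln 2 + w \<le> x" using w0 ln2 by linarith
      then have "ln 2 \<le> x + (- w - ln 2)" by simp
      then have "exp (ln 2) \<le> exp (x + (- w - ln 2))" by (simp only: exp_le_cancel_iff)
      then show ?thesis by (simp add: \<tau>_exp Nx exp_add mult.commute)
    qed
    have "1 \<le> 12 * x / y" using yx E(1) x0 by (simp add: field_simps)
    then have c3: "2 \<le> K"
      using three_x exp_ge_add_one_self[of "3 * x / real I"] unfolding K_def by linarith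
    have c4: "1 \<le> K * \<tau>"
    proof -
      have "0 \<le> 3 * x / real I + (- w - ln 2)" using three_x E(2) by linarith
      then have "exp 0 \<le> exp (3 * x / real I + (- w - ln 2))" by (simp only: exp_le_cancel_iff)
      then show ?thesis by (simp add: K_def \<tau>_exp exp_add)
    qed
    have KI: "K ^ I = exp (3 * x)" using I(3) by (simp add: K_def flip: exp_of_nat_mult)
    have c5: "2 * (real N)\<^sup>2 \<le> K ^ I * \<tau> ^ 4"
    proof -
      have "2 * (real N)\<^sup>2 = exp (ln 2 + 2 * x)" by (simp add: Nx exp_add flip: exp_of_nat_mult)
      also have "\<dots> \<le> exp (3 * x + 4 * (- w - ln 2))" using E(3) by simp
      also have "\<dots> = K ^ I * \<tau> ^ 4" by (simp add: KI \<tau>_exp exp_add flip: exp_of_nat_mult)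
      finally show ?thesis .
    qed
    have c6: "2 * real N \<le> \<tau> * p" if "real N powr (1 + ln (2 / \<alpha>) / ln (ln (real N))) \<le> p" for p
    proof -
      have "2 * real N = exp (ln 2 + x)" by (simp add: Nx exp_add)
      also have "\<dots> \<le> exp ((- w - ln 2) + (x + \<gamma> * x / y))" using E(4) ln4 by simp
      also have "\<dots> = \<tau> * real N powr (1 + \<gamma> / y)"
        using N by (simp add: \<tau>_exp powr_def x_def[symmetric] exp_add distrib_right)
      also have "\<dots> \<le> \<tau> * p"
        using that by (intro mult_left_mono) (simp_all add: \<gamma>_def y_def x_def \<tau>_def)
      finally show ?thesis .
    qed
    have c7: "K ^ 13500 \<le> real N powr (324000 / ln (ln (real N)))"
    proof -
      have "K ^ 13500 = exp (13500 * (3 * x / real I))" by (simp add: K_def flip: exp_of_nat_mult)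
      also have "\<dots> \<le> exp (324000 / y * x)"
      proof -
        \<comment> \<open>From \<open>I \<ge> y / 8\<close> follows the final constant 324000 =
          13500 * 3 * 8.\<close>
        have "3 * x / real I \<le> 3 * x / (y / 8)"
          using I x0 E(1) by (intro divide_left_mono mult_pos_pos) auto
        then have "13500 * (3 * x / real I) \<le> 13500 * (3 * x / (y / 8))" by (rule mult_left_mono) simp
        then show ?thesis by (simp add: mult.commute)
      qed
      also have "\<dots> = real N powr (324000 / ln (ln (real N)))"
        using N by (simp add: powr_def x_def y_def)
      finally show ?thesis .
    qed
    have "good_parameters \<alpha> N I \<tau> K"
      unfolding good_parameters_def using I(3) c1 c2 c3 c4 c5 c6 by (auto simp: \<tau>_def)
    then show "\<exists>I \<tau> K. good_parameters \<alpha> N I \<tau> K \<and>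
        K ^ 13500 \<le> real N powr (324000 / ln (ln (real N)))"
      using c7 by blast
  qed
qed

theorem theorem3p2:
  fixes \<alpha> :: real
  assumes "0 < \<alpha>" and "\<alpha> < 1"
  shows "\<exists>C>0. \<exists>c>0. \<forall>N::nat. N > 0 \<longrightarrow>
    (\<forall>(Y :: complex set) L.
       card Y = N \<and>
       L \<subseteq> lines ring_of_type_algebra \<and>
       general_position ring_of_type_algebra L \<and>
       (\<forall>l\<in>L. rich \<alpha> Y l) \<longrightarrow>
       finite L \<and> real (card L) \<le> c * real N powr (C / ln (ln (real N)))) \<and>
    (\<forall>(p::nat) Y L.
       Factorial_Ring.prime p \<and>
       Y \<subseteq> carrier (residue_ring (int p)) \<and> card Y = N \<and>
       L \<subseteq> lines (residue_ring (int p)) \<and>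
       general_position (residue_ring (int p)) L \<and>
       (\<forall>l\<in>L. rich \<alpha> Y l) \<and>
       real N powr (1 + ln (2 / \<alpha>) / ln (ln (real N))) \<le> real p \<longrightarrow>
       finite L \<and> real (card L) \<le> c * real N powr (C / ln (ln (real N))))"
proof -
  define f where "f N = real N powr (324000 / ln (ln (real N)))" for N
  obtain N0 where N0: "\<And>N. N \<ge> N0 \<Longrightarrow> \<exists>I \<tau> K. good_parameters \<alpha> N I \<tau> K \<and> K ^ 13500 \<le> f N"
    using eventually_parameters[OF assms] unfolding f_def by blast
  \<comment> \<open>For small \<open>N\<close> the exponent in \<open>f\<close> may be negative or,
    at \<open>N = 1\<close>, a default value, but \<open>f N\<close> stays positive. The sum over
    \<open>N\<close> below \<open>N0\<close> therefore lets \<open>c * f N\<close> dominate the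
    quadratic bound.\<close>
  define c where "c = 1 + (\<Sum>N\<in>{0<..<N0}. 2 * (real N)\<^sup>2 / f N)"
  have f: "f N > 0" if "N > 0" for N using that by (simp add: f_def)
  have "(\<Sum>N\<in>{0<..<N0}. 2 * (real N)\<^sup>2 / f N) \<ge> 0"
    by (intro sum_nonneg) (simp add: f_def)
  then have c: "c \<ge> 1" by (simp add: c_def)
  have small: "2 * (real N)\<^sup>2 \<le> c * f N" if "N > 0" "N < N0" for N
  proof -
    have "2 * (real N)\<^sup>2 / f N \<le> (\<Sum>N\<in>{0<..<N0}. 2 * (real N)\<^sup>2 / f N)"
      using that by (intro member_le_sum) (auto simp: f_def)
    then have "2 * (real N)\<^sup>2 / f N \<le> c" by (simp add: c_def)
    then show ?thesis using f[OF that(1)] by (simp add: divide_le_eq)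
  qed
  have large: "\<exists>I \<tau> K. good_parameters \<alpha> N I \<tau> K \<and> K ^ 13500 \<le> c * f N" if "N > 0" "\<not> N < N0" for N
  proof -
    have "f N \<le> c * f N" using c f[OF that(1)] by simp
    then show ?thesis using N0[of N] that(2) by (meson not_less order_trans)
  qed
  show ?thesis
  proof (rule exI[of _ 324000], rule conjI, simp, rule exI[of _ c], intro conjI allI impI; (elim conjE)?)
    show "0 < c" using c by simp
  next
    fix N :: nat and Y :: "complex set" and L
    assume *: "N > 0" "card Y = N" "L \<subseteq> lines ring_of_type_algebra" "general_position ring_of_type_algebra L"
      "\<forall>l\<in>L. rich \<alpha> Y l"
    have car: "carrier (ring_of_type_algebra :: complex ring) = UNIV" by (simp add: ring_of_type_algebra_def)
    have "finite L \<and> real (card L) \<le> c * f N"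
      by (rule affine_plane.card_general_position_le_uniform[OF affine_plane_complex
            _ *(2,1,3,4,5) assms(1) _ small[OF *(1)] large[OF *(1)]])
         (simp_all add: car infinite_UNIV_char_0)
    then show "finite L" "real (card L) \<le> c * real N powr (324000 / ln (ln (real N)))"
      by (simp_all add: f_def)
  next
    fix N p :: nat and Y L
    assume *: "N > 0" "Factorial_Ring.prime p" "Y \<subseteq> carrier (residue_ring (int p))" "card Y = N"
      "L \<subseteq> lines (residue_ring (int p))" "general_position (residue_ring (int p)) L"
      "\<forall>l\<in>L. rich \<alpha> Y l"
      "real N powr (1 + ln (2 / \<alpha>) / ln (ln (real N))) \<le> real p"
    have "card (carrier (residue_ring (int p))) = p" by (simp add: residue_ring_def)
    then have "finite L \<and> real (card L) \<le> c * f N"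
      using *(8)
      by (intro affine_plane.card_general_position_le_uniform[OF affine_plane_residue_ring[OF *(2)]
            *(3,4,1,5,6,7) assms(1) _ small[OF *(1)] large[OF *(1)]]) simp
    then show "finite L" "real (card L) \<le> c * real N powr (324000 / ln (ln (real N)))"
      by (simp_all add: f_def)
  qed
qed

end
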